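(* Let $p(n)$ denote the number of partitions of $n$. For every positive integer $n$, $$p(n) = \frac{1}{\pi \sqrt{2}} \sum_{c=1}^{\infty} A_c(n) \sqrt{c}\, \frac{d}{dn} \left[ \frac{\sinh\left( \mu \sqrt{n - 1/24}\,/c \right)}{\sqrt{n - 1/24}} \right],$$ where $\mu = \pi \sqrt{2/3}$ and $A_c(n) = e^{\pi i/4} A(-1/24,\, n - 1/24;\, c)$, with $A(\cdot,\cdot;c)$ the generalized Kloosterman sum defined in the context. (Here $\frac{d}{dn}[\cdot]$ means the derivative of the bracketed expression regarded as a function of a real variable, evaluated at the integer $n$.)
   Context: $p(n)$ is the number of ways to write $n>0$ as an unordered sum of positive integers, with $p(0)=1$; equivalently $\sum_{n\ge 0} p(n) q^n = \prod_{n\ge 1} (1-q^n)^{-1}$. Let $\mathbb{H} = \{x+iy : y>0\}$, $q = e^{2\pi i \tau}$ for $\tau\in\mathbb{H}$ (with $q^{s} = e^{2\pi i s\tau}$), $\Gamma = SL_2(\mathbb{Z})$ acting on $\mathbb{H}$ by Möbius transformations. Roots and powers of $z\in\mathbb{C}^\times$ are taken with $-\pi \le \arg z < \pi$. The Dedekind eta-function is $\eta(\tau) = q^{1/24}\prod_{n=1}^\infty (1-q^n)$. The eta multiplier $v_\eta$ is the function from $\Gamma$ to the 24th roots of unity determined by $$\eta(M\tau) = v_\eta(M)\sqrt{c\tau+d}\;\eta(\tau)\quad\text{for all } \tau\in\mathbb{H},\ M = \begin{pmatrix} * & * \\ c & d\end{pmatrix}\in\Gamma .$$ For $m \in \frac{1}{24}\mathbb{Z}$,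 $n\in \mathbb{Z}+m$ and a positive integer $c$, the generalized Kloosterman sum is $$A(m,n;c) = \sum_{\substack{d \ (\mathrm{mod}\ c)\\ (c,d)=1}} v_\eta(M)^{-24m}\, e^{2\pi i \frac{ma+nd}{c}},$$ where for each $d$ in a set of representatives of the residue classes modulo $c$ coprime to $c$, $M = \begin{pmatrix} a & * \\ c & d\end{pmatrix}$ is any element of $\Gamma$ with lower row $(c,d)$, and $a$ is its upper left entry (the summand does not depend on the choices). *)

theory Defs
  imports "HOL-Analysis.Analysis" "HOL-Library.Multiset"
begin

definition partition_count :: "nat \<Rightarrow> nat"
  where "partition_count n = card {P :: nat multiset. 0 \<notin># P \<and> sum_mset P = n}"

definition upper_half_plane :: "complex set"
  where "upper_half_plane = {\<tau>. Im \<tau> > 0}"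

definition SL2Z :: "(int ^ 2 ^ 2) set"
  where "SL2Z = {M. det M = 1}"

definition moebius :: "int ^ 2 ^ 2 \<Rightarrow> complex \<Rightarrow> complex"
  where "moebius M \<tau> =
    (of_int (M $ 1 $ 1) * \<tau> + of_int (M $ 1 $ 2)) / (of_int (M $ 2 $ 1) * \<tau> + of_int (M $ 2 $ 2))"

text \<open>
  The argument is normalised to \<open>- pi \<le> arg z < pi\<close>, whereas the library's \<^const>\<open>Arg\<close> takes
  values in \<open>{- pi <.. pi}\<close>. Hence \<open>branch_sqrt\<close> differs from \<^const>\<open>csqrt\<close> on the negative real
  axis, which matters for matrices with lower row \<open>(0, -1)\<close>.
\<close>
definition branch_arg :: "complex \<Rightarrow> real"
  where "branch_arg z = (if Arg z = pi then - pi else Arg z)"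

definition branch_sqrt :: "complex \<Rightarrow> complex"
  where "branch_sqrt z = of_real (sqrt (norm z)) * exp (\<i> * of_real (branch_arg z / 2))"

definition q_power :: "real \<Rightarrow> complex \<Rightarrow> complex"
  where "q_power s \<tau> = exp (2 * of_real pi * \<i> * of_real s * \<tau>)"

definition dedekind_eta :: "complex \<Rightarrow> complex"
  where "dedekind_eta \<tau> = q_power (1 / 24) \<tau> * prodinf (\<lambda>n. 1 - q_power 1 \<tau> ^ Suc n)"

definition eta_multiplier :: "int ^ 2 ^ 2 \<Rightarrow> complex"
  where "eta_multiplier M = (THE v. v ^ 24 = 1 \<and>
    (\<forall>\<tau>\<in>upper_half_plane. dedekind_eta (moebius M \<tau>) =
       v * branch_sqrt (of_int (M $ 2 $ 1) * \<tau> + of_int (M $ 2 $ 2)) * dedekind_eta \<tau>))"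

text \<open>
  The sum is meant for \<open>24 * m \<in> \<int>\<close>, \<open>n - m \<in> \<int>\<close> and \<open>c > 0\<close>. For such \<open>m\<close> the floor is exactly
  the integer \<open>- 24 * m\<close>, and the summand depends neither on the choice of the matrix with lower
  row \<open>(c, d)\<close> nor on the representative \<open>d\<close> modulo \<open>c\<close>.
\<close>
definition kloosterman_sum :: "real \<Rightarrow> real \<Rightarrow> nat \<Rightarrow> complex"
  where "kloosterman_sum m n c =
    (\<Sum>d\<in>{d \<in> {0..<int c}. coprime (int c) d}.
       let M = (SOME M. M \<in> SL2Z \<and> M $ 2 $ 1 = int c \<and> M $ 2 $ 2 = d)
       in eta_multiplier M powi \<lfloor>- 24 * m\<rfloor> *
          exp (2 * of_real pi * \<i> * of_real ((m * of_int (M $ 1 $ 1) + n * of_int d) / real c)))"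

definition rademacher_A :: "nat \<Rightarrow> nat \<Rightarrow> complex"
  where "rademacher_A c n =
    exp (of_real pi * \<i> / 4) * kloosterman_sum (- 1 / 24) (real n - 1 / 24) c"

definition rademacher_term :: "nat \<Rightarrow> nat \<Rightarrow> complex"
  where "rademacher_term n c = rademacher_A c n * of_real (sqrt (real c)) *
    of_real (deriv (\<lambda>x :: real. sinh (pi * sqrt (2 / 3) * sqrt (x - 1 / 24) / real c)
                                  / sqrt (x - 1 / 24)) (real n))"

end

theory Submission
  imports
    Defs
    "HOL-Complex_Analysis.Complex_Analysis"
    "HOL-Probability.Sinc_Integral"
    "HOL-Real_Asymp.Real_Asymp"
begin

text \<open>
  Let \<open>g \<tau> = q\<^sup>-\<^sup>n / \<Prod>(1 - q\<^sup>m)\<close>. The sum of \<open>g (M \<tau>) / (c \<tau> + d)\<^sup>2\<close> over the coprime pairs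
  \<open>(c, d)\<close> converges absolutely, because \<open>\<bar>\<eta> (M \<tau>)\<bar> = \<bar>c \<tau> + d\<bar>\<^sup>1\<^sup>/\<^sup>2 \<bar>\<eta> \<tau>\<bar>\<close> makes the terms of size
  \<open>\<bar>c \<tau> + d\<bar>\<^sup>-\<^sup>5\<^sup>/\<^sup>2\<close>, and it is modular of weight 2. Hence its integral over a horizontal segment of
  length 1 vanishes. The terms with \<open>c = 0\<close> contribute \<open>p(n)\<close>. In the others the factor
  \<open>1 / \<Prod>(1 - q\<^sup>m) = 1 + O(q)\<close> can be dropped in the limit \<open>Im \<tau> \<rightarrow> \<infinity>\<close>. What remains unfolds, for
  each \<open>c\<close> and each residue \<open>d\<close> modulo \<open>c\<close>, to an integral of
  \<open>s\<^sup>-\<^sup>5\<^sup>/\<^sup>2 exp (\<alpha> s + \<beta> / s)\<close> over a vertical line, which is a Bessel function of order 3/2, and the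
  eta multipliers assemble to the Kloosterman sum.
\<close>

text \<open>For the full series P over coprime pairs, P(tau) d tau is an invariant differential;
  this is what weight 2 is for, and its vanishing period takes the place of a dissection by Farey
  fractions. The obstacle is that the integrals of the terms with c > 0 are not Bessel integrals as
  they stand. By the eta transformation each of them has eta(tau) in the denominator, the same
  factor for all (c, d), and with it the whole Euler product at tau. \<open>poincare_phi\<close>
  cancels that one product and leaves a power times elementary exponentials. The modified sum no
  longer integrates to exactly - p(n), but its integral is known in closed form at every height y
  and does not depend on y. The error is at most a constant times exp(pi y / 12) exp(- 2 pi y),
  where the first factor is the growth of q^(-1/24) and the second the size of 1 / prod(1 - q^m) -
  1. Hence letting y grow removes it. Convergence involves only |eta|, which the law for eta^24
  controls; the multiplier and its square root serve to identify the Kloosterman sum. The law for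
  eta^24 itself comes from the Eisenstein series of weight 2, where conditional convergence is the
  difficulty.\<close>

section \<open>Partitions and the Euler product\<close>

text \<open>With parts bounded by m the generating function is the inverse of a finite product, so
  the identity can be proved formally, before any limit.\<close>

definition bounded_partitions :: "nat \<Rightarrow> nat \<Rightarrow> nat multiset set"
  where "bounded_partitions m n = {P. set_mset P \<subseteq> {1..m} \<and> sum_mset P = n}"

lemma bounded_partitions_0: "bounded_partitions 0 n = (if n = 0 then {{#}} else {})"
  by (auto simp: bounded_partitions_def)

text \<open>Either the part m + 1 does not occur, or one copy of it can be removed; the rest may
  contain it again, so the second set keeps the bound m + 1.\<close>

lemma bounded_partitions_Suc:
  "bounded_partitions (Suc m) n = bounded_partitions m n \<union>
     (if Suc m \<le> n then add_mset (Suc m) ` bounded_partitions (Suc m) (n - Suc m) else {})"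
proof (intro equalityI subsetI)
  fix P assume P: "P \<in> bounded_partitions (Suc m) n"
  show "P \<in> bounded_partitions m n \<union>
     (if Suc m \<le> n then add_mset (Suc m) ` bounded_partitions (Suc m) (n - Suc m) else {})"
  proof (cases "Suc m \<in># P")
    case True
    then obtain Q where Q: "P = add_mset (Suc m) Q" by (metis mset_add)
    with P show ?thesis by (auto simp: bounded_partitions_def)
  next
    case False
    hence "x \<le> m" if "x \<in># P" for x
      using P that by (force simp: bounded_partitions_def le_Suc_eq)
    with P show ?thesis by (force simp: bounded_partitions_def)
  qed
next
  fix P assume "P \<in> bounded_partitions m n \<union>
     (if Suc m \<le> n then add_mset (Suc m) ` bounded_partitions (Suc m) (n - Suc m) else {})"
  thus "P \<in> bounded_partitions (Suc m) n"
    by (force simp: bounded_partitions_def split: if_splits)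
qed

lemma finite_bounded_partitions [simp, intro]: "finite (bounded_partitions m n)"
\<comment> \<open>The recursion leads to (k, n) and to (Suc k, n - Suc k); the sum of the two
  arguments decreases in both.\<close>
proof (induction "m + n" arbitrary: m n rule: less_induct)
  case less
  show ?case
  proof (cases m)
    case 0
    thus ?thesis by (simp add: bounded_partitions_0)
  next
    case (Suc k)
    thus ?thesis using less by (subst Suc, subst bounded_partitions_Suc) auto
  qed
qed

lemma card_bounded_partitions_Suc:
  "card (bounded_partitions (Suc m) n) = card (bounded_partitions m n) +
     (if Suc m \<le> n then card (bounded_partitions (Suc m) (n - Suc m)) else 0)"
proof -
  have "P \<notin> bounded_partitions m n" if "Suc m \<in># P" for P
    using that by (force simp: bounded_partitions_def)
  hence "bounded_partitions m n \<inter> add_mset (Suc m) ` bounded_partitions (Suc m) (n - Suc m) = {}"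
    by auto
  thus ?thesis
    by (subst bounded_partitions_Suc) (auto simp: card_Un_disjoint card_image inj_on_def)
qed

lemma partition_count_eq_bounded:
  assumes "n \<le> m"
  shows "partition_count n = card (bounded_partitions m n)"
proof -
  have "x \<le> m" if "x \<in># P" "sum_mset P = n" for x P
    using that assms by (metis le_add1 le_trans mset_add sum_mset.add_mset)
  moreover have "0 < x" if "x \<in># P" "0 \<notin># P" for x and P :: "nat multiset"
    using that by (cases x) auto
  ultimately have "{P. 0 \<notin># P \<and> sum_mset P = n} = bounded_partitions m n"
    by (fastforce simp: bounded_partitions_def)
  thus ?thesis by (simp add: partition_count_def)
qed

text \<open>The recurrence of \<open>card_bounded_partitions_Suc\<close> says that multiplying by 1
  - X^(m+1) forbids the part m + 1, so the factors strip off the parts one by one.\<close>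

lemma fps_bounded_partitions:
  "Abs_fps (\<lambda>n. of_nat (card (bounded_partitions m n))) * (\<Prod>k<m. 1 - fps_X ^ Suc k) =
     (1 :: complex fps)"
proof (induction m)
  case 0
  show ?case by (auto simp: fps_eq_iff bounded_partitions_0)
next
  case (Suc m)
  have "Abs_fps (\<lambda>n. of_nat (card (bounded_partitions (Suc m) n))) * (1 - fps_X ^ Suc m) =
          (Abs_fps (\<lambda>n. of_nat (card (bounded_partitions m n))) :: complex fps)"
  proof (rule fps_ext)
    fix n
    show "fps_nth (Abs_fps (\<lambda>n. of_nat (card (bounded_partitions (Suc m) n))) * (1 - fps_X ^ Suc m)) n =
          fps_nth (Abs_fps (\<lambda>n. of_nat (card (bounded_partitions m n))) :: complex fps) n"
      by (subst ring_distribs, subst fps_sub_nth, subst fps_X_power_mult_right_nth)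
         (simp add: card_bounded_partitions_Suc[of m n])
  qed
  with Suc show ?case
    unfolding prod.lessThan_Suc by (metis (no_types, lifting) mult.assoc mult.commute)
qed

section \<open>The Euler product as a holomorphic function on the unit disc\<close>

definition euler_prod :: "complex \<Rightarrow> complex"
  where "euler_prod q = (\<Prod>n. 1 - q ^ Suc n)"

text \<open>On the disc of radius r the factors differ from 1 by at most r^(k+1), so the Weierstrass
  test applies. Uniformity later transfers holomorphy, Taylor coefficients and the logarithmic
  derivative to the limit.\<close>

lemma uniform_limit_euler_prod:
  assumes "r < 1"
  shows "uniform_limit (cball 0 r) (\<lambda>n q. \<Prod>k<n. 1 - q ^ Suc k) euler_prod sequentially"
proof -
  have "uniformly_convergent_on (cball 0 r) (\<lambda>n q :: complex. \<Prod>k<n. 1 - q ^ Suc k)"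
  proof (rule uniformly_convergent_on_prod')
    show "uniformly_convergent_on (cball 0 r) (\<lambda>N x. \<Sum>n<N. norm (1 - x ^ Suc n - 1 :: complex))"
    proof (cases "r \<ge> 0")
      case True
      show ?thesis
      proof (rule Weierstrass_m_test')
        show "norm (norm (1 - x ^ Suc n - 1)) \<le> r ^ Suc n" if "x \<in> cball 0 r" for n and x :: complex
          using that by (simp add: norm_power power_mono del: power_Suc)
        show "summable (\<lambda>n. r ^ Suc n)"
          using assms True by (simp add: summable_geometric)
      qed
    next
      \<comment> \<open>For negative r the disc is empty.\<close>
      case False
      hence "cball (0::complex) r = {}" by simp
      thus ?thesis by (simp add: uniformly_convergent_on_def)
    qed
  qed (auto intro!: continuous_intros)
  then obtain P where P: "uniform_limit (cball 0 r) (\<lambda>n q :: complex. \<Prod>k<n. 1 - q ^ Suc k) P sequentially"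
    by (auto simp: uniformly_convergent_on_def)
  have "P q = euler_prod q" if q: "q \<in> cball 0 r" for q
  proof -
    have "(\<lambda>n. \<Prod>k<n. 1 - q ^ Suc k) \<longlonglongrightarrow> P q"
      using P q by (rule tendsto_uniform_limitI)
    moreover have "convergent_prod (\<lambda>n. 1 - q ^ Suc n)"
    proof (rule abs_convergent_prod_imp_convergent_prod, rule summable_imp_abs_convergent_prod)
      have "norm q < 1" using q assms by simp
      thus "summable (\<lambda>n. norm (1 - q ^ Suc n - 1))"
        using summable_geometric[of "norm q"] by (simp add: norm_power norm_mult summable_mult)
    qed
    hence "(\<lambda>n. \<Prod>k<n. 1 - q ^ Suc k) \<longlonglongrightarrow> euler_prod q"
      unfolding euler_prod_def by (subst LIMSEQ_lessThan_iff_atMost) (rule convergent_prod_LIMSEQ)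
    ultimately show ?thesis by (rule LIMSEQ_unique)
  qed
  thus ?thesis using P by (metis (no_types, lifting) uniform_limit_cong')
qed

lemma holomorphic_euler_prod: "euler_prod holomorphic_on ball 0 1"
proof (rule holomorphic_uniform_sequence)
  show "\<exists>d>0. cball x d \<subseteq> ball 0 1 \<and>
          uniform_limit (cball x d) (\<lambda>n q. \<Prod>k<n. 1 - q ^ Suc k) euler_prod sequentially"
    if "x \<in> ball (0::complex) 1" for x
  proof (intro exI conjI)
    define d where "d = (1 - norm x) / 2"
    have d: "cball x d \<subseteq> cball 0 ((1 + norm x) / 2)"
    proof
      fix y assume "y \<in> cball x d"
      thus "y \<in> cball 0 ((1 + norm x) / 2)"
        using norm_triangle_sub[of y x] by (simp add: d_def dist_norm norm_minus_commute field_simps)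
    qed
    show "d > 0" using that by (simp add: d_def)
    show "cball x d \<subseteq> ball 0 1" using d that by (auto simp: subset_iff)
    show "uniform_limit (cball x d) (\<lambda>n q. \<Prod>k<n. 1 - q ^ Suc k) euler_prod sequentially"
      by (rule uniform_limit_on_subset[OF uniform_limit_euler_prod d]) (use that in simp)
  qed
qed (auto intro!: holomorphic_intros)

lemma euler_prod_nonzero:
  assumes "norm q < 1"
  shows "euler_prod q \<noteq> 0"
  unfolding euler_prod_def
proof (rule prodinf_nonzero)
  show "convergent_prod (\<lambda>n. 1 - q ^ Suc n)"
  proof (rule abs_convergent_prod_imp_convergent_prod, rule summable_imp_abs_convergent_prod)
    show "summable (\<lambda>n. norm (1 - q ^ Suc n - 1))"
      using summable_geometric[of "norm q"] assms by (simp add: norm_power norm_mult summable_mult)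
  qed
  show "1 - q ^ Suc n \<noteq> 0" for n
  proof
    assume "1 - q ^ Suc n = 0"
    hence "norm q ^ Suc n = 1" by (metis eq_iff_diff_eq_0 norm_one norm_power)
    moreover have "norm q ^ Suc n < 1" using assms by (simp add: power_less_one_iff del: power_Suc)
    ultimately show False by simp
  qed
qed

text \<open>A factor 1 - X^(j+1) with j >= m affects coefficients only from index m + 1 on, so each
  coefficient of the partial products is eventually constant.\<close>

lemma fps_nth_prod_stable:
  assumes "i < m" "m \<le> k"
  shows "fps_nth (\<Prod>j<k. 1 - fps_X ^ Suc j) i = fps_nth ((\<Prod>j<m. 1 - fps_X ^ Suc j) :: complex fps) i"
  using assms(2)
proof (induction k rule: dec_induct)
  case (step k)
  have "fps_nth (\<Prod>j<Suc k. 1 - fps_X ^ Suc j) i = fps_nth ((\<Prod>j<k. 1 - fps_X ^ Suc j) :: complex fps) i"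
    unfolding prod.lessThan_Suc
    by (subst ring_distribs, subst fps_sub_nth, subst fps_X_power_mult_right_nth) (use assms step in simp)
  thus ?case using step by simp
qed auto

text \<open>Taylor coefficients at 0 pass to the uniform limit and are eventually constant along the
  partial products. So the expansion E of the Euler product agrees with finite products
  coefficientwise, and \<open>fps_bounded_partitions\<close> yields its formal inverse.\<close>

lemma inverse_euler_prod_has_fps_expansion:
  "(\<lambda>q. inverse (euler_prod q)) has_fps_expansion Abs_fps (\<lambda>n. of_nat (partition_count n))"
proof -
  define E where "E = fps_expansion euler_prod 0"
  have exp: "euler_prod has_fps_expansion E"
    unfolding E_def by (rule has_fps_expansion_fps_expansion[of "ball 0 1"])
      (auto intro: holomorphic_euler_prod)
  have nth: "fps_nth E i = fps_nth (\<Prod>j<m. 1 - fps_X ^ Suc j) i" if "i < m" for i m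
  proof -
    have "(\<lambda>n. (deriv ^^ i) (\<lambda>q. \<Prod>k<n. 1 - q ^ Suc k) 0) \<longlonglongrightarrow> (deriv ^^ i) euler_prod 0"
      by (rule higher_deriv_complex_uniform_limit[where A = "ball 0 (1/2)"],
          rule uniform_limit_on_subset[OF uniform_limit_euler_prod[of "1/2"]])
         (auto intro!: holomorphic_intros always_eventually)
    hence "(\<lambda>n. (deriv ^^ i) (\<lambda>q. \<Prod>k<n. 1 - q ^ Suc k) 0 / fact i) \<longlonglongrightarrow> fps_nth E i"
      unfolding fps_nth_fps_expansion[OF exp] by (intro tendsto_intros) auto
    moreover have "(\<lambda>n. (deriv ^^ i) (\<lambda>q::complex. \<Prod>k<n. 1 - q ^ Suc k) 0 / fact i) \<longlonglongrightarrow>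
                     fps_nth (\<Prod>j<m. 1 - fps_X ^ Suc j) i"
    proof (rule Lim_transform_eventually[OF tendsto_const])
      show "\<forall>\<^sub>F n in sequentially. fps_nth (\<Prod>j<m. 1 - fps_X ^ Suc j) i =
              (deriv ^^ i) (\<lambda>q::complex. \<Prod>k<n. 1 - q ^ Suc k) 0 / fact i"
        using eventually_ge_at_top[of m]
      proof eventually_elim
        case (elim n)
        have "(\<lambda>q::complex. \<Prod>k<n. 1 - q ^ Suc k) has_fps_expansion (\<Prod>j<n. 1 - fps_X ^ Suc j)"
          by (intro fps_expansion_intros)
        from fps_nth_fps_expansion[OF this, of i] fps_nth_prod_stable[OF that elim]
        show ?case by simp
      qed
    qed
    ultimately show ?thesis by (rule LIMSEQ_unique)
  qed
  define F :: "complex fps" where "F = Abs_fps (\<lambda>n. of_nat (partition_count n))"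
  have "F * E = 1"
  proof (rule fps_ext)
    fix n
    have "fps_nth (F * E) n = (\<Sum>i=0..n. fps_nth F i * fps_nth E (n - i))" by (rule fps_mult_nth)
    \<comment> \<open>Up to index n the truncation at m = Suc n is exact in both factors.\<close>
    also have "\<dots> = (\<Sum>i=0..n. fps_nth (Abs_fps (\<lambda>k. of_nat (card (bounded_partitions (Suc n) k)))) i *
                       fps_nth (\<Prod>j<Suc n. 1 - fps_X ^ Suc j) (n - i))"
      by (intro sum.cong refl arg_cong2[where f = "(*)"] nth)
         (auto simp: F_def partition_count_eq_bounded[of _ "Suc n"])
    also have "\<dots> = fps_nth (Abs_fps (\<lambda>k. of_nat (card (bounded_partitions (Suc n) k))) *
                       (\<Prod>j<Suc n. 1 - fps_X ^ Suc j)) n"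
      by (rule fps_mult_nth [symmetric])
    also have "\<dots> = fps_nth 1 n" by (simp only: fps_bounded_partitions)
    finally show "fps_nth (F * E) n = fps_nth 1 n" .
  qed
  hence "F = inverse E" by (metis fps_inverse_unique mult.commute)
  moreover have "fps_nth E 0 \<noteq> 0" using \<open>F * E = 1\<close>
    by (metis fps_mult_nth_0 fps_one_nth mult_zero_right zero_neq_one)
  hence "(\<lambda>q. inverse (euler_prod q)) has_fps_expansion inverse E"
    by (intro fps_expansion_intros exp)
  ultimately show ?thesis by (simp add: F_def)
qed

section \<open>Partition numbers as integrals over one period\<close>

lemma has_integral_circle_coeff:
  assumes "f holomorphic_on ball 0 1" "0 < r" "r < 1"
  shows "((\<lambda>x. f (of_real r * exp (2 * of_real pi * \<i> * of_real x)) /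
            (of_real r * exp (2 * of_real pi * \<i> * of_real x)) ^ n) has_integral
          (deriv ^^ n) f 0 / fact n) {0..1}"
proof -
  have "((\<lambda>u. f u / (u - 0) ^ Suc n) has_contour_integral ((2 * pi * \<i>) / fact n * (deriv ^^ n) f 0))
           (circlepath 0 r)"
  proof (rule Cauchy_has_contour_integral_higher_derivative_circlepath)
    show "continuous_on (cball 0 r) f"
      by (rule holomorphic_on_imp_continuous_on, rule holomorphic_on_subset[OF assms(1)])
         (use assms in auto)
    show "f holomorphic_on ball 0 r"
      by (rule holomorphic_on_subset[OF assms(1)]) (use assms in auto)
  qed (use assms in auto)
  hence "((\<lambda>x. f (circlepath 0 r x) / circlepath 0 r x ^ Suc n *
            (2 * pi * \<i> * r * exp (2 * of_real pi * \<i> * x))) has_integral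
          ((2 * pi * \<i>) / fact n * (deriv ^^ n) f 0)) {0..1}"
    unfolding has_contour_integral
    by (rule has_integral_eq[rotated]) (simp add: vector_derivative_circlepath mult_ac)
  from has_integral_mult_right[OF this, of "1 / (2 * pi * \<i>)"]
  have "((\<lambda>x. f (of_real r * exp (2 * of_real pi * \<i> * of_real x)) /
            (of_real r * exp (2 * of_real pi * \<i> * of_real x)) ^ n) has_integral
          (1 / (2 * pi * \<i>) * ((2 * pi * \<i>) / fact n * (deriv ^^ n) f 0))) {0..1}"
    by (rule has_integral_eq[rotated]) (use assms in \<open>simp add: circlepath\<close>)
  thus ?thesis by simp
qed

text \<open>The segment of height y is mapped to the circle of radius exp(- 2 pi y), on which q^(-n)
  times the generating function has mean value p(n).\<close>

lemma has_integral_partition_count: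
  assumes "y > 0"
  shows "((\<lambda>x. exp (- 2 * of_real pi * \<i> * of_nat n * Complex x y) *
             inverse (euler_prod (exp (2 * of_real pi * \<i> * Complex x y)))) has_integral
          of_nat (partition_count n)) {0..1}"
proof -
  define r where "r = exp (- 2 * pi * y)"
  have r: "0 < r" "r < 1" using assms by (auto simp: r_def)
  have hol: "(\<lambda>q. inverse (euler_prod q)) holomorphic_on ball 0 1"
    by (intro holomorphic_intros holomorphic_euler_prod euler_prod_nonzero) auto
  have eq: "of_real r * exp (2 * of_real pi * \<i> * of_real x) = exp (2 * of_real pi * \<i> * Complex x y)" for x
  proof -
    have "of_real r * exp (2 * of_real pi * \<i> * of_real x) =
            exp (of_real (- 2 * pi * y) + 2 * of_real pi * \<i> * of_real x)"
      unfolding r_def exp_of_real [symmetric] by (rule exp_add [symmetric])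
    also have "of_real (- 2 * pi * y) + 2 * of_real pi * \<i> * of_real x = 2 * of_real pi * \<i> * Complex x y"
      by (simp add: complex_eq_iff)
    finally show ?thesis .
  qed
  have "fps_nth (Abs_fps (\<lambda>n. of_nat (partition_count n))) n =
          (deriv ^^ n) (\<lambda>q. inverse (euler_prod q)) 0 / fact n"
    by (rule fps_nth_fps_expansion[OF inverse_euler_prod_has_fps_expansion])
  with has_integral_circle_coeff[OF hol r, of n]
  have "((\<lambda>x. inverse (euler_prod (exp (2 * of_real pi * \<i> * Complex x y))) /
            exp (2 * of_real pi * \<i> * Complex x y) ^ n) has_integral of_nat (partition_count n)) {0..1}"
    unfolding eq by simp
  thus ?thesis
  proof (rule has_integral_eq[rotated])
    fix x
    have "exp (- 2 * of_real pi * \<i> * of_nat n * Complex x y) =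
            inverse (exp (of_nat n * (2 * of_real pi * \<i> * Complex x y)))"
      unfolding exp_minus [symmetric] by (rule arg_cong[of _ _ exp]) (simp add: mult_ac)
    thus "inverse (euler_prod (exp (2 * of_real pi * \<i> * Complex x y))) /
            exp (2 * of_real pi * \<i> * Complex x y) ^ n =
          exp (- 2 * of_real pi * \<i> * of_nat n * Complex x y) *
             inverse (euler_prod (exp (2 * of_real pi * \<i> * Complex x y)))"
      unfolding exp_of_nat_mult by (simp add: divide_inverse)
  qed
qed

section \<open>Lattice sums and the cotangent\<close>

text \<open>The exponent is half of 5 / 2: since max 1 |c| * max 1 |d| <= c^2 + d^2, the decay |c
  tau + d|^(-5/2) splits into one such weight in c and one in d, and each is still summable.\<close>

definition int_weight :: "int \<Rightarrow> real"
  where "int_weight m = max 1 \<bar>of_int m\<bar> powr (- 5 / 4)"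

lemma int_weight_pos: "int_weight m > 0"
  by (simp add: int_weight_def)

lemma summable_int_weight: "int_weight summable_on UNIV"
proof -
  have sum: "summable (\<lambda>k. int_weight (int k))"
  proof (rule summable_comparison_test_ev)
    show "\<forall>\<^sub>F n in sequentially. norm (int_weight (int n)) \<le> real n powr (- 5 / 4)"
      using eventually_ge_at_top[of 1]
    proof eventually_elim
      case (elim n)
      hence "max 1 \<bar>real n\<bar> = real n" by simp
      thus ?case by (simp add: int_weight_def)
    qed
    show "summable (\<lambda>n. real n powr (- 5 / 4))" by (simp add: summable_real_powr_iff)
  qed
  have nat: "(\<lambda>k. int_weight (int k)) summable_on UNIV"
    using sum by (intro norm_summable_imp_summable_on) (simp add: less_imp_le[OF int_weight_pos])
  have "int_weight summable_on range int"
    using nat by (subst summable_on_reindex) (auto simp: o_def)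
  moreover have "(\<lambda>k. int_weight (- int (Suc k))) summable_on UNIV"
  proof -
    have "summable (\<lambda>k. int_weight (int (Suc k)))" using sum by (subst summable_Suc_iff)
    thus ?thesis
      by (intro norm_summable_imp_summable_on) (simp add: int_weight_def add_ac)
  qed
  hence "int_weight summable_on range (\<lambda>k. - int (Suc k))"
    by (subst summable_on_reindex) (auto simp: o_def inj_on_def)
  moreover have "range int \<inter> range (\<lambda>k. - int (Suc k)) = {}" by auto
  moreover have "range int \<union> range (\<lambda>k. - int (Suc k)) = UNIV"
  proof (intro equalityI subsetI UNIV_I)
    fix m :: int
    show "m \<in> range int \<union> range (\<lambda>k. - int (Suc k))"
    proof (cases "m \<ge> 0")
      case True
      hence "m = int (nat m)" by simp
      thus ?thesis by blast
    next
      case False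
      hence "m = - int (Suc (nat (- m - 1)))" by simp
      thus ?thesis by blast
    qed
  qed
  ultimately show ?thesis using summable_on_Un_disjoint by metis
qed

definition lattice_weight :: "int \<times> int \<Rightarrow> real"
  where "lattice_weight p = int_weight (fst p) * int_weight (snd p)"

lemma lattice_weight_pos: "lattice_weight p > 0"
  by (simp add: lattice_weight_def int_weight_pos)

lemma summable_lattice_weight: "lattice_weight summable_on A"
proof -
  obtain S where S: "(int_weight has_sum S) UNIV"
    using summable_int_weight by (auto simp: summable_on_def)
  have "lattice_weight summable_on Sigma UNIV (\<lambda>_. UNIV)"
  proof (rule summable_on_SigmaI)
    show "((\<lambda>d. lattice_weight (c, d)) has_sum int_weight c * S) UNIV" for c
      unfolding lattice_weight_def using has_sum_cmult_right[OF S] by simp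
    show "(\<lambda>c. int_weight c * S) summable_on UNIV"
      by (intro summable_on_cmult_left summable_int_weight)
  qed (simp add: less_imp_le[OF lattice_weight_pos])
  thus ?thesis by (rule summable_on_subset_banach) auto
qed

text \<open>The imaginary part of c tau + d controls c, giving |c| <= N / y, and subtracting c tau
  then controls d, giving |d| <= N (1 + R / y).\<close>

lemma lattice_bound:
  fixes \<tau> :: complex and c d :: real
  assumes "0 < y" "y \<le> Im \<tau>" "norm \<tau> \<le> R"
  shows "c ^ 2 + d ^ 2 \<le> (1 / y ^ 2 + (1 + R / y) ^ 2) * norm (of_real c * \<tau> + of_real d) ^ 2"
proof -
  define N where "N = norm (of_real c * \<tau> + of_real d)"
  have "\<bar>c\<bar> * y \<le> \<bar>c\<bar> * \<bar>Im \<tau>\<bar>" using assms by (intro mult_left_mono) auto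
  also have "\<dots> = \<bar>Im (of_real c * \<tau> + of_real d)\<bar>" by (simp add: abs_mult)
  also have "\<dots> \<le> N" unfolding N_def by (rule abs_Im_le_cmod)
  finally have c: "\<bar>c\<bar> \<le> N / y" using assms by (simp add: field_simps)
  have "\<bar>d\<bar> = norm ((of_real c * \<tau> + of_real d) - of_real c * \<tau>)" by simp
  also have "\<dots> \<le> N + \<bar>c\<bar> * norm \<tau>" unfolding N_def
    by (rule order_trans[OF norm_triangle_ineq4]) (simp add: norm_mult)
  also have "\<dots> \<le> N + N / y * R"
    using c assms by (intro add_left_mono mult_mono) auto
  finally have d: "\<bar>d\<bar> \<le> N * (1 + R / y)" by (simp add: field_simps)
  have "c ^ 2 \<le> (N / y) ^ 2" using power_mono[OF c, of 2] by simp
  moreover have "d ^ 2 \<le> (N * (1 + R / y)) ^ 2" using power_mono[OF d, of 2] by simp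
  moreover have "(1 / y ^ 2 + (1 + R / y) ^ 2) * N ^ 2 = (N / y) ^ 2 + (N * (1 + R / y)) ^ 2"
    unfolding power_mult_distrib power_divide by (simp add: distrib_right)
  ultimately have "c ^ 2 + d ^ 2 \<le> (1 / y ^ 2 + (1 + R / y) ^ 2) * N ^ 2" by simp
  thus ?thesis by (simp add: N_def)
qed

text \<open>For nonzero c and d this is 2 |c d| <= c^2 + d^2; if one of them vanishes, it is |x| <=
  x^2 for integers.\<close>

lemma max_mult_le_sum_squares:
  fixes c d :: int
  assumes "(c, d) \<noteq> (0, 0)"
  shows "max 1 \<bar>of_int c\<bar> * max 1 \<bar>of_int d\<bar> \<le> (of_int c ^ 2 + of_int d ^ 2 :: real)"
proof -
  have "max 1 \<bar>c\<bar> * max 1 \<bar>d\<bar> \<le> c ^ 2 + d ^ 2"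
  proof (cases "c = 0 \<or> d = 0")
    case True
    have "\<bar>x\<bar> \<le> x ^ 2" for x :: int
      by (cases "x = 0") (use self_le_power[of "\<bar>x\<bar>" 2] in auto)
    thus ?thesis using True assms by (auto simp: max_def)
  next
    case False
    hence "max 1 \<bar>c\<bar> = \<bar>c\<bar>" "max 1 \<bar>d\<bar> = \<bar>d\<bar>" by (auto simp: max_def)
    moreover have "0 \<le> (\<bar>c\<bar> - \<bar>d\<bar>) ^ 2" by simp
    hence "2 * (\<bar>c\<bar> * \<bar>d\<bar>) \<le> c ^ 2 + d ^ 2" by (simp add: power2_diff)
    moreover have "0 \<le> \<bar>c\<bar> * \<bar>d\<bar>" by simp
    ultimately show ?thesis by linarith
  qed
  hence "of_int (max 1 \<bar>c\<bar> * max 1 \<bar>d\<bar>) \<le> (of_int (c ^ 2 + d ^ 2) :: real)"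
    by (simp only: of_int_le_iff)
  thus ?thesis by simp
qed

text \<open>The two preceding bounds give P <= K N^2 for P = max 1 |c| * max 1 |d|, so a negative
  power of N is controlled by half that power of P, which factors. Applied with s = 5 / 2 to the
  Poincare terms and with s = 3 to the regularised Eisenstein series.\<close>

lemma norm_lattice_powr_le:
  assumes "0 < y" "y \<le> Im \<tau>" "norm \<tau> \<le> R" "(c, d) \<noteq> (0, 0)" "s \<ge> 5 / 2"
  shows "norm (of_int c * \<tau> + of_int d) powr (- s) \<le>
           (1 / y ^ 2 + (1 + R / y) ^ 2) powr (s / 2) * lattice_weight (c, d)"
proof -
  define K where "K = 1 / y ^ 2 + (1 + R / y) ^ 2"
  define N where "N = norm (of_int c * \<tau> + of_int d)"
  define P where "P = max 1 \<bar>of_int c\<bar> * max 1 (\<bar>of_int d\<bar> :: real)"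
  have P1: "P \<ge> 1 * 1" unfolding P_def by (intro mult_mono) auto
  have PN: "P \<le> K * N ^ 2"
    using max_mult_le_sum_squares[OF assms(4)] lattice_bound[OF assms(1-3), of "of_int c" "of_int d"]
    by (simp add: P_def K_def N_def)
  have K0: "K > 0" unfolding K_def using assms by (intro add_pos_nonneg) auto
  have N0: "N > 0" using P1 PN by (cases "N = 0") (auto simp: N_def)
  have "N powr (- s) = (N ^ 2) powr (- s / 2)"
    using N0 by (simp add: powr_powr flip: powr_numeral)
  also have "\<dots> \<le> (P / K) powr (- s / 2)"
    using PN K0 P1 assms by (intro powr_mono2') (auto simp: field_simps)
  also have "\<dots> = K powr (s / 2) * P powr (- s / 2)"
    using K0 P1 by (simp add: powr_divide powr_minus field_simps)
  \<comment> \<open>Since P >= 1, the exponent - s / 2 may be raised to - 5 / 4, so one weight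
    serves all s >= 5 / 2.\<close>
  also have "\<dots> \<le> K powr (s / 2) * P powr (- 5 / 4)"
    using P1 assms by (intro mult_left_mono powr_mono) auto
  also have "P powr (- 5 / 4) = lattice_weight (c, d)"
    by (simp add: P_def lattice_weight_def int_weight_def powr_mult)
  finally show ?thesis by (simp add: K_def N_def)
qed

section \<open>Symmetric partial sums and the partial fractions of the cotangent\<close>

text \<open>The intervals are half-open because they pair k with - k - 1, which is how the series of
  Digamma at z and at 1 - z combine into one sum over the integers.\<close>

lemma filterlim_int_intervals:
  "filterlim (\<lambda>N. {- int N..<int N}) (finite_subsets_at_top UNIV) sequentially"
  unfolding filterlim_finite_subsets_at_top
proof (intro allI impI)
  fix X :: "int set" assume "finite X \<and> X \<subseteq> UNIV"
  hence "finite X" by simp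
  define M where "M = Max (insert 0 ((\<lambda>x. nat \<bar>x\<bar>) ` X))"
  have M: "nat \<bar>x\<bar> \<le> M" if "x \<in> X" for x
    unfolding M_def using that \<open>finite X\<close> by (intro Max_ge) auto
  show "\<forall>\<^sub>F N in sequentially. finite {- int N..<int N} \<and> X \<subseteq> {- int N..<int N} \<and> {- int N..<int N} \<subseteq> UNIV"
    using eventually_gt_at_top[of M] by eventually_elim (use M in force)
qed

lemma has_sum_int_imp_LIMSEQ:
  assumes "(f has_sum S) (UNIV :: int set)"
  shows "(\<lambda>N. \<Sum>m\<in>{- int N..<int N}. f m) \<longlonglongrightarrow> S"
  using filterlim_compose[OF assms[unfolded has_sum_def] filterlim_int_intervals] .

lemma sum_int_interval_eq:
  "(\<Sum>m\<in>{- int N..<int N}. f m) = (\<Sum>k<N. f (int k) + f (- int k - 1))"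
proof (induction N)
  case (Suc N)
  have "{- int (Suc N)..<int (Suc N)} = insert (int N) (insert (- int N - 1) {- int N..<int N})" by auto
  with Suc show ?case by (simp add: add_ac)
qed auto

text \<open>Differentiate Gamma z * Gamma (1 - z) = pi / sin (pi z) and divide by the function
  itself.\<close>

lemma Digamma_reflection:
  fixes z :: complex
  assumes "z \<notin> \<int>"
  shows "Digamma z - Digamma (1 - z) = - of_real pi * cot (of_real pi * z)"
proof -
  have s: "sin (of_real pi * z) \<noteq> 0"
    using assms by (auto simp: sin_eq_0 Ints_def)
  have nz: "z \<notin> \<int>\<^sub>\<le>\<^sub>0" "1 - z \<notin> \<int>\<^sub>\<le>\<^sub>0"
    using assms nonpos_Ints_Int[of z] nonpos_Ints_Int[of "1 - z"] Ints_diff[OF Ints_1, of "1 - z"] by auto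
  have "((\<lambda>w. Gamma w * Gamma (1 - w)) has_field_derivative
          Gamma z * Gamma (1 - z) * (Digamma z - Digamma (1 - z))) (at z)"
    using nz by (auto intro!: derivative_eq_intros simp: algebra_simps)
  moreover have "((\<lambda>w. of_real pi / sin (of_real pi * w)) has_field_derivative
          - (of_real pi / sin (of_real pi * z)) * (of_real pi * cot (of_real pi * z))) (at z)"
    using s by (auto intro!: derivative_eq_intros simp: cot_def field_simps power2_eq_square)
  ultimately have "of_real pi / sin (of_real pi * z) * (Digamma z - Digamma (1 - z)) =
          - (of_real pi / sin (of_real pi * z)) * (of_real pi * cot (of_real pi * z))"
    unfolding Gamma_reflection_complex by (rule DERIV_unique)
  hence "of_real pi / sin (of_real pi * z) * (Digamma z - Digamma (1 - z)) =
          of_real pi / sin (of_real pi * z) * (- (of_real pi * cot (of_real pi * z)))" by simp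
  thus ?thesis using s by (subst (asm) mult_left_cancel) auto
qed

text \<open>In Digamma (1 - z) - Digamma z the divergent logarithms of the two limit formulas
  cancel, leaving exactly the sum over the half-open interval.\<close>

lemma cot_partial_fractions:
  fixes z :: complex
  assumes "z \<notin> \<int>"
  shows "(\<lambda>N. \<Sum>m\<in>{- int N..<int N}. 1 / (z + of_int m)) \<longlonglongrightarrow> of_real pi * cot (of_real pi * z)"
proof -
  have "z \<noteq> 0" "1 - z \<noteq> 0" using assms by auto
  hence "(\<lambda>N. (of_real (ln (real N)) - (\<Sum>k<N. inverse ((1 - z) + of_nat k))) -
              (of_real (ln (real N)) - (\<Sum>k<N. inverse (z + of_nat k)))) \<longlonglongrightarrow>
          Digamma (1 - z) - Digamma z"
    by (intro tendsto_diff Digamma_LIMSEQ)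
  also have "Digamma (1 - z) - Digamma z = of_real pi * cot (of_real pi * z)"
    using Digamma_reflection[OF assms] by (simp add: algebra_simps)
  also have "(\<lambda>N. (of_real (ln (real N)) - (\<Sum>k<N. inverse ((1 - z) + of_nat k))) -
              (of_real (ln (real N)) - (\<Sum>k<N. inverse (z + of_nat k)))) =
             (\<lambda>N. \<Sum>m\<in>{- int N..<int N}. 1 / (z + of_int m))"
  proof
    fix N
    have "inverse ((1 - z) + of_nat k) = - (1 / (z + of_int (- int k - 1)))" for k
      using minus_divide_right[of 1 "(1 - z) + of_nat k"] by (simp add: inverse_eq_divide minus_divide_right algebra_simps)
    thus "(of_real (ln (real N)) - (\<Sum>k<N. inverse ((1 - z) + of_nat k))) -
              (of_real (ln (real N)) - (\<Sum>k<N. inverse (z + of_nat k))) =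
          (\<Sum>m\<in>{- int N..<int N}. 1 / (z + of_int m))"
      by (simp add: sum_int_interval_eq sum.distrib sum_negf inverse_eq_divide)
  qed
  finally show ?thesis .
qed

lemma Polygamma_1_reflection:
  fixes z :: complex
  assumes "z \<notin> \<int>"
  shows "Polygamma 1 z + Polygamma 1 (1 - z) = (of_real pi / sin (of_real pi * z)) ^ 2"
proof -
  have s: "sin (of_real pi * z) \<noteq> 0"
    using assms by (auto simp: sin_eq_0 Ints_def)
  have nz: "z \<notin> \<int>\<^sub>\<le>\<^sub>0" "1 - z \<notin> \<int>\<^sub>\<le>\<^sub>0"
    using assms nonpos_Ints_Int[of z] nonpos_Ints_Int[of "1 - z"] Ints_diff[OF Ints_1, of "1 - z"] by auto
  have "((\<lambda>w. Digamma w - Digamma (1 - w)) has_field_derivative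
           Polygamma 1 z + Polygamma 1 (1 - z)) (at z)"
    using nz by (auto intro!: derivative_eq_intros)
  moreover have "((\<lambda>w. - of_real pi * cot (of_real pi * w)) has_field_derivative
           (of_real pi / sin (of_real pi * z)) ^ 2) (at z)"
    using s by (auto intro!: derivative_eq_intros DERIV_chain2[OF DERIV_cot]
                     simp: field_simps power2_eq_square)
  hence "((\<lambda>w. Digamma w - Digamma (1 - w)) has_field_derivative
           (of_real pi / sin (of_real pi * z)) ^ 2) (at z)"
  proof (rule has_field_derivative_transform_within_open)
    show "open (- \<int> :: complex set)" using closed_Ints by (simp add: open_Compl)
  qed (use assms Digamma_reflection in auto)
  ultimately show ?thesis by (rule DERIV_unique)
qed

lemma int_weight_ge_inverse_square:
  assumes "1 + of_int n ^ 2 \<le> K * N ^ 2" "N > 0" "K > 0"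
  shows "inverse (N ^ 2) \<le> K * int_weight n"
proof -
  define P where "P = max 1 (\<bar>of_int n\<bar> :: real)"
  have P1: "P \<ge> 1" by (simp add: P_def)
  have "P ^ 2 \<le> 1 + of_int n ^ 2" by (auto simp: P_def max_def)
  hence "inverse (N ^ 2) \<le> K * inverse (P ^ 2)"
    using assms P1 by (simp add: field_simps)
  also have "inverse (P ^ 2) = P powr (-2)" using P1 by (simp add: powr_minus)
  also have "\<dots> \<le> P powr (- 5 / 4)" using P1 by (intro powr_mono) auto
  finally show ?thesis using assms by (simp add: int_weight_def P_def)
qed

lemma norm_inverse_square_le:
  assumes "Im \<tau> > 0"
  obtains K where "K > 0" "\<And>n. norm (1 / (\<tau> + of_int n) ^ 2) \<le> K * int_weight n"
proof -
  define K where "K = 1 / Im \<tau> ^ 2 + (1 + norm \<tau> / Im \<tau>) ^ 2"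
  have K: "K > 0" unfolding K_def using assms by (intro add_pos_nonneg) auto
  have "norm (1 / (\<tau> + of_int n) ^ 2) \<le> K * int_weight n" for n
  proof -
    have "\<tau> + of_int n \<noteq> 0" using assms by (auto simp: complex_eq_iff)
    hence "inverse (norm (\<tau> + of_int n) ^ 2) \<le> K * int_weight n"
      using lattice_bound[OF assms order_refl order_refl, of 1 "of_int n"] K
      by (intro int_weight_ge_inverse_square) (auto simp: K_def)
    thus ?thesis by (simp add: norm_divide norm_power inverse_eq_divide)
  qed
  thus ?thesis using that K by blast
qed

text \<open>Absolute convergence provides some unordered sum, and the symmetric partial sums
  identify it through the trigamma reflection formula.\<close>

lemma has_sum_inverse_square:
  assumes "Im \<tau> > 0"
  shows "((\<lambda>m::int. 1 / (\<tau> + of_int m) ^ 2) has_sum (of_real pi / sin (of_real pi * \<tau>)) ^ 2) UNIV"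
proof -
  have nz: "\<tau> \<notin> \<int>" using assms by (auto simp: Ints_def)
  hence nz': "\<tau> \<noteq> 0" "1 - \<tau> \<noteq> 0" by auto
  obtain K where K: "K > 0" "\<And>n. norm (1 / (\<tau> + of_int n) ^ 2) \<le> K * int_weight n"
    using norm_inverse_square_le[OF assms] by blast
  have "(\<lambda>m::int. 1 / (\<tau> + of_int m) ^ 2) summable_on UNIV"
  proof (rule abs_summable_summable, rule summable_on_comparison_test)
    show "(\<lambda>n. K * int_weight n) summable_on UNIV"
      by (intro summable_on_cmult_right summable_int_weight)
  qed (use K in auto)
  then obtain S where S: "((\<lambda>m::int. 1 / (\<tau> + of_int m) ^ 2) has_sum S) UNIV"
    by (auto simp: summable_on_def)
  have "(\<lambda>N. \<Sum>m\<in>{- int N..<int N}. 1 / (\<tau> + of_int m) ^ 2) \<longlonglongrightarrow> S"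
    by (rule has_sum_int_imp_LIMSEQ[OF S])
  moreover have "(\<lambda>k. inverse ((\<tau> + of_nat k) ^ Suc 1) + inverse (((1 - \<tau>) + of_nat k) ^ Suc 1))
                   sums ((-1) ^ Suc 1 * Polygamma 1 \<tau> / fact 1 + (-1) ^ Suc 1 * Polygamma 1 (1 - \<tau>) / fact 1)"
    using nz' by (intro sums_add Polygamma_LIMSEQ) auto
  hence "(\<lambda>N. \<Sum>m\<in>{- int N..<int N}. 1 / (\<tau> + of_int m) ^ 2) \<longlonglongrightarrow> (of_real pi / sin (of_real pi * \<tau>)) ^ 2"
  proof -
    have eq: "1 / (\<tau> + of_int (int k)) ^ 2 + 1 / (\<tau> + of_int (- int k - 1)) ^ 2 =
            inverse ((\<tau> + of_nat k) ^ Suc 1) + inverse (((1 - \<tau>) + of_nat k) ^ Suc 1)" for k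
    proof -
      have "(\<tau> + of_int (- int k - 1)) ^ 2 = ((1 - \<tau>) + of_nat k) ^ 2"
        by (simp add: power2_eq_square algebra_simps)
      thus ?thesis by (simp add: inverse_eq_divide power2_eq_square)
    qed
    assume "(\<lambda>k. inverse ((\<tau> + of_nat k) ^ Suc 1) + inverse (((1 - \<tau>) + of_nat k) ^ Suc 1))
                   sums ((-1) ^ Suc 1 * Polygamma 1 \<tau> / fact 1 + (-1) ^ Suc 1 * Polygamma 1 (1 - \<tau>) / fact 1)"
    thus ?thesis
      unfolding sum_int_interval_eq eq sums_def using Polygamma_1_reflection[OF nz] by simp
  qed
  ultimately have "S = (of_real pi / sin (of_real pi * \<tau>)) ^ 2" by (rule LIMSEQ_unique)
  with S show ?thesis by simp
qed

section \<open>The Eisenstein series of weight 2 and the eta function\<close>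

lemma dedekind_eta_eq: "dedekind_eta \<tau> = q_power (1 / 24) \<tau> * euler_prod (q_power 1 \<tau>)"
  by (simp add: dedekind_eta_def euler_prod_def)

lemma norm_q_power: "norm (q_power s \<tau>) = exp (- 2 * pi * s * Im \<tau>)"
  by (simp add: q_power_def norm_exp_eq_Re)

lemma q_power_1_in_ball:
  assumes "Im \<tau> > 0"
  shows "norm (q_power 1 \<tau>) < 1"
  using assms by (simp add: norm_q_power)

lemma q_power_add_right: "q_power s (\<tau> + \<tau>') = q_power s \<tau> * q_power s \<tau>'"
  by (simp add: q_power_def ring_distribs exp_add)

lemma q_power_add_left: "q_power (s + s') \<tau> = q_power s \<tau> * q_power s' \<tau>"
  by (simp add: q_power_def ring_distribs exp_add)

lemma q_power_nonzero [simp]: "q_power s \<tau> \<noteq> 0"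
  by (simp add: q_power_def)

lemma q_power_minus: "q_power (- s) \<tau> = inverse (q_power s \<tau>)"
  by (simp add: q_power_def exp_minus)

lemma q_power_int_int: "q_power (of_int k) (of_int n) = 1"
  unfolding q_power_def by (rule exp_eq_1 [THEN iffD2]) (auto intro!: exI[of _ "k * n"])

lemma q_power_1_power: "q_power 1 \<tau> ^ n = q_power 1 (of_nat n * \<tau>)"
  by (simp add: q_power_def exp_of_nat_mult [symmetric] mult_ac)

lemma holomorphic_q_power [holomorphic_intros]: "q_power s holomorphic_on A"
  unfolding q_power_def by (intro holomorphic_intros)

lemma has_field_derivative_q_power:
  "(q_power s has_field_derivative 2 * of_real pi * \<i> * of_real s * q_power s \<tau>) (at \<tau>)"
  unfolding q_power_def by (auto intro!: derivative_eq_intros)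

lemma dedekind_eta_nonzero:
  assumes "Im \<tau> > 0"
  shows "dedekind_eta \<tau> \<noteq> 0"
  using euler_prod_nonzero[OF q_power_1_in_ball[OF assms]] by (simp add: dedekind_eta_eq)

lemma holomorphic_dedekind_eta: "dedekind_eta holomorphic_on {\<tau>. Im \<tau> > 0}"
proof -
  have "(euler_prod \<circ> q_power 1) holomorphic_on {\<tau>. Im \<tau> > 0}"
    by (rule holomorphic_on_compose_gen[OF holomorphic_q_power holomorphic_euler_prod])
       (use q_power_1_in_ball in auto)
  hence "(\<lambda>\<tau>. q_power (1/24) \<tau> * euler_prod (q_power 1 \<tau>)) holomorphic_on {\<tau>. Im \<tau> > 0}"
    by (intro holomorphic_intros) (auto simp: o_def)
  thus ?thesis by (simp add: dedekind_eta_eq [abs_def])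
qed

lemma has_sum_nat_mult_power:
  assumes "norm (q::complex) < 1"
  shows "((\<lambda>m. of_nat (Suc m) * q ^ Suc m) has_sum q / (1 - q) ^ 2) UNIV"
proof (rule norm_summable_imp_has_sum)
  have "(\<lambda>m. q * (of_nat (Suc m) * q ^ m)) sums (q * (1 / (1 - q) ^ 2))"
    by (intro sums_mult geometric_deriv_sums assms)
  thus "(\<lambda>m. of_nat (Suc m) * q ^ Suc m) sums (q / (1 - q) ^ 2)" by (simp add: mult_ac)
  have "summable (\<lambda>m. norm q * (of_nat (Suc m) * norm q ^ m))"
    by (intro summable_mult sums_summable[OF geometric_deriv_sums]) (use assms in auto)
  thus "summable (\<lambda>m. norm (of_nat (Suc m) * q ^ Suc m))"
    by (simp add: norm_mult norm_power mult_ac del: of_nat_Suc)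
qed

lemma has_sum_Suc_power:
  assumes "norm (x::'a::{real_normed_field,banach}) < 1"
  shows "((\<lambda>k. x ^ Suc k) has_sum x / (1 - x)) UNIV"
proof (rule norm_summable_imp_has_sum)
  have "(\<lambda>m. x * x ^ m) sums (x * (1 / (1 - x)))"
    by (intro sums_mult geometric_sums assms)
  thus "(\<lambda>k. x ^ Suc k) sums (x / (1 - x))" by simp
  show "summable (\<lambda>k. norm (x ^ Suc k))"
    using summable_geometric[of "norm x"] assms by (simp add: norm_power norm_mult summable_mult)
qed

lemma norm_power_Suc_less_1:
  assumes "norm (q::complex) < 1"
  shows "norm (q ^ Suc m) < 1"
  using assms by (simp add: norm_power power_less_one_iff del: power_Suc)

text \<open>Both series are the double series of m q^(m k) over m, k >= 1, summed in the two orders.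
  The first is what differentiating the Euler product produces, the second is what the sine squares
  of the lattice rows produce.\<close>

lemma lambert_series:
  assumes "norm (q::complex) < 1" "(\<lambda>m. of_nat (Suc m) * q ^ Suc m / (1 - q ^ Suc m)) sums S"
  shows "((\<lambda>k. q ^ Suc k / (1 - q ^ Suc k) ^ 2) has_sum S) UNIV"
proof -
  define f where "f = (\<lambda>(m,k). of_nat (Suc m) * (q ^ Suc m) ^ Suc k)"
  have rows: "((\<lambda>k. f (m, k)) has_sum of_nat (Suc m) * (q ^ Suc m / (1 - q ^ Suc m))) UNIV" for m
    unfolding f_def prod.case by (intro has_sum_cmult_right has_sum_Suc_power norm_power_Suc_less_1 assms)
  have cols: "((\<lambda>m. f (m, k)) has_sum q ^ Suc k / (1 - q ^ Suc k) ^ 2) UNIV" for k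
  proof -
    have "f (m, k) = of_nat (Suc m) * (q ^ Suc k) ^ Suc m" for m
      by (simp only: f_def prod.case power_mult [symmetric] mult.commute[of "Suc m"])
    thus ?thesis using has_sum_nat_mult_power[OF norm_power_Suc_less_1[OF assms(1)], of k] by simp
  qed
  \<comment> \<open>Absolute convergence by the same row computation with |q| in place of q; the
    factor 1 / (1 - |q|^(m+1)) is bounded by 1 / (1 - |q|).\<close>
  have "(\<lambda>p. norm (f p)) summable_on (UNIV \<times> UNIV)"
  proof (rule summable_on_SigmaI)
    have nq: "norm q ^ Suc m < 1" for m using norm_power_Suc_less_1[OF assms(1), of m] by (simp only: norm_power)
    show "((\<lambda>k. norm (f (m, k))) has_sum of_nat (Suc m) * (norm q ^ Suc m / (1 - norm q ^ Suc m))) UNIV" for m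
      unfolding f_def prod.case norm_mult norm_power norm_of_nat
      by (intro has_sum_cmult_right has_sum_Suc_power) (use nq[of m] in \<open>simp del: power_Suc\<close>)
    show "(\<lambda>m. of_nat (Suc m) * (norm q ^ Suc m / (1 - norm q ^ Suc m))) summable_on UNIV"
    proof (rule summable_on_comparison_test)
      have "(\<lambda>m. norm (of_nat (Suc m) * q ^ Suc m)) summable_on UNIV"
      proof (rule norm_summable_imp_summable_on)
        have "summable (\<lambda>m. norm q * (of_nat (Suc m) * norm q ^ m))"
          by (intro summable_mult sums_summable[OF geometric_deriv_sums]) (use assms in auto)
        thus "summable (\<lambda>m. norm (norm (of_nat (Suc m) * q ^ Suc m)))"
          by (simp add: norm_mult norm_power mult_ac del: of_nat_Suc)
      qed
      thus "(\<lambda>m. norm (of_nat (Suc m) * q ^ Suc m) * (1 / (1 - norm q))) summable_on UNIV"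
        by (rule summable_on_cmult_left)
      fix m
      have "norm q ^ Suc m \<le> norm q ^ 1" using assms(1) by (intro power_decreasing) auto
      hence "norm q ^ Suc m / (1 - norm q ^ Suc m) \<le> norm q ^ Suc m / (1 - norm q)"
        using assms(1) by (intro divide_left_mono mult_pos_pos) (auto simp: nq simp del: power_Suc)
      hence "of_nat (Suc m) * (norm q ^ Suc m / (1 - norm q ^ Suc m)) \<le> of_nat (Suc m) * (norm q ^ Suc m / (1 - norm q))"
        by (intro mult_left_mono) auto
      thus "of_nat (Suc m) * (norm q ^ Suc m / (1 - norm q ^ Suc m)) \<le> norm (of_nat (Suc m) * q ^ Suc m) * (1 / (1 - norm q))"
        by (simp add: norm_mult norm_power del: of_nat_Suc power_Suc)
      show "0 \<le> of_nat (Suc m) * (norm q ^ Suc m / (1 - norm q ^ Suc m))"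
        using nq[of m] by (intro mult_nonneg_nonneg divide_nonneg_nonneg) (auto simp del: power_Suc)
    qed
  qed auto
  hence "f summable_on (UNIV \<times> UNIV)" by (rule abs_summable_summable)
  then obtain X where X: "(f has_sum X) (UNIV \<times> UNIV)" by (auto simp: summable_on_def)
  have "((\<lambda>m. of_nat (Suc m) * (q ^ Suc m / (1 - q ^ Suc m))) has_sum X) UNIV"
    by (rule has_sum_SigmaD[OF X]) (use rows in auto)
  hence "(\<lambda>m. of_nat (Suc m) * (q ^ Suc m / (1 - q ^ Suc m))) sums X" by (rule has_sum_imp_sums)
  hence "X = S" using assms(2) sums_unique2 by (metis (no_types, lifting) sums_cong times_divide_eq_right)
  moreover have "((\<lambda>(k,m). f (m, k)) has_sum X) (UNIV \<times> UNIV)"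
    using X by (subst (asm) has_sum_swap) auto
  hence "((\<lambda>k. q ^ Suc k / (1 - q ^ Suc k) ^ 2) has_sum X) UNIV"
    by (rule has_sum_SigmaD) (use cols in auto)
  ultimately show ?thesis by simp
qed

lemma sin_square_q_power:
  assumes "Im z > 0"
  shows "q_power 1 z / (1 - q_power 1 z) ^ 2 = - ((of_real pi / sin (of_real pi * z)) ^ 2) / (4 * of_real pi ^ 2)"
proof -
  define w where "w = exp (\<i> * (of_real pi * z))"
  have w: "w \<noteq> 0" by (simp add: w_def)
  have q: "q_power 1 z = w ^ 2"
    by (simp add: q_power_def w_def exp_double [symmetric] mult_ac)
  have "sin (of_real pi * z) = (w - inverse w) / (2 * \<i>)"
    unfolding w_def sin_exp_eq by (simp add: exp_minus)
  hence "sin (of_real pi * z) = (w ^ 2 - 1) / (2 * \<i> * w)"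
    using w by (simp add: field_simps power2_eq_square)
  hence "(of_real pi / sin (of_real pi * z)) ^ 2 = of_real pi ^ 2 * (- 4 * w ^ 2) / (w ^ 2 - 1) ^ 2"
    by (simp add: power_divide power_mult_distrib)
  also have "(w ^ 2 - 1) ^ 2 = (1 - w ^ 2) ^ 2" by (simp add: power2_commute)
  finally show ?thesis unfolding q by simp
qed

text \<open>The constant i / (4 pi) is chosen so that the bracket becomes an Eisenstein sum: pi^2 /
  3 = 2 zeta(2) is the row m = 0 (it comes from the factor q^(1/24)), and T is counted twice, for
  the rows m > 0 and m < 0.\<close>

lemma deriv_dedekind_eta:
  assumes "Im \<tau> > 0"
  obtains T where
    "((\<lambda>k. (of_real pi / sin (of_real pi * (of_nat (Suc k) * \<tau>))) ^ 2) has_sum T) UNIV"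
    "deriv dedekind_eta \<tau> = dedekind_eta \<tau> * (\<i> / (4 * of_real pi) * (of_real pi ^ 2 / 3 + 2 * T))"
proof -
  define q where "q = q_power 1 \<tau>"
  have q: "norm q < 1" using q_power_1_in_ball[OF assms] by (simp add: q_def)
  obtain r where r: "norm q < r" "r < 1" using dense[OF q] by blast
  have E: "euler_prod q \<noteq> 0" by (rule euler_prod_nonzero[OF q])
  have "(\<lambda>k. deriv (\<lambda>q. 1 - q ^ Suc k) q / (1 - q ^ Suc k)) sums (deriv euler_prod q / euler_prod q)"
    by (rule logderiv_prodinf_complex_uniform_limit[where A = "ball 0 r"],
        rule uniform_limit_on_subset[OF uniform_limit_euler_prod[OF r(2)]])
       (use r E in \<open>auto intro!: holomorphic_intros\<close>)
  hence "(\<lambda>k. (- q) * (deriv (\<lambda>q. 1 - q ^ Suc k) q / (1 - q ^ Suc k))) sums ((- q) * (deriv euler_prod q / euler_prod q))"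
    by (rule sums_mult)
  moreover have d: "deriv (\<lambda>q. 1 - q ^ Suc k) q = - (of_nat (Suc k) * q ^ k)" for k
    by (rule DERIV_imp_deriv) (auto intro!: derivative_eq_intros simp: ac_simps simp del: power_Suc)
  have "(- q) * (deriv (\<lambda>q. 1 - q ^ Suc k) q / (1 - q ^ Suc k)) = of_nat (Suc k) * q ^ Suc k / (1 - q ^ Suc k)" for k
    unfolding d by (simp add: mult_ac del: of_nat_Suc)
  ultimately have "(\<lambda>k. of_nat (Suc k) * q ^ Suc k / (1 - q ^ Suc k)) sums (- (q * (deriv euler_prod q / euler_prod q)))"
    by simp
  from lambert_series[OF q this]
  have "((\<lambda>k. q ^ Suc k / (1 - q ^ Suc k) ^ 2) has_sum (- (q * (deriv euler_prod q / euler_prod q)))) UNIV" .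
  hence "((\<lambda>k. (- 4 * of_real pi ^ 2) * (q ^ Suc k / (1 - q ^ Suc k) ^ 2)) has_sum
            ((- 4 * of_real pi ^ 2) * (- (q * (deriv euler_prod q / euler_prod q))))) UNIV"
    by (rule has_sum_cmult_right)
  also have "(\<lambda>k. (- 4 * of_real pi ^ 2) * (q ^ Suc k / (1 - q ^ Suc k) ^ 2)) =
               (\<lambda>k. (of_real pi / sin (of_real pi * (of_nat (Suc k) * \<tau>))) ^ 2)"
  proof
    fix k
    have "Im (of_nat (Suc k) * \<tau>) > 0" using assms by simp
    from sin_square_q_power[OF this] show "(- 4 * of_real pi ^ 2) * (q ^ Suc k / (1 - q ^ Suc k) ^ 2) =
            (of_real pi / sin (of_real pi * (of_nat (Suc k) * \<tau>))) ^ 2"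
      unfolding q_def q_power_1_power by simp
  qed
  finally have T: "((\<lambda>k. (of_real pi / sin (of_real pi * (of_nat (Suc k) * \<tau>))) ^ 2) has_sum
            (4 * of_real pi ^ 2 * (q * (deriv euler_prod q / euler_prod q)))) UNIV" by simp
  have dE: "(euler_prod has_field_derivative deriv euler_prod q) (at q)"
    using q holomorphic_derivI[OF holomorphic_euler_prod, of q] by auto
  have "((\<lambda>\<tau>. q_power (1/24) \<tau> * euler_prod (q_power 1 \<tau>)) has_field_derivative
          (2 * of_real pi * \<i> * of_real (1/24) * q_power (1/24) \<tau>) * euler_prod (q_power 1 \<tau>) +
          (deriv euler_prod q * (2 * of_real pi * \<i> * of_real 1 * q_power 1 \<tau>)) * q_power (1/24) \<tau>) (at \<tau>)"
    by (intro DERIV_mult has_field_derivative_q_power DERIV_chain2[where f = euler_prod])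
       (use dE in \<open>auto simp: q_def\<close>)
  hence "deriv dedekind_eta \<tau> = (2 * of_real pi * \<i> * of_real (1/24) * q_power (1/24) \<tau>) * euler_prod q +
          (deriv euler_prod q * (2 * of_real pi * \<i> * of_real 1 * q)) * q_power (1/24) \<tau>"
    unfolding dedekind_eta_eq [abs_def] q_def by (rule DERIV_imp_deriv)
  also have "\<dots> = q_power (1/24) \<tau> * euler_prod q * (\<i> / (4 * of_real pi) * (of_real pi ^ 2 / 3 +
               2 * (4 * of_real pi ^ 2 * (q * (deriv euler_prod q / euler_prod q)))))"
    using E by (simp add: field_simps power2_eq_square)
  finally show ?thesis using that T by (simp add: dedekind_eta_eq q_def)
qed

section \<open>The conditionally convergent Eisenstein series of weight 2\<close>

text \<open>In the row m = 0 the term n = 0 is 1 / 0 = 0, so that row is 2 zeta(2) = pi^2 / 3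
  without any case distinction.\<close>

definition lattice_row :: "complex \<Rightarrow> int \<Rightarrow> complex"
  where "lattice_row \<tau> m = (\<Sum>\<^sub>\<infinity>n::int. 1 / (of_int m * \<tau> + of_int n) ^ 2)"

lemma bij_uminus_int: "bij_betw (uminus :: int \<Rightarrow> int) UNIV UNIV"
  by (rule bij_betwI[where g = uminus]) auto

lemma has_sum_int_inverse_squares:
  "((\<lambda>n::int. 1 / (of_int n) ^ 2) has_sum (of_real pi ^ 2 / 3 :: complex)) UNIV"
proof -
  have sums: "(\<lambda>n. 1 / (real n + 1) ^ 2) sums (pi ^ 2 / 6)"
    using inverse_squares_sums by (simp add: add_ac)
  hence s: "summable (\<lambda>n. 1 / (real n + 1) ^ 2)" by (rule sums_summable)
  have "((\<lambda>n. 1 / (real n + 1) ^ 2) has_sum (pi ^ 2 / 6)) UNIV"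
    by (rule norm_summable_imp_has_sum[OF _ sums]) (use s in simp)
  hence "((\<lambda>n. complex_of_real (1 / (real n + 1) ^ 2)) has_sum of_real (pi ^ 2 / 6)) UNIV"
    by (rule has_sum_of_real)
  hence A: "((\<lambda>n. 1 / (of_int (int (Suc n))) ^ 2) has_sum (of_real pi ^ 2 / 6 :: complex)) UNIV"
    by (simp add: add_ac)
  have pos: "((\<lambda>n::int. 1 / (of_int n) ^ 2) has_sum (of_real pi ^ 2 / 6 :: complex)) {0<..}"
  proof -
    have "bij_betw (\<lambda>n. int (Suc n)) UNIV {0<..}"
      by (rule bij_betwI[where g = "\<lambda>m. nat (m - 1)"]) auto
    from has_sum_reindex_bij_betw[OF this, of "\<lambda>n::int. 1 / (of_int n) ^ 2" "of_real pi ^ 2 / 6 :: complex"]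
    show ?thesis using A by simp
  qed
  have neg: "((\<lambda>n::int. 1 / (of_int n) ^ 2) has_sum (of_real pi ^ 2 / 6 :: complex)) {..<0}"
  proof -
    have "bij_betw uminus {0<..} {..<0::int}"
      by (rule bij_betwI[where g = uminus]) auto
    from has_sum_reindex_bij_betw[OF this, of "\<lambda>n::int. 1 / (of_int n) ^ 2" "of_real pi ^ 2 / 6 :: complex"]
    show ?thesis using pos by simp
  qed
  have "((\<lambda>n::int. 1 / (of_int n) ^ 2) has_sum (of_real pi ^ 2 / 6 + of_real pi ^ 2 / 6 :: complex)) ({0<..} \<union> {..<0})"
    by (intro has_sum_Un_disjoint pos neg) auto
  hence "((\<lambda>n::int. 1 / (of_int n) ^ 2) has_sum (of_real pi ^ 2 / 6 + of_real pi ^ 2 / 6 :: complex)) UNIV"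
    by (rule has_sum_cong_neutral[THEN iffD1, rotated -1]) auto
  thus ?thesis by simp
qed

lemma has_sum_lattice_row:
  assumes "Im \<tau> > 0"
  shows "((\<lambda>n::int. 1 / (of_int m * \<tau> + of_int n) ^ 2) has_sum lattice_row \<tau> m) UNIV"
    and "lattice_row \<tau> m = (if m = 0 then of_real pi ^ 2 / 3
           else (of_real pi / sin (of_real pi * (of_int \<bar>m\<bar> * \<tau>))) ^ 2)"
proof -
  have "((\<lambda>n::int. 1 / (of_int m * \<tau> + of_int n) ^ 2) has_sum (if m = 0 then of_real pi ^ 2 / 3
           else (of_real pi / sin (of_real pi * (of_int \<bar>m\<bar> * \<tau>))) ^ 2)) UNIV"
  proof (cases m "0::int" rule: linorder_cases)
    case equal
    thus ?thesis using has_sum_int_inverse_squares by simp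
  next
    case greater
    hence "Im (of_int \<bar>m\<bar> * \<tau>) > 0" using assms by simp
    from has_sum_inverse_square[OF this] greater show ?thesis by simp
  next
    case less
    hence "Im (of_int \<bar>m\<bar> * \<tau>) > 0" using assms by (simp add: mult_neg_pos)
    from has_sum_inverse_square[OF this]
    have "((\<lambda>n::int. 1 / (of_int \<bar>m\<bar> * \<tau> + of_int (- n)) ^ 2) has_sum
            (of_real pi / sin (of_real pi * (of_int \<bar>m\<bar> * \<tau>))) ^ 2) UNIV"
      using has_sum_reindex_bij_betw[OF bij_uminus_int, of "\<lambda>n::int. 1 / (of_int \<bar>m\<bar> * \<tau> + of_int n) ^ 2"] by simp
    moreover have "(of_int \<bar>m\<bar> * \<tau> + of_int (- n)) ^ 2 = (of_int m * \<tau> + of_int n) ^ 2" for n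
      using less by (simp add: power2_eq_square algebra_simps)
    ultimately show ?thesis using less by simp
  qed
  thus "((\<lambda>n::int. 1 / (of_int m * \<tau> + of_int n) ^ 2) has_sum lattice_row \<tau> m) UNIV"
    "lattice_row \<tau> m = (if m = 0 then of_real pi ^ 2 / 3
           else (of_real pi / sin (of_real pi * (of_int \<bar>m\<bar> * \<tau>))) ^ 2)"
    unfolding lattice_row_def by (auto simp: has_sum_iff)
qed

text \<open>The nesting matters: the double series is not absolutely convergent, and summing over m
  first gives a different value.\<close>

definition eisenstein_G2 :: "complex \<Rightarrow> complex"
  where "eisenstein_G2 \<tau> = (\<Sum>\<^sub>\<infinity>m. lattice_row \<tau> m)"

text \<open>Rows m and - m agree, so the total is the row m = 0 plus twice the sum T that occurs in
  the logarithmic derivative of eta.\<close>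

lemma eisenstein_G2:
  assumes "Im \<tau> > 0"
  shows "(lattice_row \<tau> has_sum eisenstein_G2 \<tau>) UNIV"
    and "deriv dedekind_eta \<tau> = dedekind_eta \<tau> * (\<i> / (4 * of_real pi) * eisenstein_G2 \<tau>)"
proof -
  obtain T where T: "((\<lambda>k. (of_real pi / sin (of_real pi * (of_nat (Suc k) * \<tau>))) ^ 2) has_sum T) UNIV"
    "deriv dedekind_eta \<tau> = dedekind_eta \<tau> * (\<i> / (4 * of_real pi) * (of_real pi ^ 2 / 3 + 2 * T))"
    using deriv_dedekind_eta[OF assms] by blast
  note row = has_sum_lattice_row(2)[OF assms]
  have pos: "(lattice_row \<tau> has_sum T) {0<..}"
  proof -
    have "bij_betw (\<lambda>n. int (Suc n)) UNIV {0<..}"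
      by (rule bij_betwI[where g = "\<lambda>m. nat (m - 1)"]) auto
    from has_sum_reindex_bij_betw[OF this, of "lattice_row \<tau>" T]
    show ?thesis using T(1) by (simp add: row)
  qed
  have neg: "(lattice_row \<tau> has_sum T) {..<0}"
  proof -
    have "bij_betw uminus {0<..} {..<0::int}"
      by (rule bij_betwI[where g = uminus]) auto
    from has_sum_reindex_bij_betw[OF this, of "lattice_row \<tau>" T]
    have "((\<lambda>x. lattice_row \<tau> (- x)) has_sum T) {0<..} = (lattice_row \<tau> has_sum T) {..<0}" .
    moreover have "lattice_row \<tau> (- x) = lattice_row \<tau> x" for x by (simp add: row)
    ultimately show ?thesis using pos by simp
  qed
  have zero: "(lattice_row \<tau> has_sum (of_real pi ^ 2 / 3)) {0}"
    using has_sum_finite[of "{0}" "lattice_row \<tau>"] by (simp add: row)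
  have "(lattice_row \<tau> has_sum (T + (T + of_real pi ^ 2 / 3))) ({0<..} \<union> ({..<0} \<union> {0}))"
    by (intro has_sum_Un_disjoint pos neg zero) auto
  also have "{0<..} \<union> ({..<0} \<union> {0::int}) = UNIV" by auto
  finally have *: "(lattice_row \<tau> has_sum (T + (T + of_real pi ^ 2 / 3))) UNIV" .
  hence "eisenstein_G2 \<tau> = of_real pi ^ 2 / 3 + 2 * T"
    unfolding eisenstein_G2_def by (simp add: has_sum_iff)
  with * T(2) show "(lattice_row \<tau> has_sum eisenstein_G2 \<tau>) UNIV"
    "deriv dedekind_eta \<tau> = dedekind_eta \<tau> * (\<i> / (4 * of_real pi) * eisenstein_G2 \<tau>)"
    by (simp_all add: algebra_simps)
qed

text \<open>
  Subtracting \<open>1 / x - 1 / (x + 1)\<close> makes the double series absolutely convergent. The subtracted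
  terms have vanishing row sums by telescoping, while their column sums produce a cotangent, which
  is the defect in the transformation law. At the two exceptional lattice points the junk value
  \<open>1 / 0 = 0\<close> keeps the telescoping valid.
\<close>
lemma summable_regularised_lattice:
  assumes "Im \<tau> > 0"
  defines "x \<equiv> \<lambda>(m::int, n::int). of_int m * \<tau> + of_int n"
  shows "(\<lambda>p. 1 / x p ^ 2 - (1 / x p - 1 / (x p + 1))) summable_on UNIV"
proof -
  define D where "D = (\<lambda>p. 1 / x p ^ 2 - (1 / x p - 1 / (x p + 1)))"
  define C where "C = (1 / Im \<tau> ^ 2 + (1 + norm \<tau> / Im \<tau>) ^ 2) powr (3 / 2)"
  define sh where "sh = (\<lambda>(m::int, n::int). (m, n + 1))"
  have C: "C \<ge> 0" by (simp add: C_def)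
  have x0: "p = (0, 0)" if "x p = 0" for p
    using that assms(1) by (cases p) (auto simp: x_def complex_eq_iff)
  have x_sh: "x (sh p) = x p + 1" for p by (cases p) (simp add: x_def sh_def)
  have bd: "inverse (norm (x p)) ^ 3 \<le> C * lattice_weight p" if "p \<noteq> (0, 0)" for p
  proof -
    obtain m n where p: "p = (m, n)" by (cases p)
    have "norm (x p) > 0" using x0[of p] that by auto
    hence "inverse (norm (x p)) ^ 3 = norm (x p) powr (- 3)" by (simp add: powr_minus power_inverse)
    also have "\<dots> \<le> C * lattice_weight p"
      using norm_lattice_powr_le[OF assms(1) order_refl order_refl, of m n 3] that
      by (simp add: p x_def C_def)
    finally show ?thesis .
  qed
  have w0: "lattice_weight (0, 0) = 1" "lattice_weight (0, - 1) = 1"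
    by (simp_all add: lattice_weight_def int_weight_def)
  \<comment> \<open>The 2 in C + 2 covers the points (0, 0) and (0, -1), where 1 / 0 = 0 leaves |D|
    equal to 1 and 2.\<close>
  have le: "norm (D p) \<le> (C + 2) * (lattice_weight p + lattice_weight (sh p))" for p
  proof -
    have w: "lattice_weight p > 0" "lattice_weight (sh p) > 0" by (rule lattice_weight_pos)+
    have "p = (0, - 1)" if "x p + 1 = 0"
      using x0[of "sh p"] that unfolding x_sh by (cases p) (simp add: sh_def)
    then consider "p = (0, 0)" | "p = (0, - 1)" | "x p \<noteq> 0" "x p + 1 \<noteq> 0"
      using x0[of p] by blast
    thus ?thesis
    proof cases
      case 1
      have "norm (D p) = 1" using 1 by (simp add: D_def x_def)
      also have "\<dots> \<le> (C + 2) * (1 + 0)" using C by simp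
      also have "\<dots> \<le> (C + 2) * (lattice_weight p + lattice_weight (sh p))"
        using C w by (intro mult_left_mono add_mono) (auto simp: 1 w0)
      finally show ?thesis .
    next
      case 2
      have "norm (D p) = 2" using 2 by (simp add: D_def x_def)
      also have "\<dots> \<le> (C + 2) * (1 + 0)" using C by simp
      also have "\<dots> \<le> (C + 2) * (lattice_weight p + lattice_weight (sh p))"
        using C w by (intro mult_left_mono add_mono) (auto simp: 2 w0)
      finally show ?thesis .
    next
      case 3
      define i j where "i = inverse (x p)" and "j = inverse (x p + 1)"
      \<comment> \<open>With i = 1 / x and j = 1 / (x + 1) this turns D into i^2 j, which decays
        cubically.\<close>
      have ij: "i - j = i * j" using 3 by (simp add: i_def j_def field_simps)
      have "D p = i ^ 2 - (i - j)" by (simp add: D_def i_def j_def divide_inverse power_inverse)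
      also have "\<dots> = i ^ 2 - i * j" by (simp only: ij)
      also have "\<dots> = i * (i - j)" by (simp add: power2_eq_square right_diff_distrib)
      also have "\<dots> = inverse (x p) ^ 2 * inverse (x p + 1)"
        unfolding ij by (simp add: i_def j_def power2_eq_square)
      finally have "D p = inverse (x p) ^ 2 * inverse (x p + 1)" .
      hence "norm (D p) = inverse (norm (x p)) ^ 2 * inverse (norm (x p + 1))"
        by (simp add: norm_mult norm_power norm_inverse)
      also have "\<dots> \<le> inverse (norm (x p)) ^ 3 + inverse (norm (x p + 1)) ^ 3"
      proof -
        define a b where "a = inverse (norm (x p))" and "b = inverse (norm (x p + 1))"
        have ab: "a \<ge> 0" "b \<ge> 0" by (auto simp: a_def b_def)
        \<comment> \<open>Separates the mixed product into a cube at p and a cube at the shifted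
          point \<open>sh p\<close>, to each of which \<open>bd\<close> applies.\<close>
        have "a ^ 2 * b \<le> a ^ 3 + b ^ 3"
        proof (cases "a \<le> b")
          case True
          hence "a ^ 2 * b \<le> b ^ 2 * b" using ab by (intro mult_right_mono power_mono) auto
          thus ?thesis using ab by (simp add: power2_eq_square power3_eq_cube add_increasing)
        next
          case False
          hence "a ^ 2 * b \<le> a ^ 2 * a" using ab by (intro mult_left_mono) auto
          thus ?thesis using ab by (simp add: power2_eq_square power3_eq_cube add_increasing2)
        qed
        thus ?thesis by (simp add: a_def b_def)
      qed
      also have "\<dots> \<le> C * lattice_weight p + C * lattice_weight (sh p)"
      proof (rule add_mono)
        have "p \<noteq> (0, 0)" using 3 by (auto simp: x_def)
        thus "inverse (norm (x p)) ^ 3 \<le> C * lattice_weight p" by (rule bd)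
        have "x (sh p) \<noteq> 0" using 3 by (simp add: x_sh)
        hence "sh p \<noteq> (0, 0)" by (auto simp: x_def)
        from bd[OF this] show "inverse (norm (x p + 1)) ^ 3 \<le> C * lattice_weight (sh p)" by (simp add: x_sh)
      qed
      also have "\<dots> \<le> (C + 2) * (lattice_weight p + lattice_weight (sh p))"
        using w C by (simp add: algebra_simps)
      finally show ?thesis .
    qed
  qed
  have "bij_betw sh UNIV UNIV"
    by (rule bij_betwI[where g = "\<lambda>(m, n). (m, n - 1)"]) (auto simp: sh_def)
  hence "(\<lambda>p. lattice_weight (sh p)) summable_on UNIV"
    using summable_on_reindex_bij_betw[of sh UNIV UNIV lattice_weight] summable_lattice_weight by blast
  hence "(\<lambda>p. (C + 2) * (lattice_weight p + lattice_weight (sh p))) summable_on UNIV"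
    by (intro summable_on_cmult_right summable_on_add summable_lattice_weight)
  hence "(\<lambda>p. norm (D p)) summable_on UNIV"
    by (rule summable_on_comparison_test) (use le in auto)
  thus ?thesis unfolding D_def by (rule abs_summable_summable)
qed

lemma telescope_int_interval:
  fixes f :: "int \<Rightarrow> 'a :: ab_group_add"
  shows "(\<Sum>n\<in>{- int N..<int N}. f n - f (n + 1)) = f (- int N) - f (int N)"
proof (induction N)
  case (Suc N)
  have "{- int (Suc N)..<int (Suc N)} = insert (int N) (insert (- int N - 1) {- int N..<int N})" by auto
  moreover have "- int N - 1 = - 1 - int N" by simp
  ultimately show ?case using Suc by (simp add: algebra_simps)
qed auto

lemma Im_of_real_divide: "Im (of_real r / z) = - r * Im z / norm z ^ 2"
  by (simp add: Im_divide cmod_power2)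

lemma Im_minus_inverse_pos:
  assumes "Im \<tau> > 0"
  shows "Im (- 1 / \<tau>) > 0"
proof -
  have "\<tau> \<noteq> 0" using assms by auto
  thus ?thesis using assms Im_of_real_divide[of "-1" \<tau>] by simp
qed

text \<open>In the lower half-plane exp(- 2 i N z) tends to 0. The sign of this limit decides the
  sign of the defect in the law for \<open>eisenstein_G2\<close>.\<close>

lemma tendsto_cot_lower:
  assumes "Im z < 0"
  shows "(\<lambda>N. cot (of_nat N * z)) \<longlonglongrightarrow> \<i>"
proof -
  have "(\<lambda>N. exp (- (2 * \<i> * (of_nat N * z)))) \<longlonglongrightarrow> 0"
  proof (rule tendsto_norm_zero_cancel)
    have "(\<lambda>N. exp (2 * Im z * real N)) \<longlonglongrightarrow> 0" using assms by real_asymp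
    thus "(\<lambda>N. norm (exp (- (2 * \<i> * (of_nat N * z))))) \<longlonglongrightarrow> 0"
      by (simp add: norm_exp_eq_Re mult_ac)
  qed
  hence "(\<lambda>N. \<i> * (1 + exp (- (2 * \<i> * (of_nat N * z)))) / (1 - exp (- (2 * \<i> * (of_nat N * z))))) \<longlonglongrightarrow>
           \<i> * (1 + 0) / (1 - 0)"
    by (intro tendsto_intros) auto
  moreover have "\<i> * (1 + exp (- (2 * \<i> * w))) / (1 - exp (- (2 * \<i> * w))) = cot w" for w :: complex
  proof -
    define e where "e = exp (\<i> * w)"
    have e: "e \<noteq> 0" by (simp add: e_def)
    have 1: "exp (- (2 * \<i> * w)) = inverse e ^ 2"
      by (simp add: e_def exp_double [symmetric] exp_minus [symmetric] mult_ac)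
    have "cos w = e * (1 + inverse e ^ 2) / 2"
      unfolding cos_exp_eq using e by (simp add: e_def exp_minus field_simps power2_eq_square)
    moreover have "sin w = e * (1 - inverse e ^ 2) / (2 * \<i>)"
      unfolding sin_exp_eq using e by (simp add: e_def exp_minus field_simps power2_eq_square)
    ultimately show ?thesis using e unfolding 1 cot_def by (simp add: mult_ac)
  qed
  ultimately show ?thesis by simp
qed

lemma has_sum_sum:
  fixes f :: "'a \<Rightarrow> 'b \<Rightarrow> 'c :: topological_comm_monoid_add"
  assumes "\<And>i. i \<in> I \<Longrightarrow> (f i has_sum S i) A"
  shows "((\<lambda>x. \<Sum>i\<in>I. f i x) has_sum (\<Sum>i\<in>I. S i)) A"
  using assms by (induction I rule: infinite_finite_induct) (auto intro!: has_sum_add)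

text \<open>The regularised terms D may be summed in either order. By rows the result is G2(tau); by
  columns it is G2(- 1 / tau) / tau^2 minus the total of the column sums V of the subtracted part.
  Equating the two leaves only that total to be computed.\<close>

lemma eisenstein_G2_S:
  assumes "Im \<tau> > 0"
  shows "eisenstein_G2 (- 1 / \<tau>) / \<tau> ^ 2 = eisenstein_G2 \<tau> - 2 * of_real pi * \<i> / \<tau>"
proof -
  define x where "x = (\<lambda>(m::int, n::int). of_int m * \<tau> + of_int n)"
  define u where "u = (\<lambda>p. 1 / x p - 1 / (x p + 1))"
  define D where "D = (\<lambda>p. 1 / x p ^ 2 - u p)"
  have \<tau>: "\<tau> \<noteq> 0" using assms by auto
  have im: "Im (- 1 / \<tau>) > 0" by (rule Im_minus_inverse_pos[OF assms])
  have "D summable_on UNIV"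
    unfolding D_def u_def x_def by (rule summable_regularised_lattice[OF assms])
  then obtain X where X: "(D has_sum X) (UNIV \<times> UNIV)"
    by (auto simp: summable_on_def)
  have X': "((\<lambda>(n, m). D (m, n)) has_sum X) (UNIV \<times> UNIV)"
    using X by (subst (asm) has_sum_swap) auto
  have rowD: "(\<lambda>n. D (m, n)) summable_on UNIV" for m
    using summable_on_SigmaD1[of "\<lambda>m n. D (m, n)" UNIV "\<lambda>_. UNIV" m] X by (auto simp: summable_on_def)
  have t_row: "((\<lambda>n. 1 / x (m, n) ^ 2) has_sum lattice_row \<tau> m) UNIV" for m
    using has_sum_lattice_row(1)[OF assms, of m] by (simp add: x_def)
  \<comment> \<open>Factoring tau out of m tau + n turns a column for tau into a row for - 1 / tau,
    divided by tau^2.\<close>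
  have t_col: "((\<lambda>m. 1 / x (m, n) ^ 2) has_sum lattice_row (- 1 / \<tau>) n / \<tau> ^ 2) UNIV" for n
  proof -
    have "((\<lambda>m. 1 / (of_int n * (- 1 / \<tau>) + of_int m) ^ 2) has_sum lattice_row (- 1 / \<tau>) n) UNIV"
      by (rule has_sum_lattice_row(1)[OF im])
    hence "((\<lambda>m. 1 / (of_int n * (- 1 / \<tau>) + of_int (- m)) ^ 2) has_sum lattice_row (- 1 / \<tau>) n) UNIV"
      using has_sum_reindex_bij_betw[OF bij_uminus_int, of "\<lambda>m. 1 / (of_int n * (- 1 / \<tau>) + of_int m) ^ 2"]
      by blast
    hence "((\<lambda>m. 1 / (of_int n * (- 1 / \<tau>) + of_int (- m)) ^ 2 * (1 / \<tau> ^ 2)) has_sum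
             lattice_row (- 1 / \<tau>) n * (1 / \<tau> ^ 2)) UNIV"
      by (rule has_sum_cmult_left)
    moreover have "1 / (of_int n * (- 1 / \<tau>) + of_int (- m)) ^ 2 * (1 / \<tau> ^ 2) = 1 / x (m, n) ^ 2" for m
    proof -
      have "(of_int n * (- 1 / \<tau>) + of_int (- m)) * \<tau> = - x (m, n)"
        using \<tau> by (simp add: x_def field_simps)
      hence "(of_int n * (- 1 / \<tau>) + of_int (- m)) ^ 2 * \<tau> ^ 2 = x (m, n) ^ 2"
        by (metis power_mult_distrib power2_minus)
      thus ?thesis by simp
    qed
    ultimately show ?thesis by simp
  qed
  have colD: "(\<lambda>m. D (m, n)) summable_on UNIV" for n
    using summable_on_SigmaD1[of "\<lambda>n m. D (m, n)" UNIV "\<lambda>_. UNIV" n] X' by (auto simp: summable_on_def)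
  have u_eq: "u p = 1 / x p ^ 2 + (-1) * D p" for p by (simp add: D_def)
  have u_row: "(\<lambda>n. u (m, n)) summable_on UNIV" for m
    unfolding u_eq by (intro summable_on_add summable_on_cmult_right rowD has_sum_imp_summable[OF t_row])
  have u_col: "(\<lambda>m. u (m, n)) summable_on UNIV" for n
    unfolding u_eq by (intro summable_on_add summable_on_cmult_right colD has_sum_imp_summable[OF t_col])
  have u_tel: "(\<Sum>n\<in>{- int N..<int N}. u (m, n)) = 1 / x (m, - int N) - 1 / x (m, int N)" for m N
    using telescope_int_interval[of "\<lambda>n. 1 / x (m, n)" N] by (simp add: u_def x_def add_ac)
  \<comment> \<open>Summability is already known from the difference of two summable families, so
    the telescoping symmetric sums are enough to find the value.\<close>
  have u_row0: "((\<lambda>n. u (m, n)) has_sum 0) UNIV" for m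
  proof -
    obtain V where V: "((\<lambda>n. u (m, n)) has_sum V) UNIV" using u_row[of m] by (auto simp: summable_on_def)
    have "(\<lambda>N. 1 / x (m, - int N) - 1 / x (m, int N)) \<longlonglongrightarrow> V"
      using has_sum_int_imp_LIMSEQ[OF V] by (simp only: u_tel)
    moreover have lim: "(\<lambda>N. 1 / (c + of_nat N)) \<longlonglongrightarrow> 0" for c :: complex
      by (intro tendsto_divide_0[OF tendsto_const] tendsto_add_filterlim_at_infinity[OF tendsto_const] tendsto_of_nat)
    have "(\<lambda>N. - (1 / (- (of_int m * \<tau>) + of_nat N)) - 1 / (of_int m * \<tau> + of_nat N)) \<longlonglongrightarrow> - 0 - 0"
      by (intro tendsto_intros lim)
    moreover have "- (1 / (- (of_int m * \<tau>) + of_nat N)) = 1 / x (m, - int N)" for N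
    proof -
      have "x (m, - int N) = - (- (of_int m * \<tau>) + of_nat N)" by (simp add: x_def)
      thus ?thesis by (simp only: minus_divide_right)
    qed
    hence "(\<lambda>N. - (1 / (- (of_int m * \<tau>) + of_nat N)) - 1 / (of_int m * \<tau> + of_nat N)) =
             (\<lambda>N. 1 / x (m, - int N) - 1 / x (m, int N))" by (simp add: x_def)
    ultimately have "V = 0" using LIMSEQ_unique by fastforce
    with V show ?thesis by simp
  qed
  have "((\<lambda>n. D (m, n)) has_sum lattice_row \<tau> m) UNIV" for m
  proof -
    have "((\<lambda>n. 1 / x (m, n) ^ 2 + (-1) * u (m, n)) has_sum (lattice_row \<tau> m + (-1) * 0)) UNIV"
      by (intro has_sum_add has_sum_cmult_right t_row u_row0)
    thus ?thesis by (simp add: D_def)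
  qed
  hence "(lattice_row \<tau> has_sum X) UNIV" by (intro has_sum_SigmaD[OF X]) auto
  hence X_eq: "X = eisenstein_G2 \<tau>" using eisenstein_G2(1)[OF assms] has_sum_unique by blast
  define V where "V = (\<lambda>n. \<Sum>\<^sub>\<infinity>m. u (m, n))"
  have V: "((\<lambda>m. u (m, n)) has_sum V n) UNIV" for n
    unfolding V_def by (rule has_sum_infsum[OF u_col])
  have "((\<lambda>m. D (m, n)) has_sum (lattice_row (- 1 / \<tau>) n / \<tau> ^ 2 - V n)) UNIV" for n
  proof -
    have "((\<lambda>m. 1 / x (m, n) ^ 2 + (-1) * u (m, n)) has_sum (lattice_row (- 1 / \<tau>) n / \<tau> ^ 2 + (-1) * V n)) UNIV"
      by (intro has_sum_add has_sum_cmult_right t_col V)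
    thus ?thesis by (simp add: D_def)
  qed
  hence "((\<lambda>n. lattice_row (- 1 / \<tau>) n / \<tau> ^ 2 - V n) has_sum X) UNIV"
    by (intro has_sum_SigmaD[OF X']) auto
  moreover have "((\<lambda>n. lattice_row (- 1 / \<tau>) n * (1 / \<tau> ^ 2)) has_sum eisenstein_G2 (- 1 / \<tau>) * (1 / \<tau> ^ 2)) UNIV"
    by (intro has_sum_cmult_left eisenstein_G2(1)[OF im])
  ultimately have "((\<lambda>n. lattice_row (- 1 / \<tau>) n * (1 / \<tau> ^ 2) + (-1) * (lattice_row (- 1 / \<tau>) n / \<tau> ^ 2 - V n)) has_sum
          (eisenstein_G2 (- 1 / \<tau>) * (1 / \<tau> ^ 2) + (-1) * X)) UNIV"
    by (intro has_sum_add has_sum_cmult_right)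
  hence "(V has_sum (eisenstein_G2 (- 1 / \<tau>) / \<tau> ^ 2 - eisenstein_G2 \<tau>)) UNIV"
    by (simp add: X_eq)
  hence "(\<lambda>N. \<Sum>n\<in>{- int N..<int N}. V n) \<longlonglongrightarrow> eisenstein_G2 (- 1 / \<tau>) / \<tau> ^ 2 - eisenstein_G2 \<tau>"
    by (rule has_sum_int_imp_LIMSEQ)
  \<comment> \<open>For fixed N the finite sum over n is taken inside the sum over m, where it
    telescopes. The remaining sum over m is a difference of two partial fraction series, at - N /
    tau and N / tau, that is, twice a cotangent. As pi / tau lies in the lower half-plane, the
    cotangent tends to i.\<close>
  moreover have "(\<lambda>N. \<Sum>n\<in>{- int N..<int N}. V n) \<longlonglongrightarrow> - 2 * of_real pi * \<i> / \<tau>"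
  proof (rule Lim_transform_eventually)
    have "Im (of_real pi / \<tau>) < 0"
      using assms \<tau> by (simp add: Im_of_real_divide divide_less_0_iff)
    hence "(\<lambda>N. cot (of_nat N * (of_real pi / \<tau>))) \<longlonglongrightarrow> \<i>" by (rule tendsto_cot_lower)
    from tendsto_mult_left[OF this, of "- 2 * of_real pi / \<tau>"]
    show "(\<lambda>N. (- 2 * of_real pi / \<tau>) * cot (of_nat N * (of_real pi / \<tau>))) \<longlonglongrightarrow> - 2 * of_real pi * \<i> / \<tau>"
      by simp
    show "\<forall>\<^sub>F N in sequentially. (- 2 * of_real pi / \<tau>) * cot (of_nat N * (of_real pi / \<tau>)) = (\<Sum>n\<in>{- int N..<int N}. V n)"
      using eventually_gt_at_top[of 0]
    proof eventually_elim
      case (elim N)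
      define z where "z = of_nat N / \<tau>"
      have "Im z < 0" using assms elim \<tau> Im_of_real_divide[of "real N" \<tau>]
        by (simp add: z_def divide_less_0_iff)
      moreover have "w \<notin> \<int>" if "Im w \<noteq> 0" for w using that by (auto elim!: Ints_cases)
      ultimately have z: "z \<notin> \<int>" "- z \<notin> \<int>" by auto
      have "((\<lambda>m. \<Sum>n\<in>{- int N..<int N}. u (m, n)) has_sum (\<Sum>n\<in>{- int N..<int N}. V n)) UNIV"
        by (intro has_sum_sum V)
      hence "((\<lambda>m. 1 / x (m, - int N) - 1 / x (m, int N)) has_sum (\<Sum>n\<in>{- int N..<int N}. V n)) UNIV"
        by (simp only: u_tel)
      hence "(\<lambda>M. \<Sum>m\<in>{- int M..<int M}. 1 / x (m, - int N) - 1 / x (m, int N)) \<longlonglongrightarrow> (\<Sum>n\<in>{- int N..<int N}. V n)"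
        by (rule has_sum_int_imp_LIMSEQ)
      moreover have "1 / x (m, - int N) - 1 / x (m, int N) = 1 / \<tau> * (1 / (- z + of_int m)) - 1 / \<tau> * (1 / (z + of_int m))" for m
      proof -
        have "x (m, - int N) = \<tau> * (- z + of_int m)" "x (m, int N) = \<tau> * (z + of_int m)"
          using \<tau> by (simp_all add: x_def z_def field_simps)
        thus ?thesis by simp
      qed
      ultimately have "(\<lambda>M. 1 / \<tau> * (\<Sum>m\<in>{- int M..<int M}. 1 / (- z + of_int m)) - 1 / \<tau> * (\<Sum>m\<in>{- int M..<int M}. 1 / (z + of_int m)))
            \<longlonglongrightarrow> (\<Sum>n\<in>{- int N..<int N}. V n)"
        by (simp only: sum_subtractf sum_distrib_left)
      moreover have "(\<lambda>M. 1 / \<tau> * (\<Sum>m\<in>{- int M..<int M}. 1 / (- z + of_int m)) - 1 / \<tau> * (\<Sum>m\<in>{- int M..<int M}. 1 / (z + of_int m)))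
            \<longlonglongrightarrow> 1 / \<tau> * (of_real pi * cot (of_real pi * (- z))) - 1 / \<tau> * (of_real pi * cot (of_real pi * z))"
        by (intro tendsto_intros cot_partial_fractions z)
      ultimately have "(\<Sum>n\<in>{- int N..<int N}. V n) =
            1 / \<tau> * (of_real pi * cot (of_real pi * (- z))) - 1 / \<tau> * (of_real pi * cot (of_real pi * z))"
        by (rule LIMSEQ_unique)
      also have "\<dots> = (- 2 * of_real pi / \<tau>) * cot (of_nat N * (of_real pi / \<tau>))"
        by (simp add: cot_def z_def mult_ac)
      finally show ?case ..
    qed
  qed
  ultimately have "eisenstein_G2 (- 1 / \<tau>) / \<tau> ^ 2 - eisenstein_G2 \<tau> = - 2 * of_real pi * \<i> / \<tau>"
    by (rule LIMSEQ_unique)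
  thus ?thesis by (simp add: algebra_simps)
qed

section \<open>The inversion law for the 24th power of eta\<close>

text \<open>The logarithmic derivatives of the two sides agree by \<open>eisenstein_G2_S\<close>, so
  their quotient F is constant on the half-plane. The 24th power keeps the square root of tau, and
  its branch, out of the argument.\<close>

lemma dedekind_eta_power_24_S:
  assumes "Im \<tau> > 0"
  shows "dedekind_eta (- 1 / \<tau>) ^ 24 = \<tau> ^ 12 * dedekind_eta \<tau> ^ 24"
proof -
  define F where "F = (\<lambda>\<tau>. dedekind_eta (- 1 / \<tau>) ^ 24 / (\<tau> ^ 12 * dedekind_eta \<tau> ^ 24))"
  have dF: "(F has_field_derivative 0) (at z)" if z: "Im z > 0" for z
  proof -
    define A B where "A = dedekind_eta (- 1 / z)" and "B = dedekind_eta z"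
    define P Q where "P = \<i> / (4 * of_real pi) * eisenstein_G2 (- 1 / z)" and "Q = \<i> / (4 * of_real pi) * eisenstein_G2 z"
    have z0: "z \<noteq> 0" using z by auto
    have im: "Im (- 1 / z) > 0" by (rule Im_minus_inverse_pos[OF z])
    have B0: "B \<noteq> 0" unfolding B_def by (rule dedekind_eta_nonzero[OF z])
    \<comment> \<open>P and Q are the logarithmic derivatives of eta at - 1 / z and at z. The defect
      of G2 becomes z / 2, and 24 * (z / 2) / z^2 = 12 / z is the logarithmic derivative of
      z^12.\<close>
    have PQ: "P = z ^ 2 * Q + z / 2"
    proof -
      have "eisenstein_G2 (- 1 / z) = z ^ 2 * (eisenstein_G2 z - 2 * of_real pi * \<i> / z)"
        using eisenstein_G2_S[OF z] z0 by (simp add: field_simps)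
      hence "P = z ^ 2 * Q - \<i> / (4 * of_real pi) * (z ^ 2 * (2 * of_real pi * \<i> / z))"
        by (simp add: P_def Q_def right_diff_distrib mult_ac)
      also have "\<i> / (4 * of_real pi) * (z ^ 2 * (2 * of_real pi * \<i> / z)) = - (z / 2)"
        using z0 by (simp add: field_simps power2_eq_square)
      finally show ?thesis by simp
    qed
    have op: "open {\<tau>. Im \<tau> > 0}" by (rule open_halfspace_Im_gt)
    have dB: "(dedekind_eta has_field_derivative B * Q) (at z)"
      using holomorphic_derivI[OF holomorphic_dedekind_eta op, of z] z eisenstein_G2(2)[OF z]
      by (simp add: B_def Q_def)
    have "(dedekind_eta has_field_derivative A * P) (at (- 1 / z))"
      using holomorphic_derivI[OF holomorphic_dedekind_eta op, of "- 1 / z"] im eisenstein_G2(2)[OF im]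
      by (simp add: A_def P_def)
    moreover have "((\<lambda>w. - 1 / w) has_field_derivative 1 / z ^ 2) (at z)"
      using z0 by (auto intro!: derivative_eq_intros simp: power2_eq_square)
    ultimately have dA: "((\<lambda>w. dedekind_eta (- 1 / w)) has_field_derivative A * P * (1 / z ^ 2)) (at z)"
      by (rule DERIV_chain2)
    define a b d where "a = A ^ 23" and "b = B ^ 23" and "d = z ^ 10"
    have pw: "A ^ 24 = A * a" "B ^ 24 = B * b" "z ^ 12 = z ^ 2 * d" "z ^ 11 = z * d"
      by (simp_all add: a_def b_def d_def flip: power_Suc power_add)
    have dB24: "((\<lambda>w. dedekind_eta w ^ 24) has_field_derivative 24 * (B * Q * b)) (at z)"
      using DERIV_power[OF dB, of 24] by (simp add: B_def b_def)
    have dA24: "((\<lambda>w. dedekind_eta (- 1 / w) ^ 24) has_field_derivative 24 * (A * P * (1 / z ^ 2) * a)) (at z)"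
      using DERIV_power[OF dA, of 24] by (simp add: A_def a_def)
    have dz: "((\<lambda>w. w ^ 12) has_field_derivative 12 * (z * d)) (at z)"
      unfolding pw(4) [symmetric] by (auto intro!: derivative_eq_intros)
    have "(F has_field_derivative
            (24 * (A * P * (1 / z ^ 2) * a) * (z ^ 12 * dedekind_eta z ^ 24) -
              dedekind_eta (- 1 / z) ^ 24 * (12 * (z * d) * dedekind_eta z ^ 24 + 24 * (B * Q * b) * z ^ 12)) /
            ((z ^ 12 * dedekind_eta z ^ 24) * (z ^ 12 * dedekind_eta z ^ 24))) (at z)"
      unfolding F_def by (intro DERIV_divide DERIV_mult dA24 dB24 dz) (use z0 B0 in \<open>auto simp: B_def\<close>)
    also have "24 * (A * P * (1 / z ^ 2) * a) * (z ^ 12 * dedekind_eta z ^ 24) -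
              dedekind_eta (- 1 / z) ^ 24 * (12 * (z * d) * dedekind_eta z ^ 24 + 24 * (B * Q * b) * z ^ 12) = 0"
    proof -
      have "24 * (A * P * (1 / z ^ 2) * a) * (z ^ 12 * dedekind_eta z ^ 24) =
              24 * A * P * a * d * B * b * (1 / z ^ 2 * z ^ 2)"
        by (simp only: pw B_def [symmetric] mult_ac)
      also have "\<dots> = 24 * A * (z ^ 2 * Q + z / 2) * a * d * B * b"
        using z0 PQ by simp
      also have "\<dots> = (A * a) * (12 * (z * d) * (B * b) + 24 * (B * Q * b) * (z ^ 2 * d))"
        by (simp add: algebra_simps)
      also have "\<dots> = dedekind_eta (- 1 / z) ^ 24 * (12 * (z * d) * dedekind_eta z ^ 24 + 24 * (B * Q * b) * z ^ 12)"
        by (simp only: pw A_def [symmetric] B_def [symmetric])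
      finally show ?thesis by simp
    qed
    finally show ?thesis by simp
  qed
  have "F constant_on {\<tau>. Im \<tau> > 0}"
    by (rule has_field_derivative_0_imp_constant_on)
       (auto intro: dF convex_connected convex_halfspace_Im_gt open_halfspace_Im_gt)
  then obtain c where c: "F z = c" if "Im z > 0" for z
    unfolding constant_on_def by blast
  have "F \<tau> = F \<i>" using c[OF assms] c[of \<i>] by simp
  \<comment> \<open>The point i is fixed by - 1 / z, and i^12 = 1.\<close>
  also have "F \<i> = 1"
    using dedekind_eta_nonzero[of \<i>] by (simp add: F_def)
  finally have "dedekind_eta (- 1 / \<tau>) ^ 24 / (\<tau> ^ 12 * dedekind_eta \<tau> ^ 24) = 1"
    by (simp only: F_def)
  thus ?thesis by (simp only: divide_eq_1_iff)
qed

section \<open>The eta multiplier\<close>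

lemma q_power_1_add_int: "q_power 1 (\<tau> + of_int k) = q_power 1 \<tau>"
  using q_power_int_int[of 1 k] by (simp add: q_power_add_right)

lemma dedekind_eta_power_24_eq: "dedekind_eta \<tau> ^ 24 = q_power 1 \<tau> * euler_prod (q_power 1 \<tau>) ^ 24"
proof -
  have "q_power (1 / 24) \<tau> ^ 24 = q_power 1 \<tau>"
    by (simp add: q_power_def exp_of_nat_mult [symmetric] mult_ac)
  thus ?thesis by (simp add: dedekind_eta_eq power_mult_distrib)
qed

lemma dedekind_eta_power_24_add_int: "dedekind_eta (\<tau> + of_int k) ^ 24 = dedekind_eta \<tau> ^ 24"
  by (simp add: dedekind_eta_power_24_eq q_power_1_add_int)

lemma moebius_denom_nonzero:
  assumes "a * d - b * c = (1::int)" "Im \<tau> > 0"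
  shows "of_int c * \<tau> + of_int d \<noteq> (0::complex)"
proof
  assume *: "of_int c * \<tau> + of_int d = (0::complex)"
  hence "of_int c * Im \<tau> = 0" by (metis Im_complex_of_real add_0_right complex_Im_of_int plus_complex.sel(2) of_real_of_int_eq scaleR_conv_of_real scaleR_complex.sel(2) zero_complex.sel(2))
  hence "c = 0" using assms by simp
  moreover from this * have "d = 0" by simp
  ultimately show False using assms by simp
qed

lemma Im_moebius:
  assumes "a * d - b * c = (1::int)" "Im \<tau> > 0"
  shows "Im ((of_int a * \<tau> + of_int b) / (of_int c * \<tau> + of_int d)) =
           Im \<tau> / norm (of_int c * \<tau> + of_int d) ^ 2"
proof -
  have "Im ((of_int a * \<tau> + of_int b) / (of_int c * \<tau> + of_int d)) =
          (of_int (a * d - b * c) * Im \<tau>) / norm (of_int c * \<tau> + of_int d) ^ 2"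
    by (simp add: Im_divide cmod_power2 algebra_simps)
  thus ?thesis using assms by simp
qed

lemma Im_moebius_pos:
  assumes "a * d - b * c = (1::int)" "Im \<tau> > 0"
  shows "Im ((of_int a * \<tau> + of_int b) / (of_int c * \<tau> + of_int d)) > 0"
  using moebius_denom_nonzero[OF assms] assms by (simp add: Im_moebius)

text \<open>Euclid's algorithm on the lower row: the matrix is factored as M' S T^k with k = d div
  c, and M' has lower row (r, - c) with r = d mod c, so |c| drops.\<close>

lemma dedekind_eta_power_24_moebius:
  assumes "a * d - b * c = (1::int)" "Im \<tau> > 0"
  shows "dedekind_eta ((of_int a * \<tau> + of_int b) / (of_int c * \<tau> + of_int d)) ^ 24 =
           (of_int c * \<tau> + of_int d) ^ 12 * dedekind_eta \<tau> ^ 24"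
  using assms
proof (induction "nat \<bar>c\<bar>" arbitrary: a b c d \<tau> rule: less_induct)
  case less
  show ?case
  proof (cases "c = 0")
    case True
    hence "a * d = 1" using less.prems by simp
    hence "a = 1 \<and> d = 1 \<or> a = - 1 \<and> d = - 1" by (simp add: zmult_eq_1_iff)
    thus ?thesis
    proof
      assume "a = 1 \<and> d = 1"
      thus ?thesis using True dedekind_eta_power_24_add_int[of \<tau> b] by simp
    next
      assume "a = - 1 \<and> d = - 1"
      thus ?thesis using True dedekind_eta_power_24_add_int[of \<tau> "- b"] by simp
    qed
  next
    case False
    define k r where "k = d div c" and "r = d mod c"
    define \<tau>1 where "\<tau>1 = \<tau> + of_int k"
    define \<tau>2 where "\<tau>2 = - 1 / \<tau>1"
    have d: "d = c * k + r" by (simp add: k_def r_def)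
    have im1: "Im \<tau>1 > 0" using less.prems by (simp add: \<tau>1_def)
    hence im2: "Im \<tau>2 > 0" unfolding \<tau>2_def by (rule Im_minus_inverse_pos)
    have nz: "\<tau>1 \<noteq> 0" using im1 by auto
    \<comment> \<open>The entries of M' = M T^(-k) S^(-1), which acts on the point tau2 = S T^k
      tau.\<close>
    have det: "(b - a * k) * (- c) - (- a) * r = 1"
      using less.prems d by (simp add: algebra_simps)
    have lt: "nat \<bar>r\<bar> < nat \<bar>c\<bar>"
      using abs_mod_less[OF False, of d] by (simp add: r_def)
    have num: "of_int (b - a * k) * \<tau>2 + of_int (- a) = - ((of_int a * \<tau> + of_int b) / \<tau>1)"
      using nz by (simp add: \<tau>2_def field_simps) (simp add: \<tau>1_def algebra_simps)
    have den: "of_int r * \<tau>2 + of_int (- c) = - ((of_int c * \<tau> + of_int d) / \<tau>1)"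
      using nz by (simp add: \<tau>2_def d field_simps) (simp add: \<tau>1_def algebra_simps)
    have "dedekind_eta ((of_int (b - a * k) * \<tau>2 + of_int (- a)) / (of_int r * \<tau>2 + of_int (- c))) ^ 24 =
            (of_int r * \<tau>2 + of_int (- c)) ^ 12 * dedekind_eta \<tau>2 ^ 24"
      by (rule less.hyps[OF lt det im2])
    also have "dedekind_eta \<tau>2 ^ 24 = \<tau>1 ^ 12 * dedekind_eta \<tau> ^ 24"
      using dedekind_eta_power_24_S[OF im1] dedekind_eta_power_24_add_int[of \<tau> k] by (simp add: \<tau>2_def \<tau>1_def)
    also have "(of_int r * \<tau>2 + of_int (- c)) ^ 12 * (\<tau>1 ^ 12 * dedekind_eta \<tau> ^ 24) =
                 (of_int c * \<tau> + of_int d) ^ 12 * dedekind_eta \<tau> ^ 24"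
    proof -
      have "(- y) ^ 12 = y ^ 12" for y :: complex by (simp add: power_minus_even)
      thus ?thesis unfolding den using nz by (simp only: power_divide) simp
    qed
    also have "(of_int (b - a * k) * \<tau>2 + of_int (- a)) / (of_int r * \<tau>2 + of_int (- c)) =
                 (of_int a * \<tau> + of_int b) / (of_int c * \<tau> + of_int d)"
      unfolding num den using nz by (simp add: divide_simps)
    finally show ?thesis .
  qed
qed

text \<open>Nonnegative reals have unique 24th roots, so the law for eta^24 determines |eta|; the
  estimates for the Poincare series rest on this.\<close>

lemma norm_dedekind_eta_moebius:
  assumes "a * d - b * c = (1::int)" "Im \<tau> > 0"
  shows "norm (dedekind_eta ((of_int a * \<tau> + of_int b) / (of_int c * \<tau> + of_int d))) =
           sqrt (norm (of_int c * \<tau> + of_int d)) * norm (dedekind_eta \<tau>)"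
proof -
  define n where "n = norm (of_int c * \<tau> + of_int d)"
  have "sqrt n ^ 24 = (sqrt n ^ 2) ^ 12" by (simp flip: power_mult)
  also have "\<dots> = n ^ 12" by (simp add: n_def)
  finally have "(sqrt n * norm (dedekind_eta \<tau>)) ^ 24 = n ^ 12 * norm (dedekind_eta \<tau>) ^ 24"
    by (simp add: power_mult_distrib)
  also have "\<dots> = norm ((of_int c * \<tau> + of_int d) ^ 12 * dedekind_eta \<tau> ^ 24)"
    by (simp add: norm_mult norm_power n_def)
  also have "\<dots> = norm (dedekind_eta ((of_int a * \<tau> + of_int b) / (of_int c * \<tau> + of_int d))) ^ 24"
    unfolding dedekind_eta_power_24_moebius[OF assms, symmetric] by (rule norm_power)
  finally have "norm (dedekind_eta ((of_int a * \<tau> + of_int b) / (of_int c * \<tau> + of_int d))) ^ 24 =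
                  (sqrt n * norm (dedekind_eta \<tau>)) ^ 24" ..
  thus ?thesis unfolding n_def by (rule power_eq_imp_eq_base) auto
qed

text \<open>The two conventions for the argument differ only on the negative real axis, which c tau
  + d avoids when c > 0.\<close>

lemma branch_sqrt_eq_csqrt:
  assumes "Im z > 0"
  shows "branch_sqrt z = csqrt z"
proof -
  have z: "z \<noteq> 0" using assms by auto
  have "Arg z \<noteq> pi" using assms Arg_eq_pi[of z] by auto
  hence "branch_sqrt z = of_real (sqrt (norm z)) * exp (\<i> * of_real (Arg z / 2))"
    by (simp add: branch_sqrt_def branch_arg_def)
  also have "of_real (sqrt (norm z)) = exp (complex_of_real (ln (norm z) / 2))"
    using z by (simp add: exp_of_real ln_sqrt [symmetric])
  also have "exp (complex_of_real (ln (norm z) / 2)) * exp (\<i> * of_real (Arg z / 2)) = exp (Ln z / 2)"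
    using z by (simp add: Ln_Arg exp_add [symmetric] add_divide_distrib)
  also have "\<dots> = csqrt z" using z by (simp add: csqrt_exp_Ln)
  finally show ?thesis .
qed

text \<open>The quotient f of the two sides is continuous on a connected set and takes values among
  the 24th roots of unity, hence is constant.\<close>

lemma dedekind_eta_moebius:
  assumes "a * d - b * c = (1::int)" "c > 0"
  obtains v where "v ^ 24 = 1"
    "\<And>\<tau>. Im \<tau> > 0 \<Longrightarrow> dedekind_eta ((of_int a * \<tau> + of_int b) / (of_int c * \<tau> + of_int d)) =
            v * csqrt (of_int c * \<tau> + of_int d) * dedekind_eta \<tau>"
proof -
  define f where "f = (\<lambda>\<tau>. dedekind_eta ((of_int a * \<tau> + of_int b) / (of_int c * \<tau> + of_int d)) /
                         (csqrt (of_int c * \<tau> + of_int d) * dedekind_eta \<tau>))"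
  define H where "H = {\<tau>. Im \<tau> > 0}"
  have nz: "of_int c * \<tau> + of_int d \<noteq> 0" if "\<tau> \<in> H" for \<tau>
    using moebius_denom_nonzero[OF assms(1)] that by (simp add: H_def)
  have im: "Im (of_int c * \<tau> + of_int d) > 0" if "\<tau> \<in> H" for \<tau>
    using that assms by (simp add: H_def)
  have f24: "f \<tau> ^ 24 = 1" if "\<tau> \<in> H" for \<tau>
  proof -
    have "csqrt (of_int c * \<tau> + of_int d) ^ 24 = (csqrt (of_int c * \<tau> + of_int d) ^ 2) ^ 12"
      using power_mult[of "csqrt (of_int c * \<tau> + of_int d)" 2 12] by (simp del: power2_csqrt)
    hence "csqrt (of_int c * \<tau> + of_int d) ^ 24 = (of_int c * \<tau> + of_int d) ^ 12"
      by (simp only: power2_csqrt)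
    thus ?thesis
      using dedekind_eta_power_24_moebius[OF assms(1), of \<tau>] nz[OF that] that dedekind_eta_nonzero[of \<tau>]
      by (simp add: f_def H_def power_divide power_mult_distrib)
  qed
  have cont_eta: "continuous_on H dedekind_eta"
    unfolding H_def by (rule holomorphic_on_imp_continuous_on[OF holomorphic_dedekind_eta])
  have cont_csqrt: "continuous_on {z. Im z > 0} csqrt"
    by (intro continuous_at_imp_continuous_on ballI continuous_at_csqrt) (auto simp: complex_nonpos_Reals_iff)
  have "continuous_on H f"
    unfolding f_def
  proof (intro continuous_intros continuous_on_compose2[OF cont_eta]
      continuous_on_compose2[OF cont_csqrt])
    show "(\<lambda>\<tau>. (of_int a * \<tau> + of_int b) / (of_int c * \<tau> + of_int d)) ` H \<subseteq> H"
      using Im_moebius_pos[OF assms(1)] by (auto simp: H_def)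
    show "(\<lambda>\<tau>. of_int c * \<tau> + of_int d) ` H \<subseteq> {z. 0 < Im z}"
      using im by blast
    show "\<forall>x\<in>H. csqrt (of_int c * x + of_int d) * dedekind_eta x \<noteq> 0"
      using nz dedekind_eta_nonzero by (auto simp: H_def)
  qed (use nz in auto)
  moreover have "finite (f ` H)"
  proof (rule finite_subset)
    show "f ` H \<subseteq> {z. z ^ 24 = 1}" using f24 by auto
    show "finite {z :: complex. z ^ 24 = 1}" by (rule finite_roots_unity) simp
  qed
  moreover have "connected H" unfolding H_def by (intro convex_connected convex_halfspace_Im_gt)
  ultimately have "f constant_on H" by (intro continuous_finite_range_constant)
  then obtain v where v: "f \<tau> = v" if "\<tau> \<in> H" for \<tau> unfolding constant_on_def by blast
  have "\<i> \<in> H" by (simp add: H_def)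
  hence "v ^ 24 = 1" using f24 v by metis
  moreover have "dedekind_eta ((of_int a * \<tau> + of_int b) / (of_int c * \<tau> + of_int d)) =
            v * csqrt (of_int c * \<tau> + of_int d) * dedekind_eta \<tau>" if "Im \<tau> > 0" for \<tau>
  proof -
    have "\<tau> \<in> H" using that by (simp add: H_def)
    from v[OF this] nz[OF this] dedekind_eta_nonzero[OF that] show ?thesis
      by (simp add: f_def divide_eq_eq mult.assoc)
  qed
  ultimately show ?thesis by (rule that)
qed

text \<open>Justifies the definite description of the multiplier: existence is
  \<open>dedekind_eta_moebius\<close>, and uniqueness follows at tau = i, where nothing in the
  equation vanishes.\<close>

lemma dedekind_eta_moebius_multiplier:
  fixes M :: "int ^ 2 ^ 2"
  assumes "M \<in> SL2Z" "M $ 2 $ 1 > 0" "Im \<tau> > 0"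
  shows "dedekind_eta (moebius M \<tau>) =
           eta_multiplier M * csqrt (of_int (M $ 2 $ 1) * \<tau> + of_int (M $ 2 $ 2)) * dedekind_eta \<tau>"
proof -
  define a b c d where "a = M $ 1 $ 1" and "b = M $ 1 $ 2" and "c = M $ 2 $ 1" and "d = M $ 2 $ 2"
  have det: "a * d - b * c = 1" using assms(1) by (simp add: SL2Z_def det_2 a_def b_def c_def d_def)
  have c: "c > 0" using assms(2) by (simp add: c_def)
  define P where "P = (\<lambda>v. v ^ 24 = 1 \<and>
    (\<forall>\<tau>\<in>upper_half_plane. dedekind_eta (moebius M \<tau>) =
       v * branch_sqrt (of_int (M $ 2 $ 1) * \<tau> + of_int (M $ 2 $ 2)) * dedekind_eta \<tau>))"
  have bs: "branch_sqrt (of_int (M $ 2 $ 1) * \<tau> + of_int (M $ 2 $ 2)) = csqrt (of_int c * \<tau> + of_int d)"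
    if "Im \<tau> > 0" for \<tau>
    unfolding c_def d_def by (rule branch_sqrt_eq_csqrt) (use that assms in simp)
  obtain v where v: "v ^ 24 = 1"
    "\<And>\<tau>. Im \<tau> > 0 \<Longrightarrow> dedekind_eta ((of_int a * \<tau> + of_int b) / (of_int c * \<tau> + of_int d)) =
            v * csqrt (of_int c * \<tau> + of_int d) * dedekind_eta \<tau>"
    using dedekind_eta_moebius[OF det c] by blast
  have moeb: "moebius M \<tau> = (of_int a * \<tau> + of_int b) / (of_int c * \<tau> + of_int d)" for \<tau>
    by (simp add: moebius_def a_def b_def c_def d_def)
  have "P v" using v by (auto simp: P_def upper_half_plane_def bs moeb)
  moreover have "w = v" if "P w" for w
  proof -
    have i: "\<i> \<in> upper_half_plane" by (simp add: upper_half_plane_def)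
    have "w * csqrt (of_int c * \<i> + of_int d) * dedekind_eta \<i> = v * csqrt (of_int c * \<i> + of_int d) * dedekind_eta \<i>"
      using \<open>P v\<close> \<open>P w\<close> i bs[of \<i>] unfolding P_def by (metis imaginary_unit.sel(2) zero_less_one)
    moreover have "csqrt (of_int c * \<i> + of_int d) \<noteq> 0" "dedekind_eta \<i> \<noteq> 0"
      using moebius_denom_nonzero[OF det, of \<i>] dedekind_eta_nonzero[of \<i>] by auto
    ultimately show ?thesis by simp
  qed
  ultimately have "P (THE v. P v)" by (rule theI)
  moreover have "eta_multiplier M = (THE v. P v)"
    unfolding eta_multiplier_def P_def by (rule refl)
  ultimately have "P (eta_multiplier M)" by simp
  thus ?thesis using assms(3) bs[OF assms(3)] by (simp add: P_def upper_half_plane_def c_def d_def)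
qed

section \<open>Poincare series of weight 2\<close>

text \<open>The generating function of p shifted by q^(-n), so that p(n) becomes its mean over a
  horizontal segment of length 1.\<close>

definition seed :: "nat \<Rightarrow> complex \<Rightarrow> complex"
  where "seed n z = q_power (- real n) z * inverse (euler_prod (q_power 1 z))"

lemma seed_add_int: "seed n (z + of_int k) = seed n z"
proof -
  have "q_power (- real n) (of_int k) = 1"
    using q_power_int_int[of "- int n" k] by simp
  hence "q_power (- real n) (z + of_int k) = q_power (- real n) z"
    by (simp only: q_power_add_right mult_1_right)
  thus ?thesis by (simp only: seed_def q_power_1_add_int)
qed

text \<open>Completing the Euler product to eta costs a factor q^(1/24); this is where n - 1 / 24
  originates.\<close>

lemma seed_eq_eta: "seed n z = q_power (- (real n - 1 / 24)) z * inverse (dedekind_eta z)"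
proof -
  have "q_power (- (real n - 1 / 24)) z = q_power (- real n) z * q_power (1 / 24) z"
    by (simp flip: q_power_add_left)
  thus ?thesis by (simp add: seed_def dedekind_eta_eq field_simps)
qed

lemma holomorphic_seed: "seed n holomorphic_on {z. Im z > 0}"
  unfolding seed_eq_eta [abs_def]
  by (intro holomorphic_intros holomorphic_dedekind_eta) (use dedekind_eta_nonzero in auto)

text \<open>Two completions of (c, d) to determinant 1 differ by a translation on the left, under
  which \<open>seed\<close> is invariant, so for coprime pairs the choice is immaterial.\<close>

definition poincare_term :: "nat \<Rightarrow> int \<times> int \<Rightarrow> complex \<Rightarrow> complex"
  where "poincare_term n = (\<lambda>(c, d) \<tau>. let (a, b) = (SOME (a, b). a * d - b * c = 1)
           in seed n ((of_int a * \<tau> + of_int b) / (of_int c * \<tau> + of_int d)) / (of_int c * \<tau> + of_int d) ^ 2)"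

lemma poincare_term_eq:
  assumes "a * d - b * c = 1" "Im \<tau> > 0"
  shows "poincare_term n (c, d) \<tau> =
           seed n ((of_int a * \<tau> + of_int b) / (of_int c * \<tau> + of_int d)) / (of_int c * \<tau> + of_int d) ^ 2"
proof -
  obtain a' b' where ab: "(SOME (a, b). a * d - b * c = 1) = (a', b')" by fastforce
  have "case (SOME (a, b). a * d - b * c = 1) of (a, b) \<Rightarrow> a * d - b * c = 1"
    by (rule someI[of _ "(a, b)"]) (use assms in simp)
  hence det': "a' * d - b' * c = 1" by (simp add: ab)
  \<comment> \<open>The translation length: the upper right entry of the product of one matrix with
    the inverse of the other, up to the order chosen.\<close>
  define k where "k = a * b' - b * a'"
  have "a' = a + k * c" "b' = b + k * d"
    using assms(1) det' unfolding k_def by algebra+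
  moreover have "of_int c * \<tau> + of_int d \<noteq> 0" by (rule moebius_denom_nonzero[OF assms])
  ultimately have "(of_int a' * \<tau> + of_int b') / (of_int c * \<tau> + of_int d) =
                     (of_int a * \<tau> + of_int b) / (of_int c * \<tau> + of_int d) + of_int k"
    by (simp add: field_simps)
  thus ?thesis by (simp add: poincare_term_def ab seed_add_int)
qed

definition coprime_pairs :: "(int \<times> int) set"
  where "coprime_pairs = {(c, d). coprime c d}"

lemma coprime_pairs_bezout:
  assumes "(c, d) \<in> coprime_pairs"
  obtains a b where "a * d - b * c = 1"
proof -
  obtain u v where "u * c + v * d = gcd c d" using bezout_int by blast
  hence "v * d - (- u) * c = 1" using assms by (simp add: coprime_pairs_def)
  thus ?thesis by (rule that)
qed

lemma coprime_pairsI: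
  assumes "a * d - b * c = 1"
  shows "(c, d) \<in> coprime_pairs"
proof -
  have "coprime c d"
  proof (rule coprimeI)
    fix e assume "e dvd c" "e dvd d"
    hence "e dvd a * d - b * c" by auto
    thus "is_unit e" using assms by simp
  qed
  thus ?thesis by (simp add: coprime_pairs_def)
qed

text \<open>The exponential comes from Im (M tau) = Im tau / |c tau + d|^2, and |eta (M tau)| adds 1
  / 2 to the exponent 2. Multiplying by |eta tau| postpones the question of a lower bound for
  eta.\<close>

lemma norm_poincare_term:
  assumes "(c, d) \<in> coprime_pairs" "Im \<tau> > 0"
  shows "norm (poincare_term n (c, d) \<tau>) * norm (dedekind_eta \<tau>) =
           exp (2 * pi * (real n - 1 / 24) * (Im \<tau> / norm (of_int c * \<tau> + of_int d) ^ 2)) *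
           norm (of_int c * \<tau> + of_int d) powr (- (5 / 2))"
proof -
  obtain a b where det: "a * d - b * c = 1" using coprime_pairs_bezout[OF assms(1)] by blast
  define w where "w = of_int c * \<tau> + of_int d"
  define z where "z = (of_int a * \<tau> + of_int b) / w"
  have w: "w \<noteq> 0" unfolding w_def by (rule moebius_denom_nonzero[OF det assms(2)])
  have eta: "dedekind_eta \<tau> \<noteq> 0" by (rule dedekind_eta_nonzero[OF assms(2)])
  have "norm (poincare_term n (c, d) \<tau>) = norm (q_power (- (real n - 1 / 24)) z) / norm (dedekind_eta z) / norm w ^ 2"
    unfolding poincare_term_eq[OF det assms(2)] seed_eq_eta w_def [symmetric] z_def [symmetric]
      divide_inverse [of "q_power _ _", symmetric]
    by (simp only: norm_divide norm_power)
  also have "norm (dedekind_eta z) = sqrt (norm w) * norm (dedekind_eta \<tau>)"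
    unfolding z_def w_def by (rule norm_dedekind_eta_moebius[OF det assms(2)])
  also have "norm (q_power (- (real n - 1 / 24)) z) = exp (2 * pi * (real n - 1 / 24) * (Im \<tau> / norm w ^ 2))"
  proof -
    have "exp (- 2 * pi * (- x) * y) = exp (2 * pi * x * y)" for x y by simp
    thus ?thesis by (simp only: norm_q_power z_def w_def Im_moebius[OF det assms(2)])
  qed
  finally have A: "norm (poincare_term n (c, d) \<tau>) =
      exp (2 * pi * (real n - 1 / 24) * (Im \<tau> / norm w ^ 2)) / (sqrt (norm w) * norm (dedekind_eta \<tau>)) / norm w ^ 2" .
  have "x / (s * e) / q * e = x * (1 / (s * q))" if "e \<noteq> 0" for x s e q :: real
    using that by simp
  hence "norm (poincare_term n (c, d) \<tau>) * norm (dedekind_eta \<tau>) =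
          exp (2 * pi * (real n - 1 / 24) * (Im \<tau> / norm w ^ 2)) * (1 / (sqrt (norm w) * norm w ^ 2))"
    using eta unfolding A by (simp only: norm_eq_zero not_False_eq_True)
  also have "1 / (sqrt (norm w) * norm w ^ 2) = norm w powr (- (5 / 2))"
  proof -
    have "norm w powr (5 / 2) = norm w powr (1 / 2 + 2)" by simp
    also have "\<dots> = sqrt (norm w) * norm w ^ 2"
      unfolding powr_add using w by (simp add: powr_half_sqrt)
    finally show ?thesis by (simp only: powr_minus inverse_eq_divide)
  qed
  finally show ?thesis by (simp only: w_def)
qed

lemma norm_poincare_term_le:
  assumes "0 < y" "R > 0" "n > 0"
  obtains C where "C > 0" "\<And>\<tau> p. y \<le> Im \<tau> \<Longrightarrow> norm \<tau> \<le> R \<Longrightarrow> p \<in> coprime_pairs \<Longrightarrow>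
    norm (poincare_term n p \<tau>) * norm (dedekind_eta \<tau>) \<le> C * lattice_weight p"
proof -
  define K where "K = 1 / y ^ 2 + (1 + R / y) ^ 2"
  define C where "C = exp (2 * pi * (real n - 1 / 24) * (R * K)) * K powr (5 / 2 / 2)"
  have K: "K > 0" unfolding K_def using assms by (intro add_pos_nonneg) auto
  have "norm (poincare_term n p \<tau>) * norm (dedekind_eta \<tau>) \<le> C * lattice_weight p"
    if \<tau>: "y \<le> Im \<tau>" "norm \<tau> \<le> R" and p: "p \<in> coprime_pairs" for \<tau> p
  proof -
    obtain c d where p_eq: "p = (c, d)" by (cases p)
    have nz: "(c, d) \<noteq> (0, 0)" using p p_eq by (auto simp: coprime_pairs_def)
    define N where "N = norm (of_int c * \<tau> + of_int d)"
    have "1 * 1 \<le> max 1 \<bar>of_int c\<bar> * max 1 \<bar>of_int d :: real\<bar>" by (intro mult_mono) auto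
    also have "\<dots> \<le> of_int c ^ 2 + of_int d ^ 2" by (rule max_mult_le_sum_squares[OF nz])
    also have "\<dots> \<le> K * N ^ 2"
      using lattice_bound[OF assms(1) \<tau>, of "of_int c" "of_int d"] by (simp add: K_def N_def)
    \<comment> \<open>Keeps N away from 0 uniformly over all pairs, so Im tau / N^2 <= R K and the
      exponential factor is bounded.\<close>
    finally have KN: "1 \<le> K * N ^ 2" by simp
    hence N: "N > 0" by (cases "N = 0") (auto simp: N_def)
    have "Im \<tau> / N ^ 2 \<le> R * K"
    proof -
      have "Im \<tau> \<le> R" using \<tau> abs_Im_le_cmod[of \<tau>] by simp
      hence "Im \<tau> * 1 \<le> R * (K * N ^ 2)" using KN assms \<tau> by (intro mult_mono) auto
      thus ?thesis using N by (simp add: field_simps)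
    qed
    hence "exp (2 * pi * (real n - 1 / 24) * (Im \<tau> / N ^ 2)) \<le> exp (2 * pi * (real n - 1 / 24) * (R * K))"
      using assms by (intro exp_le_cancel_iff[THEN iffD2] mult_left_mono) auto
    moreover have "N powr (- (5 / 2)) \<le> K powr (5 / 2 / 2) * lattice_weight (c, d)"
      unfolding N_def K_def by (rule norm_lattice_powr_le[OF assms(1) \<tau> nz]) simp
    ultimately have "exp (2 * pi * (real n - 1 / 24) * (Im \<tau> / N ^ 2)) * N powr (- (5 / 2)) \<le>
        exp (2 * pi * (real n - 1 / 24) * (R * K)) * (K powr (5 / 2 / 2) * lattice_weight (c, d))"
      by (intro mult_mono) auto
    moreover have "Im \<tau> > 0" using \<tau> assms by simp
    ultimately show ?thesis
      using norm_poincare_term[of c d \<tau> n] p unfolding p_eq by (simp add: N_def C_def mult_ac)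
  qed
  moreover have "C > 0" using K by (simp add: C_def)
  ultimately show ?thesis using that by blast
qed

lemma holomorphic_poincare_term:
  assumes "p \<in> coprime_pairs"
  shows "poincare_term n p holomorphic_on {\<tau>. Im \<tau> > 0}"
proof -
  obtain c d where p: "p = (c, d)" by (cases p)
  obtain a b where det: "a * d - b * c = 1" using coprime_pairs_bezout assms p by blast
  have "(\<lambda>\<tau>. seed n ((of_int a * \<tau> + of_int b) / (of_int c * \<tau> + of_int d)) / (of_int c * \<tau> + of_int d) ^ 2)
          holomorphic_on {\<tau>. Im \<tau> > 0}"
  proof (intro holomorphic_intros)
    have "(seed n \<circ> (\<lambda>\<tau>. (of_int a * \<tau> + of_int b) / (of_int c * \<tau> + of_int d))) holomorphic_on {\<tau>. Im \<tau> > 0}"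
      by (rule holomorphic_on_compose_gen[OF _ holomorphic_seed])
         (use moebius_denom_nonzero[OF det] Im_moebius_pos[OF det] in \<open>auto intro!: holomorphic_intros\<close>)
    thus "(\<lambda>\<tau>. seed n ((of_int a * \<tau> + of_int b) / (of_int c * \<tau> + of_int d))) holomorphic_on {\<tau>. Im \<tau> > 0}"
      by (simp add: o_def)
  qed (use moebius_denom_nonzero[OF det] in auto)
  thus ?thesis
    unfolding p by (rule holomorphic_transform) (use poincare_term_eq[OF det] in auto)
qed

section \<open>Convergence and modularity of the series\<close>

definition poincare_series :: "nat \<Rightarrow> complex \<Rightarrow> complex"
  where "poincare_series n \<tau> = (\<Sum>\<^sub>\<infinity>p\<in>coprime_pairs. poincare_term n p \<tau>)"

lemma poincare_term_bound_on_compact: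
  assumes "compact A" "A \<subseteq> {\<tau>. Im \<tau> > 0}" "n > 0"
  shows "\<exists>C. \<forall>\<tau>\<in>A. \<forall>p\<in>coprime_pairs. norm (poincare_term n p \<tau>) \<le> C * lattice_weight p"
proof (cases "A = {}")
  case False
  have "continuous_on A Im" by (intro continuous_intros)
  then obtain \<tau>0 where \<tau>0: "\<tau>0 \<in> A" "\<And>\<tau>. \<tau> \<in> A \<Longrightarrow> Im \<tau>0 \<le> Im \<tau>"
    using continuous_attains_inf[OF assms(1) False] by blast
  have y: "Im \<tau>0 > 0" using \<tau>0(1) assms by auto
  obtain R where R: "R > 0" "\<And>\<tau>. \<tau> \<in> A \<Longrightarrow> norm \<tau> \<le> R"
    using compact_imp_bounded[OF assms(1)] by (auto simp: bounded_pos)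
  obtain C where C: "C > 0" "\<And>\<tau> p. Im \<tau>0 \<le> Im \<tau> \<Longrightarrow> norm \<tau> \<le> R \<Longrightarrow> p \<in> coprime_pairs \<Longrightarrow>
    norm (poincare_term n p \<tau>) * norm (dedekind_eta \<tau>) \<le> C * lattice_weight p"
    using norm_poincare_term_le[OF y R(1) assms(3)] by blast
  have "continuous_on A (\<lambda>\<tau>. norm (dedekind_eta \<tau>))"
    by (intro continuous_intros continuous_on_subset[OF _ assms(2)]
        holomorphic_on_imp_continuous_on[OF holomorphic_dedekind_eta])
  then obtain \<tau>1 where \<tau>1: "\<tau>1 \<in> A" "\<And>\<tau>. \<tau> \<in> A \<Longrightarrow> norm (dedekind_eta \<tau>1) \<le> norm (dedekind_eta \<tau>)"
    using continuous_attains_inf[OF assms(1) False] by blast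
  define e where "e = norm (dedekind_eta \<tau>1)"
  have e: "e > 0" using dedekind_eta_nonzero[of \<tau>1] \<tau>1(1) assms(2) by (auto simp: e_def)
  have "norm (poincare_term n p \<tau>) \<le> C / e * lattice_weight p" if "\<tau> \<in> A" "p \<in> coprime_pairs" for \<tau> p
  proof -
    have "norm (poincare_term n p \<tau>) * e \<le> norm (poincare_term n p \<tau>) * norm (dedekind_eta \<tau>)"
      using \<tau>1(2)[OF that(1)] by (intro mult_left_mono) (auto simp: e_def)
    also have "\<dots> \<le> C * lattice_weight p" using that \<tau>0 R by (intro C) auto
    finally show ?thesis using e by (simp add: field_simps)
  qed
  thus ?thesis by blast
qed auto

lemma has_sum_poincare_series:
  assumes "Im \<tau> > 0" "n > 0"
  shows "((\<lambda>p. poincare_term n p \<tau>) has_sum poincare_series n \<tau>) coprime_pairs"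
proof -
  obtain C where "\<forall>\<tau>'\<in>{\<tau>}. \<forall>p\<in>coprime_pairs. norm (poincare_term n p \<tau>') \<le> C * lattice_weight p"
    using poincare_term_bound_on_compact[of "{\<tau>}" n] assms by auto
  hence "(\<lambda>p. norm (poincare_term n p \<tau>)) summable_on coprime_pairs"
    by (intro summable_on_comparison_test[OF summable_on_cmult_right[OF summable_lattice_weight]]) auto
  thus ?thesis unfolding poincare_series_def by (rule has_sum_infsum[OF abs_summable_summable])
qed

lemma holomorphic_poincare_series:
  assumes "n > 0"
  shows "poincare_series n holomorphic_on {\<tau>. Im \<tau> > 0}"
proof (rule holomorphic_onI)
  fix \<tau> assume "\<tau> \<in> {\<tau>. Im \<tau> > 0}"
  hence \<tau>: "Im \<tau> > 0" by simp
  define r where "r = Im \<tau> / 2"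
  have r: "r > 0" using \<tau> by (simp add: r_def)
  have sub: "cball \<tau> r \<subseteq> {\<tau>. Im \<tau> > 0}"
  proof
    fix z assume "z \<in> cball \<tau> r"
    hence "\<bar>Im (\<tau> - z)\<bar> \<le> r" using abs_Im_le_cmod[of "\<tau> - z"] by (simp add: dist_norm)
    hence "Im \<tau> - Im z \<le> r" by simp
    thus "z \<in> {\<tau>. Im \<tau> > 0}" using \<tau> by (simp add: r_def)
  qed
  obtain C where C: "\<forall>z\<in>cball \<tau> r. \<forall>p\<in>coprime_pairs. norm (poincare_term n p z) \<le> C * lattice_weight p"
    using poincare_term_bound_on_compact[OF _ sub assms] by auto
  have ulim: "uniform_limit (cball \<tau> r) (\<lambda>X z. \<Sum>p\<in>X. poincare_term n p z) (poincare_series n)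
           (finite_subsets_at_top coprime_pairs)"
    unfolding poincare_series_def [abs_def]
    by (rule Weierstrass_m_test_general[where M = "\<lambda>p. C * lattice_weight p"])
       (use C in \<open>auto intro: summable_on_cmult_right summable_lattice_weight\<close>)
  have "poincare_series n holomorphic_on ball \<tau> r"
  proof (rule holomorphic_uniform_limit[OF _ ulim])
    have "(\<lambda>z. \<Sum>p\<in>X. poincare_term n p z) holomorphic_on {\<tau>. Im \<tau> > 0}" if "X \<subseteq> coprime_pairs" for X
      using that by (intro holomorphic_intros holomorphic_poincare_term) auto
    thus "\<forall>\<^sub>F X in finite_subsets_at_top coprime_pairs.
            continuous_on (cball \<tau> r) (\<lambda>z. \<Sum>p\<in>X. poincare_term n p z) \<and>
            (\<lambda>z. \<Sum>p\<in>X. poincare_term n p z) holomorphic_on ball \<tau> r"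
      using sub by (intro eventually_finite_subsets_at_top_weakI conjI holomorphic_on_imp_continuous_on)
        (meson ball_subset_cball holomorphic_on_subset order_trans)+
  qed auto
  hence "poincare_series n field_differentiable at \<tau>"
    using r by (auto intro: holomorphic_on_imp_differentiable_at)
  thus "poincare_series n field_differentiable at \<tau> within {\<tau>. Im \<tau> > 0}"
    by (rule field_differentiable_at_within)
qed

lemma poincare_term_add_int:
  assumes "(c, d) \<in> coprime_pairs" "Im \<tau> > 0"
  shows "poincare_term n (c, d) (\<tau> + of_int k) = poincare_term n (c, c * k + d) \<tau>"
proof -
  obtain a b where det: "a * d - b * c = 1" using coprime_pairs_bezout[OF assms(1)] by blast
  have "a * (c * k + d) - (a * k + b) * c = 1" using det by (simp add: algebra_simps)
  from poincare_term_eq[OF this assms(2)] poincare_term_eq[OF det, of "\<tau> + of_int k"] assms(2)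
  show ?thesis by (simp add: algebra_simps)
qed

lemma poincare_term_S:
  assumes "(c, d) \<in> coprime_pairs" "Im \<tau> > 0"
  shows "poincare_term n (c, d) (- 1 / \<tau>) = \<tau> ^ 2 * poincare_term n (d, - c) \<tau>"
proof -
  obtain a b where det: "a * d - b * c = 1" using coprime_pairs_bezout[OF assms(1)] by blast
  hence det': "b * (- c) - (- a) * d = 1" by (simp add: algebra_simps)
  have \<tau>: "\<tau> \<noteq> 0" using assms by auto
  have num: "of_int a * (- 1 / \<tau>) + of_int b = (of_int b * \<tau> + of_int (- a)) / \<tau>"
    and den: "of_int c * (- 1 / \<tau>) + of_int d = (of_int d * \<tau> + of_int (- c)) / \<tau>"
    using \<tau> by (simp_all add: field_simps)
  show ?thesis
    unfolding poincare_term_eq[OF det Im_minus_inverse_pos[OF assms(2)]] poincare_term_eq[OF det' assms(2)] num den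
    using \<tau> by (simp add: power_divide)
qed

lemma poincare_term_uminus:
  assumes "(c, d) \<in> coprime_pairs" "Im \<tau> > 0"
  shows "poincare_term n (- c, - d) \<tau> = poincare_term n (c, d) \<tau>"
proof -
  obtain a b where det: "a * d - b * c = 1" using coprime_pairs_bezout[OF assms(1)] by blast
  hence det': "(- a) * (- d) - (- b) * (- c) = 1" by (simp add: algebra_simps)
  have num: "of_int (- a) * \<tau> + of_int (- b) = - (of_int a * \<tau> + of_int b)"
    and den: "of_int (- c) * \<tau> + of_int (- d) = - (of_int c * \<tau> + of_int d)"
    by simp_all
  show ?thesis
    unfolding poincare_term_eq[OF det assms(2)] poincare_term_eq[OF det' assms(2)] num den
    by (simp only: minus_divide_divide power2_minus)
qed

text \<open>Translation and inversion of tau multiply each matrix on the right and thereby permute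
  the coprime lower rows; the sum is unordered, so it can be reindexed.\<close>

lemma poincare_series_add_1:
  assumes "Im \<tau> > 0"
  shows "poincare_series n (\<tau> + 1) = poincare_series n \<tau>"
proof -
  have "bij_betw (\<lambda>(c, d). (c, c + d)) coprime_pairs coprime_pairs"
  proof (rule bij_betwI[where g = "\<lambda>(c, d). (c, d - c)"])
    have iff: "coprime c (c + d) \<longleftrightarrow> coprime c d" for c d :: int
      by (simp add: coprime_iff_gcd_eq_1)
    hence "coprime c (d - c) \<longleftrightarrow> coprime c d" for c d :: int
      using iff[of c "d - c"] by simp
    thus "(\<lambda>(c, d). (c, c + d)) \<in> coprime_pairs \<rightarrow> coprime_pairs"
      "(\<lambda>(c, d). (c, d - c)) \<in> coprime_pairs \<rightarrow> coprime_pairs"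
      by (auto simp: coprime_pairs_def iff)
  qed auto
  from infsum_reindex_bij_betw[OF this, of "\<lambda>p. poincare_term n p \<tau>"]
  have "poincare_series n \<tau> = (\<Sum>\<^sub>\<infinity>p\<in>coprime_pairs. poincare_term n (case p of (c, d) \<Rightarrow> (c, c + d)) \<tau>)"
    by (simp add: poincare_series_def)
  also have "\<dots> = poincare_series n (\<tau> + 1)"
    unfolding poincare_series_def
  proof (intro infsum_cong)
    fix p assume "p \<in> coprime_pairs"
    thus "poincare_term n (case p of (c, d) \<Rightarrow> (c, c + d)) \<tau> = poincare_term n p (\<tau> + 1)"
      using poincare_term_add_int[of "fst p" "snd p" \<tau> n 1] assms by (cases p) simp
  qed
  finally show ?thesis ..
qed

lemma poincare_series_S:
  assumes "Im \<tau> > 0"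
  shows "poincare_series n (- 1 / \<tau>) = \<tau> ^ 2 * poincare_series n \<tau>"
proof -
  have "bij_betw (\<lambda>(c, d). (d, - c)) coprime_pairs coprime_pairs"
    by (rule bij_betwI[where g = "\<lambda>(c, d). (- d, c)"])
       (auto simp: coprime_pairs_def coprime_commute)
  from infsum_reindex_bij_betw[OF this, of "\<lambda>p. poincare_term n p \<tau>"]
  have "\<tau> ^ 2 * poincare_series n \<tau> = \<tau> ^ 2 * (\<Sum>\<^sub>\<infinity>p\<in>coprime_pairs. poincare_term n (case p of (c, d) \<Rightarrow> (d, - c)) \<tau>)"
    by (simp add: poincare_series_def)
  also have "\<dots> = (\<Sum>\<^sub>\<infinity>p\<in>coprime_pairs. \<tau> ^ 2 * poincare_term n (case p of (c, d) \<Rightarrow> (d, - c)) \<tau>)"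
    by (rule infsum_cmult_right' [symmetric])
  also have "\<dots> = poincare_series n (- 1 / \<tau>)"
    unfolding poincare_series_def
  proof (intro infsum_cong)
    fix p assume "p \<in> coprime_pairs"
    thus "\<tau> ^ 2 * poincare_term n (case p of (c, d) \<Rightarrow> (d, - c)) \<tau> = poincare_term n p (- 1 / \<tau>)"
      using poincare_term_S[of "fst p" "snd p" \<tau> n] assms by (cases p) simp
  qed
  finally show ?thesis ..
qed

text \<open>
  The periods of a primitive define a homomorphism from the modular group to the complex numbers.
  It kills the elliptic generators, which fix \<open>\<i>\<close> and \<open>exp (\<i> * pi / 3)\<close>, so it is trivial.
\<close>
lemma weight_2_horizontal_integral:
  assumes hol: "f holomorphic_on {\<tau>. Im \<tau> > 0}"
    and T: "\<And>\<tau>. Im \<tau> > 0 \<Longrightarrow> f (\<tau> + 1) = f \<tau>"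
    and S: "\<And>\<tau>. Im \<tau> > 0 \<Longrightarrow> f (- 1 / \<tau>) = \<tau> ^ 2 * f \<tau>"
    and y: "y > 0"
  shows "((\<lambda>x. f (Complex x y)) has_integral 0) {0..1}"
proof -
  define H where "H = {\<tau>. Im \<tau> > 0}"
  have op: "open H" unfolding H_def by (rule open_halfspace_Im_gt)
  have cvx: "convex H" unfolding H_def by (rule convex_halfspace_Im_gt)
  have conn: "connected H" by (rule convex_connected[OF cvx])
  obtain \<Phi> where "\<And>z. z \<in> H \<Longrightarrow> (\<Phi> has_field_derivative f z) (at z within H)"
    using holomorphic_convex_primitive'[OF cvx op] hol by (auto simp: H_def)
  hence \<Phi>: "(\<Phi> has_field_derivative f z) (at z)" if "z \<in> H" for z
    using that op by (metis at_within_open)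
  have const: "g z = g w" if "\<And>z. z \<in> H \<Longrightarrow> (g has_field_derivative 0) (at z)" "z \<in> H" "w \<in> H" for g z w
    using has_field_derivative_0_imp_constant_on[OF that(1) conn op] that(2,3) unfolding constant_on_def by metis
  have dT: "((\<lambda>z. \<Phi> (z + 1) - \<Phi> z) has_field_derivative 0) (at z)" if "z \<in> H" for z
  proof -
    have "((\<lambda>z. \<Phi> (z + 1) - \<Phi> z) has_field_derivative (f (z + 1) * 1 - f z)) (at z)"
      by (intro DERIV_diff DERIV_chain2[OF \<Phi>] \<Phi>) (use that in \<open>auto simp: H_def intro!: derivative_eq_intros\<close>)
    thus ?thesis using T[of z] that by (simp add: H_def)
  qed
  have dS: "((\<lambda>z. \<Phi> (- 1 / z) - \<Phi> z) has_field_derivative 0) (at z)" if "z \<in> H" for z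
  proof -
    have z0: "z \<noteq> 0" using that by (auto simp: H_def)
    have im: "- 1 / z \<in> H" using Im_minus_inverse_pos that by (simp add: H_def)
    have "((\<lambda>w. - 1 / w) has_field_derivative 1 / z ^ 2) (at z)"
      using z0 by (auto intro!: derivative_eq_intros simp: power2_eq_square)
    hence "((\<lambda>z. \<Phi> (- 1 / z)) has_field_derivative f (- 1 / z) * (1 / z ^ 2)) (at z)"
      by (rule DERIV_chain2[where f = \<Phi> and g = "\<lambda>w. - 1 / w", OF \<Phi>[OF im]])
    hence "((\<lambda>z. \<Phi> (- 1 / z) - \<Phi> z) has_field_derivative (f (- 1 / z) * (1 / z ^ 2) - f z)) (at z)"
      by (intro DERIV_diff \<Phi> that)
    thus ?thesis using S[of z] that z0 by (simp add: H_def)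
  qed
  have "\<i> \<in> H" by (simp add: H_def)
  \<comment> \<open>The constant difference is evaluated at the fixed point i, where it is
    0.\<close>
  hence S0: "\<Phi> (- 1 / z) = \<Phi> z" if "z \<in> H" for z
    using const[OF dS that, of \<i>] by simp
  \<comment> \<open>This is exp(i pi / 3), for which - 1 / rho = rho - 1: invariance under inversion
    forces the period of the translation to vanish at rho - 1, hence everywhere.\<close>
  define \<rho> where "\<rho> = Complex (1 / 2) (sqrt 3 / 2)"
  have \<rho>: "\<rho> \<in> H" "\<rho> - 1 \<in> H" by (simp_all add: H_def \<rho>_def)
  have prod: "(\<rho> - 1) * \<rho> = - 1"
    by (simp add: \<rho>_def complex_eq_iff)
  have "\<rho> \<noteq> 0" using \<rho>(1) by (auto simp: H_def)
  hence "- 1 / \<rho> = \<rho> - 1" unfolding prod [symmetric] by simp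
  hence \<Phi>\<rho>: "\<Phi> (\<rho> - 1) = \<Phi> \<rho>" using S0[OF \<rho>(1)] by simp
  have "Complex 0 y \<in> H" using y by (simp add: H_def)
  hence "\<Phi> (Complex 0 y + 1) - \<Phi> (Complex 0 y) = \<Phi> (\<rho> - 1 + 1) - \<Phi> (\<rho> - 1)"
    by (intro const[where g = "\<lambda>z. \<Phi> (z + 1) - \<Phi> z"] dT \<rho>)
  moreover have "Complex 0 y + 1 = Complex 1 y" by (simp add: complex_eq_iff)
  ultimately have "\<Phi> (Complex 1 y) - \<Phi> (Complex 0 y) = 0" by (simp add: \<Phi>\<rho>)
  moreover have "((\<lambda>x. f (Complex x y)) has_integral (\<Phi> (Complex 1 y) - \<Phi> (Complex 0 y))) {0..1}"
  proof (rule fundamental_theorem_of_calculus)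
    fix x :: real
    have "((\<lambda>x. Complex x y) has_vector_derivative 1) (at x within {0..1})"
      unfolding Complex_eq by (auto intro!: derivative_eq_intros)
    moreover have "(\<Phi> has_field_derivative f (Complex x y)) (at (Complex x y) within (\<lambda>x. Complex x y) ` {0..1})"
      using \<Phi>[of "Complex x y"] y by (simp add: H_def has_field_derivative_at_within)
    ultimately show "((\<lambda>x. \<Phi> (Complex x y)) has_vector_derivative f (Complex x y)) (at x within {0..1})"
      using field_vector_diff_chain_within[of "\<lambda>x. Complex x y" 1 x "{0..1}" \<Phi> "f (Complex x y)"]
      by (simp add: o_def)
  qed simp
  ultimately show ?thesis by simp
qed

section \<open>Integrals along vertical lines and the Bessel integral\<close>

lemma integrable_inverse_one_plus_square: "integrable lborel (\<lambda>t::real. inverse (1 + t ^ 2))"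
  using integrable_inverse_1_plus_square by (simp add: set_integrable_def einterval_def)

lemma continuous_on_vertical_line [continuous_intros]:
  "continuous_on A (\<lambda>t. Complex y t)"
  unfolding Complex_eq by (intro continuous_intros)

lemma integrable_vertical_line:
  fixes f :: "complex \<Rightarrow> complex"
  assumes "y > 0" "continuous_on {s. Re s = y} f" "\<And>s. Re s = y \<Longrightarrow> norm (f s) \<le> B / norm s ^ 2"
  shows "integrable lborel (\<lambda>t. f (Complex y t))"
proof (rule Bochner_Integration.integrable_bound)
  show "integrable lborel (\<lambda>t::real. (\<bar>B\<bar> * (1 + 1 / y ^ 2)) * inverse (1 + t ^ 2))"
    by (intro integrable_mult_right integrable_inverse_one_plus_square)
  have "continuous_on UNIV (\<lambda>t. f (Complex y t))"
    by (rule continuous_on_compose2[OF assms(2)]) (auto intro: continuous_intros)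
  thus "(\<lambda>t. f (Complex y t)) \<in> borel_measurable lborel"
    by (simp add: borel_measurable_continuous_onI)
  show "AE t in lborel. norm (f (Complex y t)) \<le> norm ((\<bar>B\<bar> * (1 + 1 / y ^ 2)) * inverse (1 + t ^ 2))"
  proof (rule AE_I2)
    fix t :: real
    have "norm (Complex y t) ^ 2 = y ^ 2 + t ^ 2" by (simp add: cmod_power2)
    hence "norm (f (Complex y t)) \<le> B / (y ^ 2 + t ^ 2)"
      using assms(3)[of "Complex y t"] by simp
    also have "\<dots> \<le> \<bar>B\<bar> * inverse (y ^ 2 + t ^ 2)"
      by (simp add: divide_inverse mult_right_mono)
    also have "inverse (y ^ 2 + t ^ 2) \<le> (1 + 1 / y ^ 2) * inverse (1 + t ^ 2)"
    proof -
      have "0 < y ^ 2 + t ^ 2" using assms(1) by (intro add_pos_nonneg) auto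
      moreover have "0 < 1 + t ^ 2" by (intro add_pos_nonneg) auto
      moreover have "1 + t ^ 2 \<le> (1 + 1 / y ^ 2) * (y ^ 2 + t ^ 2)"
        using assms(1) by (simp add: algebra_simps)
      ultimately show ?thesis by (simp add: field_simps)
    qed
    finally show "norm (f (Complex y t)) \<le> norm ((\<bar>B\<bar> * (1 + 1 / y ^ 2)) * inverse (1 + t ^ 2))"
      by (simp add: mult_left_mono mult.assoc abs_mult)
  qed
qed

lemma LIMSEQ_integral_symmetric:
  fixes f :: "real \<Rightarrow> complex"
  assumes "integrable lborel f"
  shows "(\<lambda>N. integral {- real N..real N} f) \<longlonglongrightarrow> (LINT t|lborel. f t)"
proof -
  have "(\<lambda>N. LINT t|lborel. indicator {- real N..real N} t *\<^sub>R f t) \<longlonglongrightarrow> (LINT t|lborel. f t)"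
  proof (rule integral_dominated_convergence)
    show "integrable lborel (\<lambda>t. norm (f t))" using assms by simp
    show "AE t in lborel. (\<lambda>N. indicator {- real N..real N} t *\<^sub>R f t) \<longlonglongrightarrow> f t"
    proof (rule AE_I2)
      fix t :: real
      obtain M where M: "\<bar>t\<bar> \<le> real M" using real_arch_simple by blast
      have "\<forall>\<^sub>F N in sequentially. f t = indicator {- real N..real N} t *\<^sub>R f t"
        using eventually_ge_at_top[of M]
      proof eventually_elim
        case (elim N)
        have "\<bar>t\<bar> \<le> real N" using M elim by linarith
        thus ?case by (simp add: abs_le_iff)
      qed
      thus "(\<lambda>N. indicator {- real N..real N} t *\<^sub>R f t) \<longlonglongrightarrow> f t"
        by (rule Lim_transform_eventually[OF tendsto_const])
    qed
    show "f \<in> borel_measurable lborel" using assms by auto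
    show "(\<lambda>t. indicator {- real N..real N} t *\<^sub>R f t) \<in> borel_measurable lborel" for N
      using assms by measurable
    show "AE t in lborel. norm (indicator {- real N..real N} t *\<^sub>R f t) \<le> norm (f t)" for N
      by (intro AE_I2) (simp add: indicator_def)
  qed
  moreover have "(LINT t|lborel. indicator {- real N..real N} t *\<^sub>R f t) = integral {- real N..real N} f" for N
  proof -
    have "set_integrable lborel {- real N..real N} f"
      unfolding set_integrable_def using assms by (intro integrable_mult_indicator) auto
    from set_borel_integral_eq_integral(2)[OF this] show ?thesis
      by (simp add: set_lebesgue_integral_def)
  qed
  ultimately show ?thesis by simp
qed

text \<open>Only the left edge is rewritten as an integral over a real interval; the other three are
  kept, since they play different roles in the two applications.\<close>

lemma contour_integral_rectpath:
  assumes "a \<le> b" "c < d" "continuous_on (path_image (rectpath (Complex a c) (Complex b d))) f"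
  shows "contour_integral (rectpath (Complex a c) (Complex b d)) f =
           contour_integral (linepath (Complex a c) (Complex b c)) f +
           contour_integral (linepath (Complex b c) (Complex b d)) f +
           contour_integral (linepath (Complex b d) (Complex a d)) f -
           \<i> * integral {c..d} (\<lambda>t. f (Complex a t))"
    and "closed_segment (Complex a c) (Complex b c) \<subseteq> path_image (rectpath (Complex a c) (Complex b d))"
    and "closed_segment (Complex b c) (Complex b d) \<subseteq> path_image (rectpath (Complex a c) (Complex b d))"
    and "closed_segment (Complex b d) (Complex a d) \<subseteq> path_image (rectpath (Complex a c) (Complex b d))"
proof -
  have img: "path_image (rectpath (Complex a c) (Complex b d)) =
          closed_segment (Complex a c) (Complex b c) \<union> closed_segment (Complex b c) (Complex b d) \<union>
          closed_segment (Complex b d) (Complex a d) \<union> closed_segment (Complex a d) (Complex a c)"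
    by (simp add: rectpath_def Let_def path_image_join Un_assoc)
  show sub: "closed_segment (Complex a c) (Complex b c) \<subseteq> path_image (rectpath (Complex a c) (Complex b d))"
    "closed_segment (Complex b c) (Complex b d) \<subseteq> path_image (rectpath (Complex a c) (Complex b d))"
    "closed_segment (Complex b d) (Complex a d) \<subseteq> path_image (rectpath (Complex a c) (Complex b d))"
    unfolding img by auto
  have "f contour_integrable_on linepath (Complex a c) (Complex b c)"
       "f contour_integrable_on linepath (Complex b c) (Complex b d)"
       "f contour_integrable_on linepath (Complex b d) (Complex a d)"
       and int4: "f contour_integrable_on linepath (Complex a d) (Complex a c)"
    by (rule contour_integrable_continuous_linepath, rule continuous_on_subset[OF assms(3)],
        use img in auto)+
  hence "contour_integral (rectpath (Complex a c) (Complex b d)) f =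
           contour_integral (linepath (Complex a c) (Complex b c)) f +
           contour_integral (linepath (Complex b c) (Complex b d)) f +
           contour_integral (linepath (Complex b d) (Complex a d)) f +
           contour_integral (linepath (Complex a d) (Complex a c)) f"
    by (simp add: rectpath_def Let_def)
  also have "contour_integral (linepath (Complex a d) (Complex a c)) f =
           - contour_integral (linepath (Complex a c) (Complex a d)) f"
    using contour_integral_reversepath[of "linepath (Complex a c) (Complex a d)" f] by simp
  also have "contour_integral (linepath (Complex a c) (Complex a d)) f =
           \<i> * integral {c..d} (\<lambda>t. f (Complex a t))"
    by (rule contour_integral_linepath_same_Re) (use assms in auto)
  finally show "contour_integral (rectpath (Complex a c) (Complex b d)) f =
           contour_integral (linepath (Complex a c) (Complex b c)) f +
           contour_integral (linepath (Complex b c) (Complex b d)) f +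
           contour_integral (linepath (Complex b d) (Complex a d)) f -
           \<i> * integral {c..d} (\<lambda>t. f (Complex a t))" by simp
qed

text \<open>Length O(N) against an integrand O(1 / N^2). The length is allowed to grow because the
  rectangle for the Cauchy integral expands to the right as well.\<close>

lemma norm_contour_integral_linepath_tendsto_0:
  assumes "\<And>N. N > 0 \<Longrightarrow> continuous_on (closed_segment (u N) (v N)) f"
    and "\<And>N s. N > 0 \<Longrightarrow> s \<in> closed_segment (u N) (v N) \<Longrightarrow> norm (f s) \<le> C / real N ^ 2"
    and "\<And>N. N > 0 \<Longrightarrow> norm (v N - u N) \<le> D * real N"
    and "C \<ge> 0"
  shows "(\<lambda>N. contour_integral (linepath (u N) (v N)) f) \<longlonglongrightarrow> 0"
proof (rule Lim_null_comparison)
  show "\<forall>\<^sub>F N in sequentially. norm (contour_integral (linepath (u N) (v N)) f) \<le> C * D * (1 / real N)"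
    using eventually_gt_at_top[of 0]
  proof eventually_elim
    case (elim N)
    have "norm (contour_integral (linepath (u N) (v N)) f) \<le> C / real N ^ 2 * norm (v N - u N)"
      using elim assms by (intro contour_integral_bound_linepath contour_integrable_continuous_linepath) auto
    also have "\<dots> \<le> C / real N ^ 2 * (D * real N)"
      using elim assms by (intro mult_left_mono) auto
    also have "\<dots> = C * D * (1 / real N)" using elim by (simp add: field_simps power2_eq_square)
    finally show ?case .
  qed
  show "(\<lambda>N. C * D * (1 / real N)) \<longlonglongrightarrow> 0" by real_asymp
qed

lemma closed_segment_same_Im_bounds:
  assumes "s \<in> closed_segment (Complex a c) (Complex b c)" "a \<le> b"
  shows "a \<le> Re s" "Re s \<le> b" "Im s = c"
proof -
  have "Re s \<in> closed_segment a b" "Im s \<in> closed_segment c c"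
    using assms(1) in_closed_segment_imp_Re_in_closed_segment[of s "Complex a c" "Complex b c"]
      in_closed_segment_imp_Im_in_closed_segment[of s "Complex a c" "Complex b c"] by auto
  thus "a \<le> Re s" "Re s \<le> b" "Im s = c" using assms(2) by (auto simp: closed_segment_eq_real_ivl)
qed

lemma closed_segment_same_Re_bounds:
  assumes "s \<in> closed_segment (Complex a c) (Complex a d)"
  shows "Re s = a"
proof -
  have "Re s \<in> closed_segment a a"
    using assms(1) in_closed_segment_imp_Re_in_closed_segment[of s "Complex a c" "Complex a d"] by auto
  thus ?thesis by auto
qed

text \<open>Cauchy's theorem on the rectangle between the two lines, whose horizontal edges
  contribute nothing in the limit.\<close>

lemma vertical_line_integral_shift:
  fixes f :: "complex \<Rightarrow> complex"
  assumes "0 < y1" "y1 \<le> y2" "f holomorphic_on {s. Re s > 0}"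
    and bound: "\<And>s. y1 \<le> Re s \<Longrightarrow> Re s \<le> y2 \<Longrightarrow> norm (f s) \<le> B / norm s ^ 2"
  shows "(LINT t|lborel. f (Complex y1 t)) = (LINT t|lborel. f (Complex y2 t))"
proof -
  have cont: "continuous_on {s. Re s > 0} f" by (rule holomorphic_on_imp_continuous_on) fact
  have B: "B \<ge> 0"
  proof -
    have "0 \<le> B / norm (of_real y1 :: complex) ^ 2"
      by (rule order_trans[OF norm_ge_zero bound]) (use assms in auto)
    thus ?thesis using assms by (simp add: zero_le_divide_iff)
  qed
  have lim: "(\<lambda>N. integral {- real N..real N} (\<lambda>t. f (Complex y t))) \<longlonglongrightarrow> (LINT t|lborel. f (Complex y t))"
    if "y1 \<le> y" "y \<le> y2" for y
    by (intro LIMSEQ_integral_symmetric integrable_vertical_line[where B = B])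
       (use assms that in \<open>auto intro: continuous_on_subset[OF cont]\<close>)
  have bd: "norm (f s) \<le> B / real N ^ 2" if "N > 0" "y1 \<le> Re s" "Re s \<le> y2" "\<bar>Im s\<bar> = real N" for N s
  proof -
    have "real N \<le> norm s" using that abs_Im_le_cmod[of s] by simp
    hence "B / norm s ^ 2 \<le> B / real N ^ 2"
      using B that by (intro divide_left_mono power_mono mult_pos_pos) auto
    thus ?thesis using bound[of s] that by linarith
  qed
  have sub: "path_image (rectpath (Complex y1 (- real N)) (Complex y2 (real N))) \<subseteq> {s. Re s > 0}" for N
    using path_image_rectpath_subset_cbox[of "Complex y1 (- real N)" "Complex y2 (real N)"] assms
    by (auto simp: in_cbox_complex_iff subset_iff)
  have rect: "contour_integral (linepath (Complex y1 (- real N)) (Complex y2 (- real N))) f +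
        \<i> * integral {- real N..real N} (\<lambda>t. f (Complex y2 t)) +
        contour_integral (linepath (Complex y2 (real N)) (Complex y1 (real N))) f -
        \<i> * integral {- real N..real N} (\<lambda>t. f (Complex y1 t)) = 0" if "N > 0" for N
  proof -
    have "(f has_contour_integral 0) (rectpath (Complex y1 (- real N)) (Complex y2 (real N)))"
      by (rule Cauchy_theorem_convex_simple[OF assms(3)])
         (use sub[of N] in \<open>auto simp: convex_halfspace_Re_gt\<close>)
    hence "contour_integral (rectpath (Complex y1 (- real N)) (Complex y2 (real N))) f = 0"
      by (rule contour_integral_unique)
    moreover have "contour_integral (linepath (Complex y2 (- real N)) (Complex y2 (real N))) f =
                     \<i> * integral {- real N..real N} (\<lambda>t. f (Complex y2 t))"
      by (rule contour_integral_linepath_same_Re) (use that in auto)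
    ultimately show ?thesis
      using contour_integral_rectpath(1)[of y1 y2 "- real N" "real N" f] assms that
        continuous_on_subset[OF cont sub] by simp
  qed
  have "(\<lambda>N. contour_integral (linepath (Complex y1 (- real N)) (Complex y2 (- real N))) f) \<longlonglongrightarrow> 0"
  proof (rule norm_contour_integral_linepath_tendsto_0[where C = B and D = "y2 - y1"])
    fix N s assume "0 < N" "s \<in> closed_segment (Complex y1 (- real N)) (Complex y2 (- real N))"
    thus "norm (f s) \<le> B / real N ^ 2"
      by (intro bd) (use assms closed_segment_same_Im_bounds[of s y1 "- real N" y2] in auto)
  next
    fix N :: nat assume "N > 0"
    have "norm (Complex y2 (- real N) - Complex y1 (- real N)) = y2 - y1"
      using assms by (simp add: cmod_def)
    thus "norm (Complex y2 (- real N) - Complex y1 (- real N)) \<le> (y2 - y1) * real N"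
      using mult_left_mono[of 1 "real N" "y2 - y1"] assms \<open>N > 0\<close> by simp
  qed (use B assms in \<open>auto intro!: continuous_on_subset[OF cont] dest: closed_segment_same_Im_bounds\<close>)
  moreover have "(\<lambda>N. contour_integral (linepath (Complex y2 (real N)) (Complex y1 (real N))) f) \<longlonglongrightarrow> 0"
  proof (rule norm_contour_integral_linepath_tendsto_0[where C = B and D = "y2 - y1"])
    fix N s assume "0 < N" "s \<in> closed_segment (Complex y2 (real N)) (Complex y1 (real N))"
    thus "norm (f s) \<le> B / real N ^ 2"
      by (intro bd)
         (use assms closed_segment_same_Im_bounds[of s y1 "real N" y2] in \<open>auto simp: closed_segment_commute\<close>)
  next
    fix N :: nat assume "N > 0"
    have "norm (Complex y1 (real N) - Complex y2 (real N)) = y2 - y1"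
      using assms by (simp add: cmod_def)
    thus "norm (Complex y1 (real N) - Complex y2 (real N)) \<le> (y2 - y1) * real N"
      using mult_left_mono[of 1 "real N" "y2 - y1"] assms \<open>N > 0\<close> by simp
  qed (use B assms in \<open>auto intro!: continuous_on_subset[OF cont] simp: closed_segment_commute[of "Complex y2 _"]
                        dest: closed_segment_same_Im_bounds\<close>)
  ultimately have "(\<lambda>N. contour_integral (linepath (Complex y1 (- real N)) (Complex y2 (- real N))) f +
        \<i> * integral {- real N..real N} (\<lambda>t. f (Complex y2 t)) +
        contour_integral (linepath (Complex y2 (real N)) (Complex y1 (real N))) f -
        \<i> * integral {- real N..real N} (\<lambda>t. f (Complex y1 t)))
        \<longlonglongrightarrow> 0 + \<i> * (LINT t|lborel. f (Complex y2 t)) + 0 - \<i> * (LINT t|lborel. f (Complex y1 t))"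
    using assms by (intro tendsto_intros lim) auto
  moreover have "(\<lambda>N. contour_integral (linepath (Complex y1 (- real N)) (Complex y2 (- real N))) f +
        \<i> * integral {- real N..real N} (\<lambda>t. f (Complex y2 t)) +
        contour_integral (linepath (Complex y2 (real N)) (Complex y1 (real N))) f -
        \<i> * integral {- real N..real N} (\<lambda>t. f (Complex y1 t))) \<longlonglongrightarrow> 0"
    by (rule Lim_transform_eventually[OF tendsto_const], rule eventually_mono[OF eventually_gt_at_top[of 0]])
       (simp add: rect)
  ultimately have "0 + \<i> * (LINT t|lborel. f (Complex y2 t)) + 0 - \<i> * (LINT t|lborel. f (Complex y1 t)) = 0"
    by (rule LIMSEQ_unique)
  thus ?thesis by simp
qed

text \<open>Cauchy's formula on a rectangle around z with left edge on Re s = y, whose other three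
  edges recede to infinity. The left edge is run downwards, which accounts for the kernel 1 / (z -
  s) instead of 1 / (s - z).\<close>

lemma vertical_line_Cauchy_integral:
  fixes f :: "complex \<Rightarrow> complex"
  assumes "0 < y" "y < z" "f holomorphic_on {s. Re s > 0}"
    and bound: "\<And>s. y \<le> Re s \<Longrightarrow> norm (f s) \<le> B / norm s ^ 2"
  shows "(LINT t|lborel. f (Complex y t) / (of_real z - Complex y t)) = 2 * of_real pi * f (of_real z)"
proof -
  define F where "F = (\<lambda>s. f s / (s - of_real z))"
  \<comment> \<open>N >= Z forces N > 2 z, so the far edges stay at distance at least z from the
    pole.\<close>
  define Z where "Z = nat \<lceil>2 * z\<rceil> + 1"
  have cont: "continuous_on {s. Re s > 0} f" by (rule holomorphic_on_imp_continuous_on) fact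
  have contF: "continuous_on A F" if "A \<subseteq> {s. Re s > 0} - {of_real z}" for A
    unfolding F_def using that by (intro continuous_intros continuous_on_subset[OF cont]) auto
  have B: "B \<ge> 0"
  proof -
    have "0 \<le> B / norm (of_real y :: complex) ^ 2"
      by (rule order_trans[OF norm_ge_zero bound]) (use assms in auto)
    thus ?thesis using assms by (simp add: zero_le_divide_iff)
  qed
  have normF: "norm (F s) \<le> (B / \<delta>) / norm s ^ 2" if "y \<le> Re s" "norm (s - of_real z) \<ge> \<delta>" "\<delta> > 0" for s \<delta>
  proof -
    have "norm (F s) = norm (f s) / norm (s - of_real z)" by (simp add: F_def norm_divide)
    also have "\<dots> \<le> (B / norm s ^ 2) / \<delta>" using bound[of s] that B by (intro frac_le) auto
    finally show ?thesis by (simp add: field_simps)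
  qed
  have lim: "(\<lambda>N. integral {- real N..real N} (\<lambda>t. F (Complex y t))) \<longlonglongrightarrow> (LINT t|lborel. F (Complex y t))"
  proof (intro LIMSEQ_integral_symmetric integrable_vertical_line)
    show "norm (F s) \<le> (B / (z - y)) / norm s ^ 2" if "Re s = y" for s
      using that assms abs_Re_le_cmod[of "s - of_real z"] by (intro normF) auto
  qed (use assms in \<open>auto intro!: contF\<close>)
  have big: "real N > 2 * z" if "N \<ge> Z" for N
    using that by (simp add: Z_def) linarith
  have N0: "N > 0" if "N \<ge> Z" for N using that by (simp add: Z_def)
  \<comment> \<open>Replacing N by max Z N makes the estimates valid for every N > 0, as the lemma
    on vanishing edges demands, and keeps the limit.\<close>
  define u where "u = (\<lambda>N. max Z N)"
  have u: "u N \<ge> Z" for N by (simp add: u_def)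
  have bd: "norm (F s) \<le> (B / z) / real N ^ 2"
    if "N \<ge> Z" "y \<le> Re s" "\<bar>Im s\<bar> = real N \<or> Re s = real N" for N s
  proof -
    have *: "real N \<le> norm s" using that abs_Im_le_cmod[of s] abs_Re_le_cmod[of s] by auto
    have "norm (s - of_real z) \<ge> z"
      using that big[of N] assms abs_Im_le_cmod[of "s - of_real z"] abs_Re_le_cmod[of "s - of_real z"]
      by auto
    hence "norm (F s) \<le> (B / z) / norm s ^ 2" using that assms by (intro normF) auto
    also have "\<dots> \<le> (B / z) / real N ^ 2"
      using B * assms N0[OF that(1)] by (intro divide_left_mono power_mono mult_pos_pos) auto
    finally show ?thesis by simp
  qed
  have seg: "closed_segment (Complex y (- real N)) (Complex (real N) (- real N)) \<subseteq> {s. Re s > 0} - {of_real z}"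
       "closed_segment (Complex (real N) (- real N)) (Complex (real N) (real N)) \<subseteq> {s. Re s > 0} - {of_real z}"
       "closed_segment (Complex (real N) (real N)) (Complex y (real N)) \<subseteq> {s. Re s > 0} - {of_real z}"
    if "N \<ge> Z" for N
    using big[OF that] assms closed_segment_same_Im_bounds[of _ y "- real N" "real N"]
      closed_segment_same_Re_bounds[of _ "real N" "- real N" "real N"]
      closed_segment_same_Im_bounds[of _ y "real N" "real N"]
    by (fastforce simp: closed_segment_commute[of "Complex (real N) (real N)" "Complex y (real N)"])+
  have rect: "contour_integral (linepath (Complex y (- real N)) (Complex (real N) (- real N))) F +
        contour_integral (linepath (Complex (real N) (- real N)) (Complex (real N) (real N))) F +
        contour_integral (linepath (Complex (real N) (real N)) (Complex y (real N))) F -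
        \<i> * integral {- real N..real N} (\<lambda>t. F (Complex y t)) = 2 * of_real pi * \<i> * f (of_real z)"
    if "N \<ge> Z" for N
  proof -
    let ?R = "rectpath (Complex y (- real N)) (Complex (real N) (real N))"
    have zbox: "of_real z \<in> box (Complex y (- real N)) (Complex (real N) (real N))"
      using assms big[OF that] by (simp add: in_box_complex_iff)
    have sub: "path_image ?R \<subseteq> {s. Re s > 0} - {of_real z}"
      using path_image_rectpath_subset_cbox[of "Complex y (- real N)" "Complex (real N) (real N)"]
        path_image_rectpath_inter_box[of "Complex y (- real N)" "Complex (real N) (real N)"]
        zbox assms big[OF that]
      by (auto simp: in_cbox_complex_iff subset_iff)
    have "(F has_contour_integral of_real (2 * pi) * \<i> * winding_number ?R (of_real z) * f (of_real z)) ?R"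
      unfolding F_def
    proof (rule Cauchy_integral_formula_convex_simple[OF _ assms(3)])
      show "of_real z \<in> interior {s. 0 < Re s}"
        using assms by (subst interior_open) (auto simp: open_halfspace_Re_gt)
    qed (use sub in \<open>auto simp: convex_halfspace_Re_gt\<close>)
    hence "contour_integral ?R F = 2 * of_real pi * \<i> * f (of_real z)"
      using winding_number_rectpath[OF zbox] contour_integral_unique by fastforce
    thus ?thesis
      using contour_integral_rectpath(1)[of y "real N" "- real N" "real N" F] assms big[OF that]
        contF[OF sub] by simp
  qed
  have small: "(\<lambda>N. contour_integral (linepath (Complex y (- real (u N))) (Complex (real (u N)) (- real (u N)))) F) \<longlonglongrightarrow> 0"
    "(\<lambda>N. contour_integral (linepath (Complex (real (u N)) (- real (u N))) (Complex (real (u N)) (real (u N)))) F) \<longlonglongrightarrow> 0"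
    "(\<lambda>N. contour_integral (linepath (Complex (real (u N)) (real (u N))) (Complex y (real (u N)))) F) \<longlonglongrightarrow> 0"
  proof -
    have le: "(B / z) / real (u N) ^ 2 \<le> (B / z) / real N ^ 2" if "N > 0" for N
      using that B assms by (intro divide_left_mono power_mono mult_pos_pos) (auto simp: u_def)
    have uN: "real (u N) \<le> real Z * real N" if "N > 0" for N
    proof -
      have "max Z N \<le> Z * N" using that N0[OF order_refl] by (auto simp: max_def)
      thus ?thesis by (simp add: u_def flip: of_nat_mult)
    qed
    have yu: "y < real (u N)" for N using big[OF u[of N]] assms by linarith
    show "(\<lambda>N. contour_integral (linepath (Complex y (- real (u N))) (Complex (real (u N)) (- real (u N)))) F) \<longlonglongrightarrow> 0"
    proof (rule norm_contour_integral_linepath_tendsto_0[where C = "B / z" and D = "real Z"])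
      fix N s assume "0 < N" "s \<in> closed_segment (Complex y (- real (u N))) (Complex (real (u N)) (- real (u N)))"
      thus "norm (F s) \<le> (B / z) / real N ^ 2"
        using bd[OF u, of s N] le[of N] yu[of N] closed_segment_same_Im_bounds[of s y "- real (u N)" "real (u N)"] by auto
    next
      fix N :: nat assume "N > 0"
      have "norm (Complex (real (u N)) (- real (u N)) - Complex y (- real (u N))) = real (u N) - y"
        using yu[of N] by (simp add: cmod_def)
      thus "norm (Complex (real (u N)) (- real (u N)) - Complex y (- real (u N))) \<le> real Z * real N"
        using uN[OF \<open>N > 0\<close>] assms by linarith
    qed (use B assms seg u contF in auto)
    show "(\<lambda>N. contour_integral (linepath (Complex (real (u N)) (- real (u N))) (Complex (real (u N)) (real (u N)))) F) \<longlonglongrightarrow> 0"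
    proof (rule norm_contour_integral_linepath_tendsto_0[where C = "B / z" and D = "2 * real Z"])
      fix N s assume "0 < N" "s \<in> closed_segment (Complex (real (u N)) (- real (u N))) (Complex (real (u N)) (real (u N)))"
      thus "norm (F s) \<le> (B / z) / real N ^ 2"
        using bd[OF u, of s N] le[of N] yu[of N] closed_segment_same_Re_bounds[of s "real (u N)"] by auto
    next
      fix N :: nat assume "N > 0"
      have "Complex (real (u N)) (real (u N)) - Complex (real (u N)) (- real (u N)) = of_real (2 * real (u N)) * \<i>"
        by (simp add: complex_eq_iff)
      hence "norm (Complex (real (u N)) (real (u N)) - Complex (real (u N)) (- real (u N))) = 2 * real (u N)"
        by (simp only: norm_mult norm_of_real norm_ii)
      thus "norm (Complex (real (u N)) (real (u N)) - Complex (real (u N)) (- real (u N))) \<le> 2 * real Z * real N"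
        using uN[OF \<open>N > 0\<close>] assms by linarith
    qed (use B assms seg u contF in auto)
    show "(\<lambda>N. contour_integral (linepath (Complex (real (u N)) (real (u N))) (Complex y (real (u N)))) F) \<longlonglongrightarrow> 0"
    proof (rule norm_contour_integral_linepath_tendsto_0[where C = "B / z" and D = "real Z"])
      fix N s assume "0 < N" "s \<in> closed_segment (Complex (real (u N)) (real (u N))) (Complex y (real (u N)))"
      thus "norm (F s) \<le> (B / z) / real N ^ 2"
        using bd[OF u, of s N] le[of N] yu[of N] closed_segment_same_Im_bounds[of s y "real (u N)" "real (u N)"]
        by (auto simp: closed_segment_commute)
    next
      fix N :: nat assume "N > 0"
      have "norm (Complex y (real (u N)) - Complex (real (u N)) (real (u N))) = real (u N) - y"
        using yu[of N] by (simp add: cmod_def)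
      thus "norm (Complex y (real (u N)) - Complex (real (u N)) (real (u N))) \<le> real Z * real N"
        using uN[OF \<open>N > 0\<close>] assms by linarith
    qed (use B assms seg u contF in auto)
  qed
  have "filterlim u sequentially sequentially"
    by (rule filterlim_at_top_mono[OF filterlim_ident]) (simp add: u_def)
  from filterlim_compose[OF lim this]
  have "(\<lambda>N. integral {- real (u N)..real (u N)} (\<lambda>t. F (Complex y t))) \<longlonglongrightarrow> (LINT t|lborel. F (Complex y t))" .
  hence "(\<lambda>N. contour_integral (linepath (Complex y (- real (u N))) (Complex (real (u N)) (- real (u N)))) F +
        contour_integral (linepath (Complex (real (u N)) (- real (u N))) (Complex (real (u N)) (real (u N)))) F +
        contour_integral (linepath (Complex (real (u N)) (real (u N))) (Complex y (real (u N)))) F -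
        \<i> * integral {- real (u N)..real (u N)} (\<lambda>t. F (Complex y t))) \<longlonglongrightarrow> 0 + 0 + 0 - \<i> * (LINT t|lborel. F (Complex y t))"
    by (intro tendsto_intros small)
  hence "2 * of_real pi * \<i> * f (of_real z) = 0 + 0 + 0 - \<i> * (LINT t|lborel. F (Complex y t))"
    unfolding rect[OF u] by (simp add: tendsto_const_iff)
  hence "\<i> * (2 * of_real pi * f (of_real z)) = \<i> * (- (LINT t|lborel. F (Complex y t)))" by (simp add: mult_ac)
  hence "2 * of_real pi * f (of_real z) = - (LINT t|lborel. F (Complex y t))"
    by (subst (asm) mult_left_cancel) auto
  also have "\<dots> = (LINT t|lborel. - F (Complex y t))" by simp
  also have "(\<lambda>t. - F (Complex y t)) = (\<lambda>t. f (Complex y t) / (of_real z - Complex y t))"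
    unfolding F_def by (metis minus_diff_eq minus_divide_right)
  finally show ?thesis ..
qed


lemma integral_exp_halfline:
  assumes "Re w < 0"
  shows "integrable lborel (\<lambda>x. indicator {0..} x *\<^sub>R exp (w * of_real x))"
    and "(LINT x|lborel. indicator {0..} x *\<^sub>R exp (w * of_real x)) = - 1 / w"
proof -
  have bd: "integrable lborel (\<lambda>x. indicator {0..} x * exp (Re w * x))"
  proof (rule integrableI_nonneg)
    have "((\<lambda>x. exp (- (- Re w) * x)) has_integral exp (- (- Re w) * 0) / (- Re w)) {0..}"
      by (rule has_integral_exp_minus_to_infinity) (use assms in simp)
    from nn_integral_has_integral_lebesgue[OF _ this]
    show "(\<integral>\<^sup>+ x. ennreal (indicator {0..} x * exp (Re w * x)) \<partial>lborel) < \<infinity>" by simp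
  qed (auto intro!: borel_measurable_continuous_onI continuous_intros)
  show int: "integrable lborel (\<lambda>x. indicator {0..} x *\<^sub>R exp (w * of_real x))"
  proof (rule Bochner_Integration.integrable_bound[OF bd])
    show "(\<lambda>x. indicator {0..} x *\<^sub>R exp (w * of_real x)) \<in> borel_measurable lborel"
      by (intro borel_measurable_scaleR) (auto intro!: borel_measurable_continuous_onI continuous_intros)
  qed (simp add: norm_exp_eq_Re)
  have w: "w \<noteq> 0" using assms by auto
  have "integral {- real N..real N} (\<lambda>x. indicator {0..} x *\<^sub>R exp (w * of_real x)) =
          (exp (w * of_real (real N)) - 1) / w" for N
  proof -
    have "((\<lambda>x. exp (w * of_real x)) has_integral exp (w * of_real (real N)) / w - exp (w * of_real 0) / w) {0..real N}"
      by (rule fundamental_theorem_of_calculus)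
         (use w in \<open>auto intro!: derivative_eq_intros has_vector_derivative_real_field simp: scaleR_conv_of_real\<close>)
    hence "((\<lambda>x. if x \<in> {0..real N} then exp (w * of_real x) else 0) has_integral
             exp (w * of_real (real N)) / w - exp (w * of_real 0) / w) {- real N..real N}"
      by (subst has_integral_restrict) auto
    hence "((\<lambda>x. indicator {0..} x *\<^sub>R exp (w * of_real x)) has_integral
             exp (w * of_real (real N)) / w - exp (w * of_real 0) / w) {- real N..real N}"
      by (rule has_integral_eq[rotated]) (auto simp: indicator_def)
    thus ?thesis by (simp add: integral_unique diff_divide_distrib)
  qed
  with LIMSEQ_integral_symmetric[OF int]
  have "(\<lambda>N. (exp (w * of_real (real N)) - 1) / w) \<longlonglongrightarrow> (LINT x|lborel. indicator {0..} x *\<^sub>R exp (w * of_real x))"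
    by simp
  moreover have "(\<lambda>N. exp (w * of_real (real N))) \<longlonglongrightarrow> 0"
  proof (rule tendsto_norm_zero_cancel)
    show "(\<lambda>N. norm (exp (w * of_real (real N)))) \<longlonglongrightarrow> 0"
      unfolding norm_exp_eq_Re using assms by simp real_asymp
  qed
  hence "(\<lambda>N. (exp (w * of_real (real N)) - 1) / w) \<longlonglongrightarrow> (0 - 1) / w"
    using w by (intro tendsto_intros)
  ultimately show "(LINT x|lborel. indicator {0..} x *\<^sub>R exp (w * of_real x)) = - 1 / w"
    using LIMSEQ_unique by fastforce
qed

section \<open>Hankel's integral for the reciprocal Gamma function and the Bessel integral\<close>

text \<open>The integrand of Hankel's formula for 1 / Gamma a. On Re s > 0 the principal power is
  holomorphic, and a >= 2 gives the quadratic decay used for vertical lines.\<close>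

definition hankel_integrand :: "real \<Rightarrow> real \<Rightarrow> complex \<Rightarrow> complex"
  where "hankel_integrand a \<alpha> s = s powr (- of_real a) * exp (of_real \<alpha> * s)"

lemma holomorphic_hankel_integrand: "hankel_integrand a \<alpha> holomorphic_on {s. Re s > 0}"
  unfolding hankel_integrand_def by (intro holomorphic_intros) (auto simp: complex_nonpos_Reals_iff)

lemma norm_hankel_integrand_le:
  assumes "a \<ge> 2" "\<alpha> \<ge> 0" "0 < y1" "y1 \<le> Re s" "Re s \<le> y2"
  shows "norm (hankel_integrand a \<alpha> s) \<le> (y1 powr (2 - a) * exp (\<alpha> * y2)) / norm s ^ 2"
proof -
  have s: "y1 \<le> norm s" "norm s > 0" using assms complex_Re_le_cmod[of s] by linarith+
  have "norm (hankel_integrand a \<alpha> s) = norm s powr (- a) * exp (\<alpha> * Re s)"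
    by (simp add: hankel_integrand_def norm_mult norm_powr_real_powr' norm_exp_eq_Re)
  also have "norm s powr (- a) = norm s powr (2 - a) / norm s ^ 2"
    using s by (simp add: powr_diff powr_minus field_simps flip: powr_numeral)
  also have "norm s powr (2 - a) / norm s ^ 2 * exp (\<alpha> * Re s) \<le>
               y1 powr (2 - a) / norm s ^ 2 * exp (\<alpha> * y2)"
    using assms s by (intro mult_mono divide_right_mono powr_mono2') (auto intro!: mult_left_mono)
  finally show ?thesis by simp
qed

lemma integrable_hankel_integrand:
  assumes "a \<ge> 2" "\<alpha> \<ge> 0" "0 < y"
  shows "integrable lborel (\<lambda>t. hankel_integrand a \<alpha> (Complex y t))"
proof (rule integrable_vertical_line[OF assms(3)])
  show "continuous_on {s. Re s = y} (hankel_integrand a \<alpha>)"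
    by (rule continuous_on_subset[OF holomorphic_on_imp_continuous_on[OF holomorphic_hankel_integrand]])
       (use assms in auto)
  show "norm (hankel_integrand a \<alpha> s) \<le> (y powr (2 - a) * exp (\<alpha> * y)) / norm s ^ 2" if "Re s = y" for s
    using that assms by (intro norm_hankel_integrand_le) auto
qed

text \<open>Substituting t / \<alpha> extracts the power of \<alpha> and moves the line to Re s =
  \<alpha> y; Cauchy's theorem moves it to Re s = 1.\<close>

lemma hankel_integral_scaling:
  assumes "a \<ge> 2" "\<alpha> > 0" "y > 0"
  shows "(LINT t|lborel. hankel_integrand a \<alpha> (Complex y t)) =
           of_real (\<alpha> powr (a - 1)) * (LINT t|lborel. hankel_integrand a 1 (Complex 1 t))"
proof -
  have eq: "hankel_integrand a \<alpha> (Complex y (0 + 1 / \<alpha> * t)) =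
              of_real (\<alpha> powr a) * hankel_integrand a 1 (Complex (\<alpha> * y) t)" for t
  proof -
    have c: "Complex y (0 + 1 / \<alpha> * t) = of_real (1 / \<alpha>) * Complex (\<alpha> * y) t"
      using assms by (simp add: complex_eq_iff)
    have "of_real (1 / \<alpha>) powr (- of_real a :: complex) = of_real ((1 / \<alpha>) powr (- a))"
      using assms by (subst powr_of_real [symmetric]) auto
    also have "(1 / \<alpha>) powr (- a) = \<alpha> powr a" using assms by (simp add: powr_divide powr_minus)
    finally have *: "of_real (1 / \<alpha>) powr (- of_real a :: complex) = of_real (\<alpha> powr a)" .
    show ?thesis
      unfolding hankel_integrand_def c
      by (subst powr_times_real_left) (use assms * in auto)
  qed
  have "(LINT t|lborel. hankel_integrand a \<alpha> (Complex y t)) =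
          \<bar>1 / \<alpha>\<bar> *\<^sub>R (LINT t|lborel. hankel_integrand a \<alpha> (Complex y (0 + 1 / \<alpha> * t)))"
    using assms by (intro lborel_integral_real_affine) auto
  also have "\<dots> = of_real (\<alpha> powr (a - 1)) * (LINT t|lborel. hankel_integrand a 1 (Complex (\<alpha> * y) t))"
    unfolding eq using assms by (simp add: scaleR_conv_of_real powr_diff)
  also have "(LINT t|lborel. hankel_integrand a 1 (Complex (\<alpha> * y) t)) =
               (LINT t|lborel. hankel_integrand a 1 (Complex 1 t))"
  proof -
    define y1 y2 where "y1 = min (\<alpha> * y) 1" and "y2 = max (\<alpha> * y) 1"
    have "(LINT t|lborel. hankel_integrand a 1 (Complex y1 t)) = (LINT t|lborel. hankel_integrand a 1 (Complex y2 t))"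
    proof (rule vertical_line_integral_shift)
      show "norm (hankel_integrand a 1 s) \<le> (y1 powr (2 - a) * exp (1 * y2)) / norm s ^ 2"
        if "y1 \<le> Re s" "Re s \<le> y2" for s
        using assms that by (intro norm_hankel_integrand_le) (auto simp: y1_def)
    qed (use assms holomorphic_hankel_integrand in \<open>auto simp: y1_def y2_def\<close>)
    thus ?thesis by (auto simp: y1_def y2_def min_def max_def split: if_splits)
  qed
  finally show ?thesis .
qed

text \<open>
  By scaling only a constant is unknown. It is found by comparing the Laplace transforms in
  \<open>\<alpha>\<close> at the point 1: the integral over \<open>\<alpha>\<close> turns the exponential into a Cauchy kernel.
\<close>
lemma hankel_integral_constant:
  assumes "a \<ge> 2"
  shows "(LINT t|lborel. hankel_integrand a 1 (Complex 1 t)) = of_real (2 * pi / Gamma a)"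
proof -
  define \<kappa> where "\<kappa> = (LINT t|lborel. hankel_integrand a 1 (Complex 1 t))"
  define h where "h = (\<lambda>s :: complex. s powr (- of_real a))"
  \<comment> \<open>The line Re s = 1/2 lies to the left of 1, so exp((s - 1) \<alpha>) decays and
    the integrations over \<alpha> and t can be exchanged.\<close>
  define k where "k = (\<lambda>\<alpha> t. indicator {0..} \<alpha> *\<^sub>R (exp ((Complex (1/2) t - 1) * of_real \<alpha>) * h (Complex (1/2) t)))"
  have hh: "h s = hankel_integrand a 0 s" for s by (simp add: h_def hankel_integrand_def)
  have cont: "continuous_on UNIV (\<lambda>t. h (Complex (1/2) t))"
    unfolding h_def by (intro continuous_intros) (auto simp: complex_nonpos_Reals_iff complex_eq_iff)
  have int_h: "integrable lborel (\<lambda>t. h (Complex (1/2) t))"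
    unfolding hh using assms by (intro integrable_hankel_integrand) auto
  have "integrable (lborel \<Otimes>\<^sub>M lborel) (case_prod k)"
  proof (rule lborel_pair.Fubini_integrable)
    have "(\<lambda>p. indicator ({0..} \<times> UNIV) p *\<^sub>R
              (exp ((Complex (1/2) (snd p) - 1) * of_real (fst p)) * h (Complex (1/2) (snd p)))) \<in> borel_measurable borel"
    proof (intro borel_measurable_scaleR)
      show "indicator ({0..} \<times> UNIV :: (real \<times> real) set) \<in> borel_measurable borel"
        by (intro borel_measurable_indicator borel_closed closed_Times) auto
      have "continuous_on UNIV (\<lambda>p. exp ((Complex (1/2) (snd p) - 1) * of_real (fst p)) * h (Complex (1/2) (snd p)))"
        unfolding Complex_eq
        by (intro continuous_intros continuous_on_compose2[OF cont[unfolded Complex_eq]]) auto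
      thus "(\<lambda>p. exp ((Complex (1/2) (snd p) - 1) * of_real (fst p)) * h (Complex (1/2) (snd p))) \<in> borel_measurable borel"
        by (rule borel_measurable_continuous_onI)
    qed
    moreover have "(\<lambda>p. indicator ({0..} \<times> UNIV) p *\<^sub>R
              (exp ((Complex (1/2) (snd p) - 1) * of_real (fst p)) * h (Complex (1/2) (snd p)))) = case_prod k"
      by (auto simp: fun_eq_iff k_def indicator_def)
    ultimately show "case_prod k \<in> borel_measurable (lborel \<Otimes>\<^sub>M lborel)"
      by (simp add: lborel_prod)
    have norm_k: "norm (k \<alpha> t) = indicator {0..} \<alpha> * exp (- \<alpha> / 2) * norm (h (Complex (1/2) t))" for \<alpha> t
      by (simp add: k_def norm_mult norm_exp_eq_Re)
    have "integrable lborel (\<lambda>x. norm (indicator {0..} x *\<^sub>R exp (of_real (-1/2) * of_real x) :: complex))"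
      by (intro integrable_norm integral_exp_halfline) auto
    hence "integrable lborel (\<lambda>x::real. indicator {0..} x * exp (- x / 2) :: real)"
      by (simp add: norm_exp_eq_Re)
    hence "integrable lborel (\<lambda>\<alpha>. indicator {0..} \<alpha> * exp (- \<alpha> / 2) * (LINT t|lborel. norm (h (Complex (1/2) t))))"
      by (rule integrable_mult_left)
    thus "integrable lborel (\<lambda>\<alpha>. LINT t|lborel. norm (case (\<alpha>, t) of (x, y) \<Rightarrow> k x y))"
      by (simp add: norm_k)
    have "integrable lborel (k \<alpha>)" for \<alpha>
    proof (rule Bochner_Integration.integrable_bound)
      show "integrable lborel (\<lambda>t. indicator {0..} \<alpha> * exp (- \<alpha> / 2) * norm (h (Complex (1/2) t)))"
        using int_h by simp
      show "k \<alpha> \<in> borel_measurable lborel"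
        unfolding k_def
        by (intro borel_measurable_scaleR borel_measurable_times)
           (auto intro!: borel_measurable_continuous_onI cont continuous_intros)
    qed (auto simp: norm_k)
    thus "AE \<alpha> in lborel. integrable lborel (\<lambda>t. case (\<alpha>, t) of (x, y) \<Rightarrow> k x y)" by simp
  qed
  hence "(LINT t|lborel. LINT \<alpha>|lborel. k \<alpha> t) = (LINT \<alpha>|lborel. LINT t|lborel. k \<alpha> t)"
    by (rule lborel_pair.Fubini_integral)
  also have "(\<lambda>t. LINT \<alpha>|lborel. k \<alpha> t) = (\<lambda>t. h (Complex (1/2) t) / (of_real 1 - Complex (1/2) t))"
  proof
    fix t
    have "(LINT \<alpha>|lborel. k \<alpha> t) =
            (LINT \<alpha>|lborel. (indicator {0..} \<alpha> *\<^sub>R exp ((Complex (1/2) t - 1) * of_real \<alpha>)) * h (Complex (1/2) t))"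
      by (simp add: k_def)
    also have "\<dots> = (LINT \<alpha>|lborel. indicator {0..} \<alpha> *\<^sub>R exp ((Complex (1/2) t - 1) * of_real \<alpha>)) * h (Complex (1/2) t)"
      by (rule integral_mult_left_zero)
    also have "(LINT \<alpha>|lborel. indicator {0..} \<alpha> *\<^sub>R exp ((Complex (1/2) t - 1) * of_real \<alpha>)) =
                 - 1 / (Complex (1/2) t - 1)"
      by (rule integral_exp_halfline) simp
    also have "- 1 / (Complex (1/2) t - 1) * h (Complex (1/2) t) = h (Complex (1/2) t) / - (Complex (1/2) t - 1)"
      by (simp only: divide_minus_right times_divide_eq_left mult_minus_left mult_1_left minus_divide_left)
    also have "- (Complex (1/2) t - 1) = of_real 1 - Complex (1/2) t" by simp
    finally show "(LINT \<alpha>|lborel. k \<alpha> t) = h (Complex (1/2) t) / (of_real 1 - Complex (1/2) t)" .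
  qed
  also have "(LINT t|lborel. h (Complex (1/2) t) / (of_real 1 - Complex (1/2) t)) = 2 * of_real pi * h (of_real 1)"
  proof (rule vertical_line_Cauchy_integral)
    show "h holomorphic_on {s. Re s > 0}"
      unfolding hh by (rule holomorphic_hankel_integrand)
    show "norm (h s) \<le> ((1/2) powr (2 - a) * exp 0) / norm s ^ 2" if "1/2 \<le> Re s" for s
      unfolding hh using norm_hankel_integrand_le[of a 0 "1/2" s "Re s"] that assms by simp
  qed auto
  also have "h (of_real 1) = 1" by (simp add: h_def)
  also have "(\<lambda>\<alpha>. LINT t|lborel. k \<alpha> t) = (\<lambda>\<alpha>. indicator {0..} \<alpha> *\<^sub>R of_real (\<alpha> powr (a - 1) / exp \<alpha>) * \<kappa>)"
  proof
    fix \<alpha> :: real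
    show "(LINT t|lborel. k \<alpha> t) = indicator {0..} \<alpha> *\<^sub>R of_real (\<alpha> powr (a - 1) / exp \<alpha>) * \<kappa>"
    proof (cases "\<alpha> \<ge> 0")
      case \<alpha>: True
      have "k \<alpha> t = of_real (exp (- \<alpha>)) * hankel_integrand a \<alpha> (Complex (1/2) t)" for t
        using \<alpha> by (simp add: k_def hankel_integrand_def h_def exp_of_real [symmetric] exp_add [symmetric] algebra_simps)
      hence *: "(LINT t|lborel. k \<alpha> t) = of_real (exp (- \<alpha>)) * (LINT t|lborel. hankel_integrand a \<alpha> (Complex (1/2) t))"
        by simp
      show ?thesis
      proof (cases "\<alpha> = 0")
        case False
        thus ?thesis
          using * hankel_integral_scaling[of a \<alpha> "1/2"] \<alpha> assms by (simp add: \<kappa>_def exp_minus field_simps)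
      next
        case True
        \<comment> \<open>The scaling law needs \<alpha> > 0. The value at 0 is its limit along
          \<alpha> = 1 / (n + 1), and it agrees with 0 powr (a - 1) = 0.\<close>
        have "(LINT t|lborel. hankel_integrand a 0 (Complex (1/2) t)) = 0"
        proof (rule LIMSEQ_unique)
          have sc: "(LINT t|lborel. hankel_integrand a (1 / real (Suc n)) (Complex (1/2) t)) =
                      of_real ((1 / real (Suc n)) powr (a - 1)) * \<kappa>" for n
            unfolding \<kappa>_def by (rule hankel_integral_scaling) (use assms in auto)
          have "(\<lambda>n. LINT t|lborel. hankel_integrand a (1 / real (Suc n)) (Complex (1/2) t)) \<longlonglongrightarrow>
                  (LINT t|lborel. hankel_integrand a 0 (Complex (1/2) t))"
          proof (rule integral_dominated_convergence)
            show "integrable lborel (\<lambda>t. exp (1/2) * norm (h (Complex (1/2) t)))"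
              using int_h by (intro integrable_mult_right integrable_norm)
            show "(\<lambda>t. hankel_integrand a 0 (Complex (1/2) t)) \<in> borel_measurable lborel"
                 "(\<lambda>t. hankel_integrand a (1 / real (Suc n)) (Complex (1/2) t)) \<in> borel_measurable lborel" for n
              using assms by (intro borel_measurable_integrable integrable_hankel_integrand; simp)+
            show "AE t in lborel. (\<lambda>n. hankel_integrand a (1 / real (Suc n)) (Complex (1/2) t)) \<longlonglongrightarrow>
                    hankel_integrand a 0 (Complex (1/2) t)"
              unfolding hankel_integrand_def
              by (intro AE_I2 tendsto_intros) (use LIMSEQ_Suc[OF lim_1_over_n] in simp)
            show "AE t in lborel. norm (hankel_integrand a (1 / real (Suc n)) (Complex (1/2) t)) \<le>
                    exp (1/2) * norm (h (Complex (1/2) t))" for n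
            proof (rule AE_I2)
              fix t
              have "exp (1 / real (Suc n) * (1/2)) \<le> exp (1/2)" by (simp add: field_simps)
              thus "norm (hankel_integrand a (1 / real (Suc n)) (Complex (1/2) t)) \<le>
                    exp (1/2) * norm (h (Complex (1/2) t))"
                by (simp add: hankel_integrand_def h_def norm_mult norm_exp_eq_Re mult.commute[of "exp (1/2)"]
                         mult_left_mono)
            qed
          qed
          thus "(\<lambda>n. of_real ((1 / real (Suc n)) powr (a - 1)) * \<kappa>) \<longlonglongrightarrow>
                  (LINT t|lborel. hankel_integrand a 0 (Complex (1/2) t))"
            by (simp only: sc)
          have "(\<lambda>n. (1 / real (Suc n)) powr (a - 1)) \<longlonglongrightarrow> 0" using assms by real_asymp
          hence "(\<lambda>n. complex_of_real ((1 / real (Suc n)) powr (a - 1))) \<longlonglongrightarrow> of_real 0"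
            by (rule tendsto_of_real)
          thus "(\<lambda>n. of_real ((1 / real (Suc n)) powr (a - 1)) * \<kappa>) \<longlonglongrightarrow> 0"
            using tendsto_mult_left_zero by fastforce
        qed
        with True * show ?thesis using assms by simp
      qed
    qed (simp add: k_def)
  qed
  also have "(LINT \<alpha>|lborel. indicator {0..} \<alpha> *\<^sub>R of_real (\<alpha> powr (a - 1) / exp \<alpha>) * \<kappa>) = of_real (Gamma a) * \<kappa>"
  proof -
    have "has_bochner_integral lborel (\<lambda>\<alpha>. indicator {0..} \<alpha> * (\<alpha> powr (a - 1) / exp \<alpha>)) (Gamma a)"
    proof (rule has_bochner_integral_nn_integral)
      show "(\<integral>\<^sup>+ x. ennreal (indicator {0..} x * (x powr (a - 1) / exp x)) \<partial>lborel) = ennreal (Gamma a)"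
        by (rule nn_integral_has_integral_lebesgue[OF _ Gamma_integral_real]) (use assms in auto)
    qed (use assms in \<open>auto simp: less_imp_le[OF Gamma_real_pos]\<close>)
    hence "has_bochner_integral lborel (\<lambda>\<alpha>. complex_of_real (indicator {0..} \<alpha> * (\<alpha> powr (a - 1) / exp \<alpha>))) (of_real (Gamma a))"
      by (rule has_bochner_integral_of_real)
    hence "has_bochner_integral lborel (\<lambda>\<alpha>. complex_of_real (indicator {0..} \<alpha> * (\<alpha> powr (a - 1) / exp \<alpha>)) * \<kappa>) (of_real (Gamma a) * \<kappa>)"
      by (rule has_bochner_integral_mult_left)
    hence "(LINT \<alpha>|lborel. complex_of_real (indicator {0..} \<alpha> * (\<alpha> powr (a - 1) / exp \<alpha>)) * \<kappa>) = of_real (Gamma a) * \<kappa>"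
      by (rule has_bochner_integral_integral_eq)
    thus ?thesis by (simp add: scaleR_conv_of_real)
  qed
  finally have "of_real (Gamma a) * \<kappa> = 2 * of_real pi" by simp
  moreover have "Gamma a > 0" using assms by (intro Gamma_real_pos) auto
  ultimately have "\<kappa> = 2 * of_real pi / of_real (Gamma a)" by (simp add: field_simps)
  thus ?thesis by (simp add: \<kappa>_def)
qed

lemma hankel_integral:
  assumes "a \<ge> 2" "\<alpha> > 0" "y > 0"
  shows "(LINT t|lborel. hankel_integrand a \<alpha> (Complex y t)) = of_real (2 * pi * \<alpha> powr (a - 1) / Gamma a)"
  using hankel_integral_scaling[OF assms] hankel_integral_constant[OF assms(1)] by simp

text \<open>Expand exp(\<beta> / s) and integrate termwise; the j-th term is Hankel's integral with
  exponent j + 5 / 2. On the line |s| >= y, so the terms are dominated by those of exp(|\<beta>| /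
  y).\<close>

lemma bessel_integral:
  assumes "\<alpha> > 0" "y > 0"
  shows "integrable lborel (\<lambda>t. Complex y t powr (-5/2) * exp (of_real \<alpha> * Complex y t + of_real \<beta> / Complex y t))"
    and "summable (\<lambda>j. \<beta> ^ j / fact j * (2 * pi * \<alpha> powr (real j + 3/2) / Gamma (real j + 5/2)))"
    and "(LINT t|lborel. Complex y t powr (-5/2) * exp (of_real \<alpha> * Complex y t + of_real \<beta> / Complex y t)) =
           of_real (\<Sum>j. \<beta> ^ j / fact j * (2 * pi * \<alpha> powr (real j + 3/2) / Gamma (real j + 5/2)))"
proof -
  define G where "G = (\<lambda>s::complex. s powr (-5/2) * exp (of_real \<alpha> * s + of_real \<beta> / s))"
  define g where "g = (\<lambda>j t. of_real (\<beta> ^ j / fact j) * hankel_integrand (real j + 5/2) \<alpha> (Complex y t))"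
  define h where "h = (\<lambda>t. hankel_integrand (5/2) \<alpha> (Complex y t))"
  have y: "Complex y t \<noteq> 0" for t using assms by (simp add: complex_eq_iff)
  have g_eq: "g j t = h t * ((of_real \<beta> / Complex y t) ^ j /\<^sub>R fact j)" for j t
  proof -
    have "Complex y t powr (- of_real (real j + 5/2)) = Complex y t powr (- of_nat j + - of_real (5/2))"
      by simp
    also have "\<dots> = Complex y t powr (- of_nat j) * Complex y t powr (- of_real (5/2))"
      by (rule powr_add)
    also have "Complex y t powr (- of_nat j) = inverse (Complex y t ^ j)"
      using y[of t] by (simp add: powr_minus powr_nat)
    finally show ?thesis
      by (simp add: g_def h_def hankel_integrand_def scaleR_conv_of_real power_divide field_simps)
  qed
  have G_sums: "(\<lambda>j. g j t) sums G (Complex y t)" for t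
  proof -
    have "(\<lambda>j. h t * ((of_real \<beta> / Complex y t) ^ j /\<^sub>R fact j)) sums (h t * exp (of_real \<beta> / Complex y t))"
      by (intro sums_mult exp_converges)
    thus ?thesis unfolding g_eq
      by (simp add: G_def h_def hankel_integrand_def exp_add mult_ac)
  qed
  have g_int: "integrable lborel (g j)" for j
    unfolding g_def using assms by (intro integrable_mult_right integrable_hankel_integrand) auto
  have h_int: "integrable lborel h"
    unfolding h_def using assms by (intro integrable_hankel_integrand) auto
  have norm_g: "norm (g j t) \<le> norm (h t) * ((\<bar>\<beta>\<bar> / y) ^ j /\<^sub>R fact j)" for j t
  proof -
    have "y \<le> norm (Complex y t)" using complex_Re_le_cmod[of "Complex y t"] by simp
    hence "\<bar>\<beta>\<bar> / norm (Complex y t) \<le> \<bar>\<beta>\<bar> / y"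
      using assms y[of t] by (intro divide_left_mono mult_pos_pos) auto
    hence "(\<bar>\<beta>\<bar> / norm (Complex y t)) ^ j \<le> (\<bar>\<beta>\<bar> / y) ^ j" by (intro power_mono) auto
    thus ?thesis unfolding g_eq
      by (simp add: norm_mult norm_divide norm_power mult_left_mono divide_right_mono)
  qed
  have summ: "summable (\<lambda>j. (\<bar>\<beta>\<bar> / y) ^ j /\<^sub>R fact j)"
    by (rule sums_summable[OF exp_converges])
  have "summable (\<lambda>j. norm (g j t))" for t
    by (rule summable_comparison_test'[OF summable_mult[OF summ, of "norm (h t)"]]) (use norm_g in auto)
  hence AE: "AE t in lborel. summable (\<lambda>j. norm (g j t))" by simp
  have summ_int: "summable (\<lambda>j. LINT t|lborel. norm (g j t))"
  proof (rule summable_comparison_test')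
    show "summable (\<lambda>j. (LINT t|lborel. norm (h t)) * ((\<bar>\<beta>\<bar> / y) ^ j /\<^sub>R fact j))"
      by (intro summable_mult summ)
    fix j :: nat
    have "(LINT t|lborel. norm (g j t)) \<le> (LINT t|lborel. norm (h t) * ((\<bar>\<beta>\<bar> / y) ^ j /\<^sub>R fact j))"
      using g_int h_int norm_g by (intro integral_mono integrable_norm integrable_mult_left) auto
    thus "norm (LINT t|lborel. norm (g j t)) \<le> (LINT t|lborel. norm (h t)) * ((\<bar>\<beta>\<bar> / y) ^ j /\<^sub>R fact j)"
      by simp
  qed
  have "(\<lambda>t. \<Sum>j. g j t) = (\<lambda>t. G (Complex y t))"
    by (intro ext sums_unique [symmetric] G_sums)
  moreover have "integrable lborel (\<lambda>t. \<Sum>j. g j t)" by (rule integrable_suminf) (use g_int AE summ_int in auto)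
  ultimately show "integrable lborel (\<lambda>t. Complex y t powr (-5/2) * exp (of_real \<alpha> * Complex y t + of_real \<beta> / Complex y t))"
    by (simp add: G_def)
  have val: "(LINT t|lborel. g j t) =
          of_real (\<beta> ^ j / fact j * (2 * pi * \<alpha> powr (real j + 3/2) / Gamma (real j + 5/2)))" for j
    unfolding g_def using hankel_integral[of "real j + 5/2" \<alpha> y] assms by (simp add: algebra_simps)
  have "(\<lambda>j. LINT t|lborel. g j t) sums (LINT t|lborel. (\<Sum>j. g j t))"
    by (rule sums_integral) (use g_int AE summ_int in auto)
  hence "(\<lambda>j. complex_of_real (\<beta> ^ j / fact j * (2 * pi * \<alpha> powr (real j + 3/2) / Gamma (real j + 5/2)))) sums
           (LINT t|lborel. G (Complex y t))"
    unfolding val \<open>(\<lambda>t. \<Sum>j. g j t) = (\<lambda>t. G (Complex y t))\<close> .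
  note sums = this
  have *: "(\<lambda>j. \<beta> ^ j / fact j * (2 * pi * \<alpha> powr (real j + 3/2) / Gamma (real j + 5/2))) sums
           Re (LINT t|lborel. G (Complex y t))"
    using sums_Re[OF sums] by (simp only: Re_complex_of_real)
  have "(\<lambda>j. 0) sums Im (LINT t|lborel. G (Complex y t))"
    using sums_Im[OF sums] by (simp only: Im_complex_of_real)
  hence Im0: "Im (LINT t|lborel. G (Complex y t)) = 0"
    using sums_zero sums_unique2 by blast
  show "summable (\<lambda>j. \<beta> ^ j / fact j * (2 * pi * \<alpha> powr (real j + 3/2) / Gamma (real j + 5/2)))"
    using * by (rule sums_summable)
  show "(LINT t|lborel. Complex y t powr (-5/2) * exp (of_real \<alpha> * Complex y t + of_real \<beta> / Complex y t)) =
           of_real (\<Sum>j. \<beta> ^ j / fact j * (2 * pi * \<alpha> powr (real j + 3/2) / Gamma (real j + 5/2)))"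
    using sums_unique[OF *] Im0 by (simp add: G_def complex_eq_iff)
qed

section \<open>Unfolding the Poincare series\<close>

lemma Gamma_plus1_real_pos:
  assumes "x > (0 :: real)"
  shows "Gamma (x + 1) = x * Gamma x"
  by (rule Gamma_plus1) (use assms in \<open>auto elim!: nonpos_Ints_cases\<close>)

text \<open>On both sides the ratio of consecutive terms is pi^2 nu / (6 c^2 (j + 1) (j + 5 / 2)),
  so only j = 0 has to be compared, where Gamma (5 / 2) = 3 / 4 * sqrt pi. This is the elementary
  form of the Bessel function of order 3 / 2, for \<alpha> = pi / 12 and \<beta> = 2 pi nu /
  c^2.\<close>

lemma bessel_coeff_eq:
  assumes c: "c > 0"
  shows "c powr (- 5 / 2) * ((2 * pi * \<nu> / c ^ 2) ^ j / fact j * (2 * pi * (pi / 12) powr (real j + 3 / 2) / Gamma (real j + 5 / 2))) =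
           sqrt c / (pi * sqrt 2) * (real (Suc j) * (pi * sqrt (2 / 3) / c) ^ (2 * j + 3) / fact (2 * j + 3) * \<nu> ^ j)"
proof (induction j)
  case 0
  have G52: "Gamma (5 / 2 :: real) = 3 / 4 * sqrt pi"
    using Gamma_plus1_real_pos[of "3 / 2"] Gamma_plus1_real_pos[of "1 / 2"] Gamma_one_half_real
    by simp
  have P32: "(pi / 12) powr (3 / 2) = pi / 12 * (sqrt pi / (2 * sqrt 3))"
  proof -
    have "(pi / 12) powr (3 / 2) = (pi / 12) powr (1 + 1 / 2)" by simp
    also have "\<dots> = pi / 12 * sqrt (pi / 12)" unfolding powr_add by (simp add: powr_half_sqrt)
    also have "sqrt (pi / 12) = sqrt pi / (2 * sqrt 3)"
      using real_sqrt_mult[of 4 3] by (simp add: real_sqrt_divide)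
    finally show ?thesis .
  qed
  have C52: "c powr (- 5 / 2) = sqrt c / c ^ 3"
  proof -
    have "c powr (- 5 / 2) = c powr (1 / 2 - 3)" by simp
    also have "\<dots> = sqrt c / c ^ 3" unfolding powr_diff using c by (simp add: powr_half_sqrt)
    finally show ?thesis .
  qed
  have X3: "(pi * sqrt (2 / 3) / c) ^ 3 = pi ^ 3 * (2 / 3 * (sqrt 2 / sqrt 3)) / c ^ 3"
  proof -
    have "sqrt x ^ 3 = x * sqrt x" if "x \<ge> 0" for x
      using that by (simp add: power3_eq_cube)
    from this[of "2 / 3"] have "sqrt (2 / 3) ^ 3 = 2 / 3 * (sqrt 2 / sqrt 3)"
      by (simp only: real_sqrt_divide)
    thus ?thesis by (simp only: power_mult_distrib power_divide)
  qed
  have "c powr (- 5 / 2) * ((2 * pi * \<nu> / c ^ 2) ^ 0 / fact 0 * (2 * pi * (pi / 12) powr (real 0 + 3 / 2) / Gamma (real 0 + 5 / 2))) =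
          sqrt c / c ^ 3 * (2 * pi * (pi / 12 * (sqrt pi / (2 * sqrt 3))) / (3 / 4 * sqrt pi))"
    by (simp only: power_0 fact_0 of_nat_0 add_0 div_by_1 mult_1_left G52 P32 C52)
  also have "\<dots> = sqrt c / c ^ 3 * (pi ^ 2 / (9 * sqrt 3))"
    by (simp add: power2_eq_square)
  also have "\<dots> = sqrt c / (pi * sqrt 2) * (pi ^ 3 * (2 / 3 * (sqrt 2 / sqrt 3)) / c ^ 3 / 6)"
    using c by (simp add: power2_eq_square power3_eq_cube)
  also have "\<dots> = sqrt c / (pi * sqrt 2) * (real (Suc 0) * (pi * sqrt (2 / 3) / c) ^ (2 * 0 + 3) / fact (2 * 0 + 3) * \<nu> ^ 0)"
  proof -
    have "fact 3 = (6 :: real)" by (simp add: fact_numeral)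
    thus ?thesis
      by (simp only: X3 power_0 mult_0_right add_0 of_nat_Suc of_nat_0 add_0_right mult_1_left mult_1_right)
  qed
  finally show ?case .
next
  case (Suc j)
  define L where "L = (\<lambda>j. c powr (- 5 / 2) * ((2 * pi * \<nu> / c ^ 2) ^ j / fact j * (2 * pi * (pi / 12) powr (real j + 3 / 2) / Gamma (real j + 5 / 2))))"
  define R where "R = (\<lambda>j. sqrt c / (pi * sqrt 2) * (real (Suc j) * (pi * sqrt (2 / 3) / c) ^ (2 * j + 3) / fact (2 * j + 3) * \<nu> ^ j))"
  have G: "Gamma (real (Suc j) + 5 / 2) = (real j + 5 / 2) * Gamma (real j + 5 / 2)"
    using Gamma_plus1_real_pos[of "real j + 5 / 2"] by (simp add: add_ac)
  have P: "(pi / 12) powr (real (Suc j) + 3 / 2) = pi / 12 * (pi / 12) powr (real j + 3 / 2)"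
    using powr_add[of "pi / 12" 1 "real j + 3 / 2"] by (simp add: add_ac)
  have "L (Suc j) = L j * (pi ^ 2 * \<nu> / (6 * c ^ 2) / ((real j + 1) * (real j + 5 / 2)))"
    unfolding L_def G P by (simp add: field_simps power2_eq_square del: of_nat_Suc) (simp add: field_simps)
  moreover have "R (Suc j) = R j * (pi ^ 2 * \<nu> / (6 * c ^ 2) / ((real j + 1) * (real j + 5 / 2)))"
  proof -
    have "2 * Suc j + 3 = Suc (Suc (2 * j + 3))" by simp
    hence "fact (2 * Suc j + 3) = real (Suc (Suc (2 * j + 3))) * (real (Suc (2 * j + 3)) * fact (2 * j + 3))"
      by (simp only: fact_Suc)
    moreover have "real (Suc (Suc (2 * j + 3))) = 2 * real j + 5" "real (Suc (2 * j + 3)) = 2 * real j + 4"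
      by simp_all
    ultimately have F: "fact (2 * Suc j + 3) = (2 * real j + 5) * ((2 * real j + 4) * fact (2 * j + 3))"
      by (simp only:)
    have "2 * Suc j + 3 = (2 * j + 3) + 2" by simp
    hence X: "(pi * sqrt (2 / 3) / c) ^ (2 * Suc j + 3) = (pi * sqrt (2 / 3) / c) ^ (2 * j + 3) * (pi ^ 2 * (2 / 3) / c ^ 2)"
      by (simp only: power_add) (simp add: power_mult_distrib power_divide)
    have r: "(real j + 2) * (pi ^ 2 * (2 / 3) / c ^ 2) / ((2 * real j + 5) * (2 * real j + 4)) =
               pi ^ 2 / (6 * c ^ 2) / (real j + 5 / 2)"
      using c by (simp add: divide_simps) (simp add: algebra_simps)
    have "R (Suc j) = sqrt c / (pi * sqrt 2) * ((pi * sqrt (2 / 3) / c) ^ (2 * j + 3) / fact (2 * j + 3) * \<nu> ^ j) * \<nu> *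
            ((real j + 2) * (pi ^ 2 * (2 / 3) / c ^ 2) / ((2 * real j + 5) * (2 * real j + 4)))"
      unfolding R_def F X by (simp add: mult_ac add_ac)
    also have "\<dots> = R j * (pi ^ 2 * \<nu> / (6 * c ^ 2) / ((real j + 1) * (real j + 5 / 2)))"
      unfolding r R_def by (simp add: add_ac mult_ac)
    finally show ?thesis .
  qed
  moreover have "L j = R j" unfolding L_def R_def by (rule Suc)
  ultimately have "L (Suc j) = R (Suc j)" by (simp only:)
  thus ?case unfolding L_def R_def .
qed

text \<open>sinh (x sqrt u) / sqrt u is an everywhere convergent power series in u with coefficients
  x^(2k+1) / (2k+1)!, and it can be differentiated termwise at u = t - a.\<close>

lemma deriv_sinh_sqrt:
  assumes less: "t > a"
  shows "(\<lambda>j. real (Suc j) * x ^ (2 * j + 3) / fact (2 * j + 3) * (t - a) ^ j) sums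
           deriv (\<lambda>s. sinh (x * sqrt (s - a)) / sqrt (s - a)) t"
proof -
  define A where "A = (\<lambda>k. x ^ (2 * k + 1) / fact (2 * k + 1))"
  have sinh_sums: "(\<lambda>k. (x * u) ^ (2 * k + 1) / fact (2 * k + 1)) sums sinh (x * u)" for u :: real
  proof -
    have "strict_mono (\<lambda>k::nat. 2 * k + 1)" by (simp add: strict_mono_def)
    moreover have "(if even n then 0 else (x * u) ^ n /\<^sub>R fact n) = 0" if "n \<notin> range (\<lambda>k. 2 * k + 1)" for n
      using that by (auto elim!: oddE)
    ultimately have "(\<lambda>k. if even (2 * k + 1) then 0 else (x * u) ^ (2 * k + 1) /\<^sub>R fact (2 * k + 1)) sums sinh (x * u)"
      using sums_mono_reindex[of "\<lambda>k. 2 * k + 1" "\<lambda>n. if even n then 0 else (x * u) ^ n /\<^sub>R fact n" "sinh (x * u)"]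
        sinh_converges[of "x * u"] by blast
    moreover have "(if even (2 * k + 1) then 0 else (x * u) ^ (2 * k + 1) /\<^sub>R fact (2 * k + 1)) =
                     (x * u) ^ (2 * k + 1) / fact (2 * k + 1)" for k
      by (simp add: divide_inverse)
    ultimately show ?thesis by (simp only:)
  qed
  have eq: "(x * u) ^ (2 * k + 1) / fact (2 * k + 1) = u * (A k * (u ^ 2) ^ k)" for u k
    by (simp add: A_def power_mult_distrib power_mult)
  have A_sums: "(\<lambda>k. A k * (u ^ 2) ^ k) sums (sinh (x * u) / u)" if "u > 0" for u
    using sums_divide[OF sinh_sums[of u], of u] that unfolding eq by simp
  have conv: "summable (\<lambda>k. A k * s ^ k)" for s
  proof (rule summable_comparison_test'[where N = 0])
    show "summable (\<lambda>k. \<bar>x\<bar> * ((x ^ 2 * \<bar>s\<bar>) ^ k /\<^sub>R fact k))"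
      by (intro summable_mult sums_summable[OF exp_converges])
    fix k :: nat
    have "fact k \<le> (fact (2 * k + 1) :: real)" by (intro fact_mono) auto
    hence "\<bar>x\<bar> ^ (2 * k + 1) * \<bar>s\<bar> ^ k / fact (2 * k + 1) \<le> \<bar>x\<bar> ^ (2 * k + 1) * \<bar>s\<bar> ^ k / fact k"
      by (intro divide_left_mono) auto
    moreover have "norm (A k * s ^ k) = \<bar>x\<bar> ^ (2 * k + 1) * \<bar>s\<bar> ^ k / fact (2 * k + 1)"
      by (simp add: A_def abs_mult power_abs)
    moreover have "(x ^ 2 * \<bar>s\<bar>) ^ k = \<bar>x\<bar> ^ (2 * k) * \<bar>s\<bar> ^ k"
      by (simp only: power_mult_distrib power_mult power2_abs)
    hence "\<bar>x\<bar> * ((x ^ 2 * \<bar>s\<bar>) ^ k /\<^sub>R fact k) = \<bar>x\<bar> ^ (2 * k + 1) * \<bar>s\<bar> ^ k / fact k"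
      by (simp only: power_add power_one_right real_scaleR_def divide_inverse mult_ac)
    ultimately show "norm (A k * s ^ k) \<le> \<bar>x\<bar> * ((x ^ 2 * \<bar>s\<bar>) ^ k /\<^sub>R fact k)" by simp
  qed
  have "((\<lambda>s. \<Sum>k. A k * s ^ k) has_field_derivative (\<Sum>k. diffs A k * (t - a) ^ k)) (at (t - a))"
    by (rule termdiffs_strong_converges_everywhere[OF conv])
  hence "((\<lambda>s. \<Sum>k. A k * (s - a) ^ k) has_field_derivative (\<Sum>k. diffs A k * (t - a) ^ k) * 1) (at t)"
    by (rule DERIV_chain2[where g = "\<lambda>s. s - a"]) (auto intro!: derivative_eq_intros)
  hence "((\<lambda>s. sinh (x * sqrt (s - a)) / sqrt (s - a)) has_field_derivative (\<Sum>k. diffs A k * (t - a) ^ k) * 1) (at t)"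
  proof (rule has_field_derivative_transform_within_open[of _ _ _ "{a<..}"])
    fix s assume "s \<in> {a<..}"
    hence s: "s > a" by simp
    from sums_unique[OF A_sums[of "sqrt (s - a)"]] s
    show "(\<Sum>k. A k * (s - a) ^ k) = sinh (x * sqrt (s - a)) / sqrt (s - a)" by simp
  qed (use less in auto)
  hence d: "deriv (\<lambda>s. sinh (x * sqrt (s - a)) / sqrt (s - a)) t = (\<Sum>k. diffs A k * (t - a) ^ k)"
    by (simp add: DERIV_imp_deriv)
  have "summable (\<lambda>k. diffs A k * (t - a) ^ k)"
    by (rule termdiff_converges_all) (rule conv)
  hence "(\<lambda>k. diffs A k * (t - a) ^ k) sums (\<Sum>k. diffs A k * (t - a) ^ k)" by (rule summable_sums)
  moreover have "diffs A k = real (Suc k) * x ^ (2 * k + 3) / fact (2 * k + 3)" for k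
    by (simp add: diffs_def A_def eval_nat_numeral)
  ultimately show ?thesis by (simp only: d)
qed

section \<open>From a single Poincare term to the Kloosterman summand\<close>

text \<open>Names the very choice made inside \<open>kloosterman_sum\<close>, so that the summands
  below agree with that definition literally.\<close>

definition kloosterman_matrix :: "int \<Rightarrow> int \<Rightarrow> int ^ 2 ^ 2"
  where "kloosterman_matrix c d = (SOME M. M \<in> SL2Z \<and> M $ 2 $ 1 = c \<and> M $ 2 $ 2 = d)"

lemma kloosterman_matrix:
  assumes "coprime c d"
  shows "kloosterman_matrix c d \<in> SL2Z" "kloosterman_matrix c d $ 2 $ 1 = c" "kloosterman_matrix c d $ 2 $ 2 = d"
proof -
  obtain a b where det: "a * d - b * c = 1"
    using coprime_pairs_bezout[of c d] assms by (auto simp: coprime_pairs_def)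
  define M :: "int ^ 2 ^ 2" where "M = (\<chi> i j. if i = 1 then (if j = 1 then a else b) else (if j = 1 then c else d))"
  have "M \<in> SL2Z \<and> M $ 2 $ 1 = c \<and> M $ 2 $ 2 = d"
    using det by (simp add: SL2Z_def det_2 M_def)
  from someI[of "\<lambda>M. M \<in> SL2Z \<and> M $ 2 $ 1 = c \<and> M $ 2 $ 2 = d", OF this]
  show "kloosterman_matrix c d \<in> SL2Z" "kloosterman_matrix c d $ 2 $ 1 = c" "kloosterman_matrix c d $ 2 $ 2 = d"
    by (auto simp: kloosterman_matrix_def)
qed

text \<open>Removes the factor 1 / prod(1 - q^m) at tau that 1 / eta(tau) contributes to every term;
  for c > 0 an elementary function remains.\<close>

definition poincare_phi :: "nat \<Rightarrow> int \<times> int \<Rightarrow> complex \<Rightarrow> complex"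
  where "poincare_phi n p \<tau> = poincare_term n p \<tau> * euler_prod (q_power 1 \<tau>)"

text \<open>The multiplier occurs to the first power because - 24 m = 1 for m = - 1 / 24.\<close>

definition kloosterman_summand :: "nat \<Rightarrow> int \<Rightarrow> int \<Rightarrow> complex"
  where "kloosterman_summand n c d = eta_multiplier (kloosterman_matrix c d) *
    exp (2 * of_real pi * \<i> * of_real ((- 1 / 24 * of_int (kloosterman_matrix c d $ 1 $ 1) + (real n - 1 / 24) * of_int d) / of_int c))"

text \<open>The logarithm pi i / 2 - ln c - Ln s has imaginary part between 0 and pi when Re s > 0,
  so the square root splits without a jump of branch. This produces exp(pi i / 4).\<close>

lemma csqrt_ii_divide:
  assumes "Re s > 0" "c > 0"
  shows "csqrt (\<i> / (of_real c * s)) = exp (\<i> * of_real pi / 4) * of_real (c powr (- 1 / 2)) * s powr (- 1 / 2)"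
proof -
  have s: "s \<noteq> 0" using assms by auto
  define w where "w = \<i> * of_real (pi / 2) - of_real (ln c) - Ln s"
  have "\<bar>Im (Ln s)\<bar> < pi / 2" using assms(1) by (rule Re_Ln_pos_lt_imp)
  hence im: "- pi < Im w" "Im w \<le> pi" by (auto simp: w_def)
  have "exp (\<i> * of_real (pi / 2)) = \<i>"
    unfolding cis_conv_exp [symmetric] by simp
  hence e: "exp w = \<i> / (of_real c * s)"
    using s assms(2) by (simp add: w_def exp_diff exp_of_real)
  have "csqrt (\<i> / (of_real c * s)) = exp (Ln (exp w) / 2)"
    unfolding e using s assms(2) by (intro csqrt_exp_Ln) auto
  also have "Ln (exp w) = w" using im by (rule Ln_exp)
  also have "w / 2 = \<i> * of_real pi / 4 + of_real (- 1 / 2 * ln c) + (- 1 / 2) * Ln s"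
    by (simp add: w_def field_simps)
  also have "exp \<dots> = exp (\<i> * of_real pi / 4) * exp (of_real (- 1 / 2 * ln c)) * exp ((- 1 / 2) * Ln s)"
    by (simp only: exp_add)
  also have "exp (of_real (- 1 / 2 * ln c)) = complex_of_real (c powr (- 1 / 2))"
    using assms(2) by (simp only: exp_of_real powr_def) simp
  also have "exp ((- 1 / 2) * Ln s) = s powr (- 1 / 2)"
    using s by (simp add: powr_def)
  finally show ?thesis .
qed

text \<open>The matrix with rows (- d, b) and (c, - a) is - M^(-1) and acts as M^(-1). With z =
  M^(-1) tau one has eta tau = eta (M z), so dividing by eta z leaves the multiplier of M itself, as
  the Kloosterman sum requires. The substitution c tau - a = i c s turns the horizontal line into Re
  s = y.\<close>

lemma poincare_phi_eq:
  fixes c d a :: int and M :: "int ^ 2 ^ 2" and x y :: real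
  assumes cd: "coprime c d" "c > 0" and y: "y > 0"
  defines "M \<equiv> kloosterman_matrix c d"
  defines "a \<equiv> M $ 1 $ 1"
  defines "s \<equiv> Complex y (of_int a / of_int c - x)"
  shows "poincare_phi n (c, - a) (Complex x y) =
           - (exp (of_real pi * \<i> / 4) * kloosterman_summand n c d * of_real (of_int c powr (- 5 / 2))) *
           (s powr (- 5 / 2) * exp (of_real (pi / 12) * s + of_real (2 * pi * (real n - 1 / 24) / of_int c ^ 2) / s))"
proof -
  define b where "b = M $ 1 $ 2"
  define \<nu> where "\<nu> = real n - 1 / 24"
  define C where "C = complex_of_int c"
  have M: "M \<in> SL2Z" "M $ 2 $ 1 = c" "M $ 2 $ 2 = d"
    using kloosterman_matrix[OF cd(1)] by (simp_all add: M_def)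
  have det: "a * d - b * c = 1"
    using M by (simp add: SL2Z_def det_2 a_def b_def)
  hence det': "(- d) * (- a) - b * c = 1" by (simp add: algebra_simps)
  define \<tau> where "\<tau> = Complex x y"
  have \<tau>: "Im \<tau> > 0" using y by (simp add: \<tau>_def)
  define W where "W = of_int c * \<tau> + of_int (- a)"
  define z where "z = (of_int (- d) * \<tau> + of_int b) / W"
  have C0: "C \<noteq> 0" using cd by (simp add: C_def)
  have W0: "W \<noteq> 0" unfolding W_def by (rule moebius_denom_nonzero[OF det' \<tau>])
  have z: "Im z > 0" unfolding z_def W_def by (rule Im_moebius_pos[OF det' \<tau>])
  have "Re s > 0" using y by (simp add: s_def)
  hence s: "Re s > 0" "s \<noteq> 0" by auto
  have W_s: "W = \<i> * C * s"
    using cd(2) by (simp add: W_def s_def C_def \<tau>_def complex_eq_iff field_simps)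
  have detC: "of_int a * of_int d - of_int b * C = (1 :: complex)"
    using det unfolding C_def by (metis of_int_1 of_int_diff of_int_mult)
  \<comment> \<open>The automorphy factor of M at z is inverse to that of M^(-1) at tau; the minus
    sign stems from using - M^(-1).\<close>
  have den: "C * z + of_int d = - 1 / W"
  proof -
    have "C * z + of_int d = (C * (of_int (- d) * \<tau> + of_int b) + of_int d * W) / W"
      using W0 by (simp add: z_def field_simps)
    also have "C * (of_int (- d) * \<tau> + of_int b) + of_int d * W = - (of_int a * of_int d - of_int b * C)"
      by (simp add: W_def C_def algebra_simps)
    finally show ?thesis by (simp add: detC)
  qed
  have "of_int a * z + of_int b = (of_int a * (of_int (- d) * \<tau> + of_int b) + of_int b * W) / W"
    using W0 by (simp add: z_def field_simps)
  also have "of_int a * (of_int (- d) * \<tau> + of_int b) + of_int b * W = - (of_int a * of_int d - of_int b * C) * \<tau>"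
    by (simp add: W_def C_def algebra_simps)
  finally have num: "of_int a * z + of_int b = - \<tau> / W" by (simp add: detC)
  have "moebius M z = (of_int a * z + of_int b) / (C * z + of_int d)"
    using M by (simp add: moebius_def a_def b_def C_def)
  also have "\<dots> = \<tau>" unfolding num den using W0 by simp
  finally have mz: "moebius M z = \<tau>" .
  have "M $ 2 $ 1 > 0" using M cd by simp
  from dedekind_eta_moebius_multiplier[OF M(1) this z]
  have eta: "dedekind_eta \<tau> = eta_multiplier M * csqrt (- 1 / W) * dedekind_eta z"
    unfolding mz M(2) M(3) C_def [symmetric] den .
  have E: "euler_prod (q_power 1 \<tau>) = dedekind_eta \<tau> * q_power (- (1 / 24)) \<tau>"
    by (simp add: dedekind_eta_eq q_power_minus)
  have "poincare_phi n (c, - a) \<tau> = q_power (- \<nu>) z * inverse (dedekind_eta z) / W ^ 2 * euler_prod (q_power 1 \<tau>)"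
    unfolding poincare_phi_def poincare_term_eq[OF det' \<tau>] seed_eq_eta by (simp add: W_def z_def \<nu>_def)
  also have "\<dots> = eta_multiplier M * (csqrt (- 1 / W) / W ^ 2) * (q_power (- \<nu>) z * q_power (- (1 / 24)) \<tau>)"
    unfolding E eta using dedekind_eta_nonzero[OF z] by simp
  \<comment> \<open>Both c and s collect - 1 / 2 from the root and - 2 from W^2 = - c^2 s^2, whose
    sign is the minus in the result.\<close>
  also have "csqrt (- 1 / W) / W ^ 2 = - (exp (of_real pi * \<i> / 4) * of_real (of_int c powr (- 5 / 2))) * s powr (- 5 / 2)"
  proof -
    have "- 1 / W = \<i> / (of_real (of_int c) * s)"
      using C0 s by (simp add: W_s C_def field_simps)
    hence "csqrt (- 1 / W) = exp (\<i> * of_real pi / 4) * of_real (of_int c powr (- 1 / 2)) * s powr (- 1 / 2)"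
      using csqrt_ii_divide[OF s(1), of "of_int c"] cd by simp
    moreover have "W ^ 2 = - (of_real (of_int c powr 2) * s powr 2)"
    proof -
      have "(of_int c :: real) powr 2 = of_int c ^ 2" using cd by simp
      hence "of_real (of_int c powr 2) = C ^ 2" by (simp add: C_def)
      moreover have "s powr 2 = s ^ 2" using s by (simp add: powr_nat')
      ultimately show ?thesis by (simp only: W_s power_mult_distrib) simp
    qed
    moreover have "of_int c powr (- 1 / 2) / of_int c powr 2 = (of_int c powr (- 5 / 2) :: real)"
      by (simp flip: powr_diff)
    hence "of_real (of_int c powr (- 1 / 2)) / of_real (of_int c powr 2) = complex_of_real (of_int c powr (- 5 / 2))"
      by (metis of_real_divide)
    moreover have "s powr (- 1 / 2) / s powr 2 = s powr (- 1 / 2 - 2)"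
      by (simp only: powr_diff)
    hence "s powr (- 1 / 2) / s powr 2 = s powr (- 5 / 2)" by simp
    moreover have "X * A * B / - (A' * B') = - (X * (A / A')) * (B / B')" for X A B A' B' :: complex
      by simp
    ultimately show ?thesis by (simp only: mult.commute[of \<i>])
  qed
  \<comment> \<open>From z = - d / c + i / (c^2 s) and tau = a / c + i s: the rational parts form
    the Kloosterman phase, the parts with s the exponent of the Bessel integral.\<close>
  also have "q_power (- \<nu>) z * q_power (- (1 / 24)) \<tau> =
      exp (2 * of_real pi * \<i> * of_real ((- 1 / 24 * of_int a + \<nu> * of_int d) / of_int c)) *
      exp (of_real (pi / 12) * s + of_real (2 * pi * \<nu> / of_int c ^ 2) / s)"
  proof -
    have z_eq: "z = - of_int d / C + \<i> / (C ^ 2 * s)"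
    proof -
      have iW: "- 1 / W = \<i> / (C * s)" using C0 s by (simp add: W_s field_simps)
      have "C * z = \<i> / (C * s) - of_int d" using den unfolding iW by (simp add: algebra_simps)
      moreover have "z = C * z / C" using C0 by simp
      ultimately have "z = (\<i> / (C * s) - of_int d) / C" by simp
      thus ?thesis by (simp add: diff_divide_distrib power2_eq_square mult_ac)
    qed
    have \<tau>_eq: "\<tau> = \<i> * s + of_int a / C"
      using W_s C0 by (simp add: W_def C_def field_simps)
    have "q_power (- \<nu>) z * q_power (- (1 / 24)) \<tau> =
            exp (2 * of_real pi * \<i> * of_real (- \<nu>) * z + 2 * of_real pi * \<i> * of_real (- (1 / 24)) * \<tau>)"
      by (simp only: q_power_def exp_add)
    also have "2 * of_real pi * \<i> * of_real (- \<nu>) * z + 2 * of_real pi * \<i> * of_real (- (1 / 24)) * \<tau> =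
        2 * of_real pi * \<i> * of_real ((- 1 / 24 * of_int a + \<nu> * of_int d) / of_int c) +
        (of_real (pi / 12) * s + of_real (2 * pi * \<nu> / of_int c ^ 2) / s)"
      unfolding z_eq \<tau>_eq using C0 s by (simp add: C_def field_simps power2_eq_square)
    finally show ?thesis by (simp only: exp_add)
  qed
  finally show ?thesis
    by (simp add: \<tau>_def kloosterman_summand_def M_def [symmetric] a_def \<nu>_def mult_ac)
qed

definition rademacher_deriv :: "nat \<Rightarrow> nat \<Rightarrow> real"
  where "rademacher_deriv n c = deriv (\<lambda>x. sinh (pi * sqrt (2 / 3) * sqrt (x - 1 / 24) / real c) / sqrt (x - 1 / 24)) (real n)"

lemma rademacher_term_eq:
  "1 / (of_real pi * of_real (sqrt 2)) * rademacher_term n c =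
     (\<Sum>d\<in>{d \<in> {0..<int c}. coprime (int c) d}.
        exp (of_real pi * \<i> / 4) * kloosterman_summand n (int c) d * of_real (sqrt (real c) / (pi * sqrt 2) * rademacher_deriv n c))"
proof -
  have "kloosterman_sum (- 1 / 24) (real n - 1 / 24) c =
          (\<Sum>d\<in>{d \<in> {0..<int c}. coprime (int c) d}. kloosterman_summand n (int c) d)"
    by (simp add: kloosterman_sum_def kloosterman_summand_def kloosterman_matrix_def Let_def)
  thus ?thesis
    by (simp add: rademacher_term_def rademacher_A_def rademacher_deriv_def sum_distrib_left sum_distrib_right mult_ac)
qed

lemma bessel_series_eq:
  assumes "n > 0" "c > 0" "S = (\<Sum>j. (2 * pi * (real n - 1 / 24) / real c ^ 2) ^ j / fact j *
      (2 * pi * (pi / 12) powr (real j + 3 / 2) / Gamma (real j + 5 / 2)))"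
    "summable (\<lambda>j. (2 * pi * (real n - 1 / 24) / real c ^ 2) ^ j / fact j *
      (2 * pi * (pi / 12) powr (real j + 3 / 2) / Gamma (real j + 5 / 2)))"
  shows "real c powr (- 5 / 2) * S = sqrt (real c) / (pi * sqrt 2) * rademacher_deriv n c"
proof -
  define x where "x = pi * sqrt (2 / 3) / real c"
  have "(\<lambda>s. sinh (pi * sqrt (2 / 3) * sqrt (s - 1 / 24) / real c) / sqrt (s - 1 / 24)) =
          (\<lambda>s. sinh (x * sqrt (s - 1 / 24)) / sqrt (s - 1 / 24))"
    by (simp add: x_def)
  moreover have "(\<lambda>j. real (Suc j) * x ^ (2 * j + 3) / fact (2 * j + 3) * (real n - 1 / 24) ^ j) sums
           deriv (\<lambda>s. sinh (x * sqrt (s - 1 / 24)) / sqrt (s - 1 / 24)) (real n)"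
    using assms(1) by (intro deriv_sinh_sqrt) linarith
  ultimately have "(\<lambda>j. real (Suc j) * x ^ (2 * j + 3) / fact (2 * j + 3) * (real n - 1 / 24) ^ j) sums rademacher_deriv n c"
    by (simp only: rademacher_deriv_def)
  hence "(\<lambda>j. sqrt (real c) / (pi * sqrt 2) * (real (Suc j) * x ^ (2 * j + 3) / fact (2 * j + 3) * (real n - 1 / 24) ^ j)) sums
           (sqrt (real c) / (pi * sqrt 2) * rademacher_deriv n c)"
    by (rule sums_mult)
  moreover have "(\<lambda>j. real c powr (- 5 / 2) * ((2 * pi * (real n - 1 / 24) / real c ^ 2) ^ j / fact j *
      (2 * pi * (pi / 12) powr (real j + 3 / 2) / Gamma (real j + 5 / 2)))) sums (real c powr (- 5 / 2) * S)"
    unfolding assms(3) by (intro sums_mult summable_sums assms(4))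
  moreover have "real c powr (- 5 / 2) * ((2 * pi * (real n - 1 / 24) / real c ^ 2) ^ j / fact j *
      (2 * pi * (pi / 12) powr (real j + 3 / 2) / Gamma (real j + 5 / 2))) =
      sqrt (real c) / (pi * sqrt 2) * (real (Suc j) * x ^ (2 * j + 3) / fact (2 * j + 3) * (real n - 1 / 24) ^ j)" for j
    unfolding x_def by (rule bessel_coeff_eq) (use assms(2) in simp)
  ultimately show ?thesis by (simp only: sums_unique2)
qed

text \<open>The real line is reflected and shifted by a / c, which does not change the Lebesgue
  integral. The value is free of y; the final limit depends on that.\<close>

lemma poincare_phi_line_integral:
  fixes d :: int
  assumes n: "n > 0" and cd: "coprime (int c) d" "c > 0" and y: "y > 0"
  defines "a \<equiv> kloosterman_matrix (int c) d $ 1 $ 1"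
  shows "integrable lborel (\<lambda>x. poincare_phi n (int c, - a) (Complex x y))"
    and "(LINT x|lborel. poincare_phi n (int c, - a) (Complex x y)) =
           - (exp (of_real pi * \<i> / 4) * kloosterman_summand n (int c) d *
              of_real (sqrt (real c) / (pi * sqrt 2) * rademacher_deriv n c))"
proof -
  define f where "f = (\<lambda>t. Complex y t powr (-5/2) *
    exp (of_real (pi / 12) * Complex y t + of_real (2 * pi * (real n - 1 / 24) / real c ^ 2) / Complex y t))"
  define K where "K = - (exp (of_real pi * \<i> / 4) * kloosterman_summand n (int c) d * of_real (real c powr (- 5 / 2)))"
  define t where "t = of_int a / real c"
  have eq: "poincare_phi n (int c, - a) (Complex x y) = K * f (t + (-1) * x)" for x
    using poincare_phi_eq[OF cd(1) _ y, of n x] cd(2) by (simp add: K_def f_def t_def a_def)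
  note bessel = bessel_integral[of "pi / 12" y "2 * pi * (real n - 1 / 24) / real c ^ 2", folded f_def]
  have int_f: "integrable lborel f" using bessel(1) y by simp
  show "integrable lborel (\<lambda>x. poincare_phi n (int c, - a) (Complex x y))"
    unfolding eq by (intro integrable_mult_right lborel_integrable_real_affine int_f) simp
  define S where "S = (\<Sum>j. (2 * pi * (real n - 1 / 24) / real c ^ 2) ^ j / fact j *
      (2 * pi * (pi / 12) powr (real j + 3 / 2) / Gamma (real j + 5 / 2)))"
  have "(LINT x|lborel. poincare_phi n (int c, - a) (Complex x y)) = K * (LINT x|lborel. f (t + (-1) * x))"
    unfolding eq by (rule integral_mult_right_zero)
  also have "(LINT x|lborel. f (t + (-1) * x)) = (LINT x|lborel. f x)"
    using lborel_integral_real_affine[of "-1" f t] by simp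
  also have "\<dots> = of_real S" using bessel(3) y by (simp add: S_def)
  also have "K * of_real S = - (exp (of_real pi * \<i> / 4) * kloosterman_summand n (int c) d *
              of_real (real c powr (- 5 / 2) * S))"
    by (simp add: K_def)
  also have "real c powr (- 5 / 2) * S = sqrt (real c) / (pi * sqrt 2) * rademacher_deriv n c"
    by (rule bessel_series_eq[OF n cd(2) S_def]) (use bessel(2) y in simp)
  finally show "(LINT x|lborel. poincare_phi n (int c, - a) (Complex x y)) =
           - (exp (of_real pi * \<i> / 4) * kloosterman_summand n (int c) d *
              of_real (sqrt (real c) / (pi * sqrt 2) * rademacher_deriv n c))" .
qed

lemma poincare_phi_add_int:
  assumes "(c, d) \<in> coprime_pairs" "Im \<tau> > 0"
  shows "poincare_phi n (c, d) (\<tau> + of_int k) = poincare_phi n (c, c * k + d) \<tau>"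
  by (simp add: poincare_phi_def poincare_term_add_int[OF assms] q_power_1_add_int)

lemma holomorphic_poincare_phi:
  assumes "p \<in> coprime_pairs"
  shows "poincare_phi n p holomorphic_on {\<tau>. Im \<tau> > 0}"
proof -
  have "(euler_prod \<circ> q_power 1) holomorphic_on {\<tau>. Im \<tau> > 0}"
    by (rule holomorphic_on_compose_gen[OF holomorphic_q_power holomorphic_euler_prod])
       (use q_power_1_in_ball in auto)
  thus ?thesis unfolding poincare_phi_def [abs_def]
    by (intro holomorphic_intros holomorphic_poincare_term assms) (auto simp: o_def)
qed

lemma continuous_on_poincare_phi:
  assumes "p \<in> coprime_pairs" "y > 0"
  shows "continuous_on A (\<lambda>x. poincare_phi n p (Complex x y))"
proof (rule continuous_on_compose2[OF holomorphic_on_imp_continuous_on[OF holomorphic_poincare_phi[OF assms(1)]]])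
  show "continuous_on A (\<lambda>x. Complex x y)" unfolding Complex_eq by (intro continuous_intros)
qed (use assms in auto)

section \<open>Sorting the lower rows by residues and unfolding\<close>

text \<open>Here c = k + 1 and d is the summation variable of the Kloosterman sum. The second entry
  runs through the class of - a modulo c as l varies, and these translates are what unfolds a unit
  segment to the whole line.\<close>

definition kloosterman_index :: "nat \<times> int \<times> int \<Rightarrow> int \<times> int"
  where "kloosterman_index = (\<lambda>(k, d, l). (int (Suc k), int (Suc k) * l + - (kloosterman_matrix (int (Suc k)) d $ 1 $ 1)))"

lemma kloosterman_matrix_inverse:
  assumes "coprime c d"
  obtains b where "(kloosterman_matrix c d $ 1 $ 1) * d - b * c = 1"
proof -
  define M where "M = kloosterman_matrix c d"
  have "M \<in> SL2Z" "M $ 2 $ 1 = c" "M $ 2 $ 2 = d"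
    using kloosterman_matrix[OF assms] by (simp_all add: M_def)
  hence "M $ 1 $ 1 * d - M $ 1 $ 2 * c = 1" by (simp add: SL2Z_def det_2)
  thus ?thesis using that by (simp add: M_def)
qed

text \<open>
  Modulo \<open>c\<close> the upper left entry is the inverse of \<open>d\<close>, so \<open>- a\<close> runs through the
  residues coprime to \<open>c\<close> as \<open>d\<close> does.
\<close>
lemma bij_betw_kloosterman_index:
  "bij_betw kloosterman_index
     (SIGMA k:UNIV. {d \<in> {0..<int (Suc k)}. coprime (int (Suc k)) d} \<times> UNIV)
     {p \<in> coprime_pairs. fst p > 0}"
proof (rule bij_betw_imageI)
  define A where "A = (SIGMA k:UNIV. {d \<in> {0..<int (Suc k)}. coprime (int (Suc k)) d} \<times> (UNIV :: int set))"
  have "p = p'" if "p \<in> A" "p' \<in> A" "kloosterman_index p = kloosterman_index p'" for p p'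
  proof -
    obtain k d l where p: "p = (k, d, l)" by (cases p)
    obtain k' d' l' where p': "p' = (k', d', l')" by (cases p')
    define c where "c = int (Suc k)"
    have k: "k' = k" using that(3) by (simp add: kloosterman_index_def p p')
    have cd: "coprime c d" "0 \<le> d" "d < c" "coprime c d'" "0 \<le> d'" "d' < c"
      using that(1,2) by (auto simp: A_def p p' k c_def)
    define a a' where "a = kloosterman_matrix c d $ 1 $ 1" and "a' = kloosterman_matrix c d' $ 1 $ 1"
    obtain b where b: "a * d - b * c = 1"
      using kloosterman_matrix_inverse[OF cd(1)] unfolding a_def by blast
    obtain b' where b': "a' * d' - b' * c = 1"
      using kloosterman_matrix_inverse[OF cd(4)] unfolding a'_def by blast
    have eq: "c * l + - a = c * l' + - a'"
      using that(3) by (simp add: kloosterman_index_def p p' k c_def a_def a'_def)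
    \<comment> \<open>Equal indices give a = a' modulo c, and d, d' are the inverses of a, a' modulo
      c; the cofactor is the explicit quotient.\<close>
    have "d - d' = c * (d' * b - d * b' - d * d' * (l - l'))"
      using b b' eq by algebra
    hence "c dvd (d - d')" by simp
    hence dd: "d = d'"
      using cd by (metis mod_eq_dvd_iff mod_pos_pos_trivial)
    hence "c * l = c * l'" using eq by (simp add: a_def a'_def)
    thus ?thesis using k dd by (simp add: p p' c_def)
  qed
  thus "inj_on kloosterman_index A" by (auto intro!: inj_onI)
  show "kloosterman_index ` A = {p \<in> coprime_pairs. fst p > 0}"
  proof (intro equalityI subsetI)
    fix q assume "q \<in> kloosterman_index ` A"
    then obtain k d l where q: "q = kloosterman_index (k, d, l)" "(k, d, l) \<in> A" by auto
    define c where "c = int (Suc k)"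
    have "coprime c d" using q(2) by (auto simp: A_def c_def)
    then obtain b where b: "(kloosterman_matrix c d $ 1 $ 1) * d - b * c = 1"
      using kloosterman_matrix_inverse by blast
    define a where "a = kloosterman_matrix c d $ 1 $ 1"
    have "(- d) * (c * l + - a) - (b - d * l) * c = 1"
      using b unfolding a_def [symmetric] by algebra
    hence "(c, c * l + - a) \<in> coprime_pairs" by (rule coprime_pairsI)
    thus "q \<in> {p \<in> coprime_pairs. fst p > 0}"
      by (simp add: q(1) kloosterman_index_def a_def c_def)
  next
    fix q assume q: "q \<in> {p \<in> coprime_pairs. fst p > 0}"
    obtain c e where ce: "q = (c, e)" by (cases q)
    have c: "c > 0" "(c, e) \<in> coprime_pairs" using q ce by auto
    obtain v u where uv: "v * e - u * c = 1" using coprime_pairs_bezout[OF c(2)] by blast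
    \<comment> \<open>- e has to be an inverse of d modulo c, and v is an inverse of e.\<close>
    define d where "d = (- v) mod c"
    define k where "k = nat (c - 1)"
    have ck: "c = int (Suc k)" using c by (simp add: k_def)
    define w where "w = (- v) div c"
    have d: "- v = c * w + d" by (simp add: d_def w_def)
    have d_range: "0 \<le> d" "d < c" using c by (simp_all add: d_def)
    have "(- e) * d - (u + e * w) * c = 1" using uv d by algebra
    hence "(c, d) \<in> coprime_pairs" by (rule coprime_pairsI)
    hence cop: "coprime c d" by (simp add: coprime_pairs_def)
    obtain b where b: "(kloosterman_matrix c d $ 1 $ 1) * d - b * c = 1"
      using kloosterman_matrix_inverse[OF cop] by blast
    define a where "a = kloosterman_matrix c d $ 1 $ 1"
    have b': "a * d - b * c = 1" using b by (simp add: a_def)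
    \<comment> \<open>Adding e times the relation \<open>b'\<close> and a times the relation for - e
      cancels a d e and exhibits e + a as c times this number.\<close>
    define l where "l = - e * b - a * (u + e * w)"
    have "e = c * l + - a"
      using b' \<open>(- e) * d - (u + e * w) * c = 1\<close> unfolding l_def by algebra
    hence "q = kloosterman_index (k, d, l)"
      by (simp add: ce kloosterman_index_def a_def ck [symmetric] del: of_nat_Suc)
    moreover have "(k, d, l) \<in> A" using d_range cop by (simp add: A_def ck [symmetric] del: of_nat_Suc)
    ultimately show "q \<in> kloosterman_index ` A" by blast
  qed
qed


lemma integral_int_shift:
  fixes f :: "real \<Rightarrow> complex"
  assumes "\<And>A. continuous_on A f"
  shows "integral {0..1} (\<lambda>x. f (x + of_int l)) = integral {of_int l..of_int l + 1} f"
proof -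
  have "(f has_integral integral {of_int l..of_int l + 1} f) (cbox (of_int l) (of_int l + 1))"
    using assms by (auto intro!: integrable_integral integrable_continuous_real)
  from has_integral_affinity'[OF this, of 1 "of_int l"] show ?thesis
    by (simp add: integral_unique)
qed

lemma sum_integral_int_intervals:
  fixes f :: "real \<Rightarrow> complex"
  assumes "\<And>A. continuous_on A f"
  shows "(\<Sum>l\<in>{- int N..<int N}. integral {of_int l..of_int l + 1} f) = integral {- real N..real N} f"
proof (induction N)
  case (Suc N)
  have int: "f integrable_on {a..b}" for a b
    using assms by (intro integrable_continuous_real)
  have "{- int (Suc N)..<int (Suc N)} = insert (int N) (insert (- int N - 1) {- int N..<int N})" by auto
  hence "(\<Sum>l\<in>{- int (Suc N)..<int (Suc N)}. integral {of_int l..of_int l + 1} f) =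
          integral {real N..real N + 1} f + (integral {- real N - 1..- real N} f + integral {- real N..real N} f)"
    using Suc by simp
  also have "integral {- real N - 1..- real N} f + integral {- real N..real N} f = integral {- real N - 1..real N} f"
    by (rule Henstock_Kurzweil_Integration.integral_combine) (use int in auto)
  also have "integral {real N..real N + 1} f + integral {- real N - 1..real N} f = integral {- real N - 1..real N + 1} f"
    by (subst add.commute, rule Henstock_Kurzweil_Integration.integral_combine) (use int in auto)
  also have "- real N - 1 = - real (Suc N)" by simp
  also have "real N + 1 = real (Suc N)" by simp
  finally show ?case .
qed simp

text \<open>Unordered summability allows summation over l first, then over d, then over c. For fixed
  c and d the shifted unit segments tile the line, so the sum over l is the full line
  integral.\<close>

lemma has_sum_rademacher_term:
  assumes n: "n > 0" and y: "y > 0"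
    and I: "((\<lambda>p. integral {0..1} (\<lambda>x. poincare_phi n p (Complex x y))) has_sum I) {p \<in> coprime_pairs. fst p > 0}"
  shows "((\<lambda>k. 1 / (of_real pi * of_real (sqrt 2)) * rademacher_term n (Suc k)) has_sum (- I)) UNIV"
proof -
  define D where "D = (\<lambda>k. {d \<in> {0..<int (Suc k)}. coprime (int (Suc k)) d})"
  define g where "g = (\<lambda>p. integral {0..1} (\<lambda>x. poincare_phi n p (Complex x y)))"
  define T where "T = (\<lambda>k d. exp (of_real pi * \<i> / 4) * kloosterman_summand n (int (Suc k)) d *
    of_real (sqrt (real (Suc k)) / (pi * sqrt 2) * rademacher_deriv n (Suc k)))"
  have fin: "finite (D k)" for k
    unfolding D_def by (rule finite_subset[of _ "{0..<int (Suc k)}"]) auto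
  have sum: "((\<lambda>q. g (kloosterman_index q)) has_sum I) (SIGMA k:UNIV. D k \<times> UNIV)"
    using I has_sum_reindex_bij_betw[OF bij_betw_kloosterman_index, of g I] by (simp add: g_def D_def)
  have summ: "(\<lambda>(d, l). g (kloosterman_index (k, d, l))) summable_on (D k \<times> UNIV)" for k
    using summable_on_SigmaD1[of "\<lambda>k q. g (kloosterman_index (k, q))" UNIV "\<lambda>k. D k \<times> UNIV" k] sum
    by (auto simp: summable_on_def case_prod_unfold)
  have inner: "((\<lambda>l. g (kloosterman_index (k, d, l))) has_sum (- T k d)) UNIV" if d: "d \<in> D k" for k d
  proof -
    define a where "a = kloosterman_matrix (int (Suc k)) d $ 1 $ 1"
    define f where "f = (\<lambda>x. poincare_phi n (int (Suc k), - a) (Complex x y))"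
    have cd: "coprime (int (Suc k)) d" using d by (simp add: D_def)
    obtain b where b: "a * d - b * int (Suc k) = 1"
      using kloosterman_matrix_inverse[OF cd] unfolding a_def by blast
    have "(- d) * (- a) - b * int (Suc k) = 1" using b by (simp add: mult.commute)
    hence cp: "(int (Suc k), - a) \<in> coprime_pairs" by (rule coprime_pairsI)
    have cont: "continuous_on A f" for A
      unfolding f_def by (rule continuous_on_poincare_phi[OF cp y])
    have g_eq: "g (kloosterman_index (k, d, l)) = integral {of_int l..of_int l + 1} f" for l
    proof -
      have "poincare_phi n (int (Suc k), int (Suc k) * l + - a) (Complex x y) = f (x + of_int l)" for x
      proof -
        have "Complex (x + of_int l) y = Complex x y + of_int l" by (simp add: complex_eq_iff)
        thus ?thesis using poincare_phi_add_int[OF cp, of "Complex x y" n l] y by (simp add: f_def)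
      qed
      hence "g (kloosterman_index (k, d, l)) = integral {0..1} (\<lambda>x. f (x + of_int l))"
        by (simp only: g_def kloosterman_index_def prod.case a_def [symmetric])
      thus ?thesis using integral_int_shift[OF cont] by simp
    qed
    have "(\<lambda>l. g (kloosterman_index (k, d, l))) summable_on UNIV"
      using summable_on_SigmaD1[of "\<lambda>d l. g (kloosterman_index (k, d, l))" "D k" "\<lambda>_. UNIV" d] summ[of k] d
      by simp
    then obtain S where S: "((\<lambda>l. g (kloosterman_index (k, d, l))) has_sum S) UNIV"
      by (auto simp: summable_on_def)
    \<comment> \<open>The symmetric sums over l are integrals over [- N, N], so the unordered sum
      and the Lebesgue integral are limits of the same sequence.\<close>
    have "(\<lambda>N. integral {- real N..real N} f) \<longlonglongrightarrow> S"
      using has_sum_int_imp_LIMSEQ[OF S] by (simp only: g_eq sum_integral_int_intervals[OF cont])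
    moreover have "(\<lambda>N. integral {- real N..real N} f) \<longlonglongrightarrow> (LINT x|lborel. f x)"
      unfolding f_def a_def
      by (rule LIMSEQ_integral_symmetric, rule poincare_phi_line_integral(1)) (use n y cd in auto)
    ultimately have "S = (LINT x|lborel. f x)" by (rule LIMSEQ_unique)
    also have "\<dots> = - T k d"
      unfolding f_def a_def T_def by (rule poincare_phi_line_integral(2)) (use n y cd in auto)
    finally show ?thesis using S by simp
  qed
  have "((\<lambda>k. \<Sum>d\<in>D k. - T k d) has_sum I) UNIV"
  proof (rule has_sum_SigmaD[OF sum])
    fix k :: nat
    obtain X where X: "((\<lambda>q. g (kloosterman_index (k, q))) has_sum X) (D k \<times> UNIV)"
      using summ[of k] by (auto simp: summable_on_def case_prod_unfold)
    have "((\<lambda>d. - T k d) has_sum X) (D k)"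
      by (rule has_sum_SigmaD[OF X]) (use inner in auto)
    hence "X = (\<Sum>d\<in>D k. - T k d)" using fin has_sum_finite has_sum_unique by blast
    thus "((\<lambda>q. g (kloosterman_index (k, q))) has_sum (\<Sum>d\<in>D k. - T k d)) (D k \<times> UNIV)"
      using X by simp
  qed
  hence "((\<lambda>k. - (\<Sum>d\<in>D k. - T k d)) has_sum (- I)) UNIV"
    by (simp only: has_sum_uminus minus_minus)
  moreover have "- (\<Sum>d\<in>D k. - T k d) = 1 / (of_real pi * of_real (sqrt 2)) * rademacher_term n (Suc k)" for k
    unfolding rademacher_term_eq by (simp add: sum_negf T_def D_def)
  ultimately show ?thesis by (simp only:)
qed

section \<open>Uniform estimates and the limit of large imaginary part\<close>

text \<open>For c >= 1 and y >= 1 one has |c tau + d| >= y, which bounds the exponential of Im (M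
  tau). All growth in y then comes from q^(-1/24), of size exp(pi y / 12).\<close>

lemma norm_poincare_phi_le:
  assumes "n > 0"
  obtains C where "C > 0" "\<And>x y p. 0 \<le> x \<Longrightarrow> x \<le> 1 \<Longrightarrow> y \<ge> 1 \<Longrightarrow> p \<in> coprime_pairs \<Longrightarrow> fst p > 0 \<Longrightarrow>
    norm (poincare_phi n p (Complex x y)) \<le> C * exp (pi * y / 12) * lattice_weight p"
proof -
  \<comment> \<open>The constant of \<open>lattice_bound\<close> with y = 1 and R = 2, as |x + i| <=
    2 for x in [0, 1].\<close>
  define K :: real where "K = 1 / 1 ^ 2 + (1 + 2 / 1) ^ 2"
  define C where "C = exp (2 * pi * (real n - 1 / 24)) * K powr (5 / 2 / 2)"
  have "norm (poincare_phi n p (Complex x y)) \<le> C * exp (pi * y / 12) * lattice_weight p"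
    if x: "0 \<le> x" "x \<le> 1" and y: "y \<ge> 1" and p: "p \<in> coprime_pairs" "fst p > 0" for x y p
  proof -
    obtain c d where cd: "p = (c, d)" by (cases p)
    define \<tau> where "\<tau> = Complex x y"
    define N where "N = norm (of_int c * \<tau> + of_int d)"
    define N1 where "N1 = norm (of_int c * Complex x 1 + of_int d)"
    have c: "c > 0" using p cd by simp
    have im: "Im \<tau> > 0" using y by (simp add: \<tau>_def)
    have "1 \<le> real_of_int c" using c by simp
    hence "1 * y \<le> of_int c * y" using y by (intro mult_right_mono) auto
    also have "\<dots> = \<bar>Im (of_int c * \<tau> + of_int d)\<bar>" using c y by (simp add: \<tau>_def)
    also have "\<dots> \<le> N" unfolding N_def by (rule abs_Im_le_cmod)
    finally have yN: "y \<le> N" by simp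
    have "1 \<le> \<bar>Im (of_int c * Complex x 1 + of_int d)\<bar>" using c by simp
    also have "\<dots> \<le> N1" unfolding N1_def by (rule abs_Im_le_cmod)
    finally have N1: "N1 \<ge> 1" .
    \<comment> \<open>Raising the point from height 1 to y only increases the modulus, so the
      lattice bound is applied at height 1 and stays uniform in y.\<close>
    have "N1 \<le> N"
    proof -
      have "(of_int c * 1) ^ 2 \<le> (of_int c * y) ^ 2" using c y by (intro power_mono mult_left_mono) auto
      thus ?thesis unfolding N_def N1_def \<tau>_def cmod_def by (intro real_sqrt_le_mono) simp
    qed
    have "norm (poincare_phi n p \<tau>) = norm (poincare_term n p \<tau>) * norm (dedekind_eta \<tau>) * norm (q_power (- (1 / 24)) \<tau>)"
    proof -
      have "euler_prod (q_power 1 \<tau>) = dedekind_eta \<tau> * q_power (- (1 / 24)) \<tau>"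
        by (simp add: dedekind_eta_eq q_power_minus)
      thus ?thesis by (simp add: poincare_phi_def norm_mult mult.assoc)
    qed
    also have "norm (poincare_term n p \<tau>) * norm (dedekind_eta \<tau>) =
           exp (2 * pi * (real n - 1 / 24) * (Im \<tau> / N ^ 2)) * N powr (- (5 / 2))"
      unfolding cd N_def by (rule norm_poincare_term) (use p cd im in auto)
    also have "norm (q_power (- (1 / 24)) \<tau>) = exp (pi * y / 12)"
      by (simp add: norm_q_power \<tau>_def)
    finally have norm_eq: "norm (poincare_phi n p \<tau>) =
        exp (2 * pi * (real n - 1 / 24) * (Im \<tau> / N ^ 2)) * N powr (- (5 / 2)) * exp (pi * y / 12)" .
    have le1: "exp (2 * pi * (real n - 1 / 24) * (Im \<tau> / N ^ 2)) \<le> exp (2 * pi * (real n - 1 / 24) * 1)"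
    proof -
      have "y * 1 \<le> N * N" using yN y by (intro mult_mono) auto
      hence "Im \<tau> / N ^ 2 \<le> 1" using yN y by (simp add: \<tau>_def power2_eq_square divide_le_eq)
      moreover have "real n \<ge> 1" using assms by simp
      ultimately show ?thesis by (intro exp_le_cancel_iff[THEN iffD2] mult_left_mono) auto
    qed
    have "N powr (- (5 / 2)) \<le> N1 powr (- (5 / 2))"
      using \<open>N1 \<le> N\<close> N1 by (intro powr_mono2') auto
    also have "N1 powr (- (5 / 2)) \<le> K powr (5 / 2 / 2) * lattice_weight (c, d)"
      unfolding N1_def K_def
    proof (rule norm_lattice_powr_le)
      have "norm (Complex x 1) \<le> \<bar>Re (Complex x 1)\<bar> + \<bar>Im (Complex x 1)\<bar>" by (rule cmod_le)
      thus "norm (Complex x 1) \<le> 2" using x by simp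
    qed (use c in auto)
    finally have le2: "N powr (- (5 / 2)) \<le> K powr (5 / 2 / 2) * lattice_weight (c, d)" .
    have "norm (poincare_phi n p \<tau>) \<le>
            exp (2 * pi * (real n - 1 / 24) * 1) * (K powr (5 / 2 / 2) * lattice_weight (c, d)) * exp (pi * y / 12)"
      unfolding norm_eq by (intro mult_right_mono mult_mono le1 le2) auto
    also have "\<dots> = C * exp (pi * y / 12) * lattice_weight p"
      by (simp add: C_def cd mult_ac)
    finally show ?thesis by (simp only: \<tau>_def)
  qed
  moreover have "C > 0" unfolding C_def K_def by simp
  ultimately show ?thesis using that by blast
qed


text \<open>The function has value 1 and a derivative at 0; any D above the modulus of that
  derivative works near 0.\<close>

lemma inverse_euler_prod_near_0:
  obtains \<delta> D where "\<delta> > 0" "D > 0"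
    "\<And>q. 0 < norm q \<Longrightarrow> norm q < \<delta> \<Longrightarrow> norm (inverse (euler_prod q) - 1) \<le> D * norm q"
proof -
  define f where "f = (\<lambda>q. inverse (euler_prod q))"
  have "f holomorphic_on ball 0 1"
    unfolding f_def by (intro holomorphic_intros holomorphic_euler_prod euler_prod_nonzero) auto
  hence "(f has_field_derivative deriv f 0) (at 0)"
    by (rule holomorphic_derivI) auto
  hence lim: "((\<lambda>q. (f q - f 0) / q) \<longlongrightarrow> deriv f 0) (at 0)"
    by (simp add: has_field_derivative_iff)
  define D where "D = norm (deriv f 0) + 1"
  have "\<forall>\<^sub>F q in at 0. norm ((f q - f 0) / q) < D"
    by (rule order_tendstoD(2)[OF tendsto_norm[OF lim]]) (simp add: D_def)
  then obtain \<delta> where \<delta>: "\<delta> > 0" "\<And>q. q \<noteq> 0 \<Longrightarrow> norm q < \<delta> \<Longrightarrow> norm ((f q - f 0) / q) < D"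
    unfolding eventually_at by auto
  have "f 0 = 1" by (simp add: f_def euler_prod_def)
  have "norm (inverse (euler_prod q) - 1) \<le> D * norm q" if "0 < norm q" "norm q < \<delta>" for q
  proof -
    have "norm ((f q - 1) / q) < D" using \<delta>(2)[of q] that \<open>f 0 = 1\<close> by auto
    thus ?thesis using that by (simp add: norm_divide divide_less_eq f_def)
  qed
  moreover have "D > 0" unfolding D_def by (intro add_nonneg_pos) auto
  ultimately show ?thesis using that \<delta>(1) by blast
qed

text \<open>The pairs (c, d) and (- c, - d) give equal terms, which accounts for the division by 2;
  the only pairs with c = 0 are (0, 1) and (0, -1), and each contributes the seed.\<close>

lemma has_sum_poincare_series_split:
  assumes "Im \<tau> > 0" "n > 0"
  shows "((\<lambda>p. poincare_term n p \<tau>) has_sum (poincare_series n \<tau> / 2 - seed n \<tau>)) {p \<in> coprime_pairs. fst p > 0}"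
proof -
  define A where "A = {p \<in> coprime_pairs. fst p > 0}"
  define B where "B = {p \<in> coprime_pairs. fst p < 0}"
  have total: "((\<lambda>p. poincare_term n p \<tau>) has_sum poincare_series n \<tau>) coprime_pairs"
    by (rule has_sum_poincare_series[OF assms])
  have "(\<lambda>p. poincare_term n p \<tau>) summable_on A"
    by (rule summable_on_subset_banach[of _ coprime_pairs]) (use total in \<open>auto simp: summable_on_def A_def\<close>)
  then obtain P where P: "((\<lambda>p. poincare_term n p \<tau>) has_sum P) A" by (auto simp: summable_on_def)
  have neg: "((\<lambda>p. poincare_term n p \<tau>) has_sum P) B"
  proof -
    have "bij_betw (\<lambda>(c, d). (- c, - d)) A B"
      by (rule bij_betwI[where g = "\<lambda>(c, d). (- c, - d)"]) (auto simp: A_def B_def coprime_pairs_def)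
    from has_sum_reindex_bij_betw[OF this, of "\<lambda>p. poincare_term n p \<tau>" P]
    have "((\<lambda>p. poincare_term n p \<tau>) has_sum P) B \<longleftrightarrow>
            ((\<lambda>p. poincare_term n (case p of (c, d) \<Rightarrow> (- c, - d)) \<tau>) has_sum P) A" by simp
    also have "\<dots> \<longleftrightarrow> ((\<lambda>p. poincare_term n p \<tau>) has_sum P) A"
    proof (rule has_sum_cong)
      fix p assume "p \<in> A"
      thus "poincare_term n (case p of (c, d) \<Rightarrow> (- c, - d)) \<tau> = poincare_term n p \<tau>"
        using poincare_term_uminus[of "fst p" "snd p" \<tau> n] assms by (cases p) (simp add: A_def)
    qed
    finally show ?thesis using P by simp
  qed
  have t1: "poincare_term n (0, 1) \<tau> = seed n \<tau>"
    using poincare_term_eq[of 1 1 0 0 \<tau> n] assms by simp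
  have t2: "poincare_term n (0, - 1) \<tau> = seed n \<tau>"
    using poincare_term_uminus[of 0 1 \<tau> n] t1 assms by (simp add: coprime_pairs_def)
  have zero: "((\<lambda>p. poincare_term n p \<tau>) has_sum (2 * seed n \<tau>)) {(0, 1), (0, - 1)}"
    using has_sum_finite[of "{(0, 1), (0, - 1)}" "\<lambda>p. poincare_term n p \<tau>"] by (simp add: t1 t2)
  have "((\<lambda>p. poincare_term n p \<tau>) has_sum (P + (P + 2 * seed n \<tau>))) (A \<union> (B \<union> {(0, 1), (0, - 1)}))"
    by (intro has_sum_Un_disjoint P neg zero) (auto simp: A_def B_def)
  also have "A \<union> (B \<union> {(0, 1), (0, - 1)}) = coprime_pairs"
  proof (intro equalityI subsetI)
    fix p assume p: "p \<in> coprime_pairs"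
    obtain c d where cd: "p = (c, d)" by (cases p)
    show "p \<in> A \<union> (B \<union> {(0, 1), (0, - 1)})"
    proof (cases "c = 0")
      case True
      hence "\<bar>d\<bar> = 1" using p by (simp add: coprime_pairs_def cd)
      thus ?thesis using True by (auto simp: cd abs_if split: if_splits)
    qed (use p cd in \<open>auto simp: A_def B_def\<close>)
  qed (auto simp: A_def B_def coprime_pairs_def)
  finally have "poincare_series n \<tau> = P + (P + 2 * seed n \<tau>)"
    using total has_sum_unique by blast
  hence "P = poincare_series n \<tau> / 2 - seed n \<tau>" by (simp add: field_simps)
  thus ?thesis using P by (simp add: A_def)
qed

text \<open>At each height y the sum I of the integrals of \<open>poincare_phi\<close> is within a
  decaying error of - p(n). By \<open>has_sum_rademacher_term\<close>, - I is the sum of one and the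
  same series for all y, so the error must be 0.\<close>

lemma has_sum_rademacher:
  assumes n: "n > 0"
  shows "((\<lambda>k. 1 / (of_real pi * of_real (sqrt 2)) * rademacher_term n (Suc k)) has_sum of_nat (partition_count n)) UNIV"
proof -
  define A where "A = {p \<in> coprime_pairs. fst p > 0}"
  have A: "A \<subseteq> coprime_pairs" by (auto simp: A_def)
  obtain C where C: "C > 0" "\<And>x y p. 0 \<le> x \<Longrightarrow> x \<le> 1 \<Longrightarrow> y \<ge> 1 \<Longrightarrow> p \<in> coprime_pairs \<Longrightarrow> fst p > 0 \<Longrightarrow>
    norm (poincare_phi n p (Complex x y)) \<le> C * exp (pi * y / 12) * lattice_weight p"
    using norm_poincare_phi_le[OF n] by blast
  obtain \<delta> D where \<delta>: "\<delta> > 0" "D > 0"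
    "\<And>q. 0 < norm q \<Longrightarrow> norm q < \<delta> \<Longrightarrow> norm (inverse (euler_prod q) - 1) \<le> D * norm q"
    using inverse_euler_prod_near_0 by blast
  obtain W where W: "(lattice_weight has_sum W) A"
    using summable_lattice_weight by (auto simp: summable_on_def)
  have W0: "W \<ge> 0" by (rule has_sum_nonneg[OF W]) (simp add: less_imp_le[OF lattice_weight_pos])
  have key: "\<exists>I. ((\<lambda>p. integral {0..1} (\<lambda>x. poincare_phi n p (Complex x y))) has_sum I) A \<and>
       (exp (- 2 * pi * y) < \<delta> \<longrightarrow>
         norm (I + of_nat (partition_count n)) \<le> C * W * D * (exp (pi * y / 12) * exp (- 2 * pi * y)))"
    if y: "y \<ge> 1" for y
  proof -
    define E where "E = (\<lambda>x. euler_prod (q_power 1 (Complex x y)))"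
    define R where "R = (\<lambda>x. \<Sum>\<^sub>\<infinity>p\<in>A. poincare_phi n p (Complex x y))"
    have E0: "E x \<noteq> 0" for x unfolding E_def by (rule euler_prod_nonzero, rule q_power_1_in_ball) (use y in simp)
    have bd: "norm (poincare_phi n p (Complex x y)) \<le> C * exp (pi * y / 12) * lattice_weight p"
      if "p \<in> A" "x \<in> {0..1}" for p x
      using C(2)[of x y p] that y by (simp add: A_def)
    have summ: "(\<lambda>p. C * exp (pi * y / 12) * lattice_weight p) summable_on A"
      by (intro summable_on_cmult_right summable_lattice_weight)
    have "uniform_limit {0..1} (\<lambda>X x. \<Sum>p\<in>X. poincare_phi n p (Complex x y)) R (finite_subsets_at_top A)"
      unfolding R_def by (rule Weierstrass_m_test_general[OF bd summ])
    \<comment> \<open>The limit theorem for integrals wants continuity for every index X, not only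
      eventually; intersecting with A secures it.\<close>
    hence ulim: "uniform_limit {0..1} (\<lambda>X x. \<Sum>p\<in>X \<inter> A. poincare_phi n p (Complex x y)) R (finite_subsets_at_top A)"
    proof (rule uniform_limit_cong[THEN iffD1, rotated 2])
      show "\<forall>\<^sub>F X in finite_subsets_at_top A. \<forall>x\<in>{0..1}.
              (\<Sum>p\<in>X. poincare_phi n p (Complex x y)) = (\<Sum>p\<in>X \<inter> A. poincare_phi n p (Complex x y))"
        by (intro eventually_finite_subsets_at_top_weakI) (auto simp: Int_absorb2)
    qed simp
    have cont: "continuous_on {0..1} (\<lambda>x. \<Sum>p\<in>X \<inter> A. poincare_phi n p (Complex x y))" for X
      by (intro continuous_intros continuous_on_poincare_phi) (use y A in auto)
    obtain J I where J: "\<And>X. ((\<lambda>x. \<Sum>p\<in>X \<inter> A. poincare_phi n p (Complex x y)) has_integral J X) {0..1}"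
      and I: "(R has_integral I) {0..1}" and lim: "(J \<longlongrightarrow> I) (finite_subsets_at_top A)"
      using uniform_limit_integral[OF ulim cont] by auto
    have "((\<lambda>p. integral {0..1} (\<lambda>x. poincare_phi n p (Complex x y))) has_sum I) A"
      unfolding has_sum_def
    proof (rule Lim_transform_eventually[OF lim], rule eventually_finite_subsets_at_top_weakI)
      fix X assume X: "finite X" "X \<subseteq> A"
      have "((\<lambda>x. \<Sum>p\<in>X \<inter> A. poincare_phi n p (Complex x y)) has_integral
               (\<Sum>p\<in>X \<inter> A. integral {0..1} (\<lambda>x. poincare_phi n p (Complex x y)))) {0..1}"
        by (intro has_integral_sum integrable_integral integrable_continuous_real continuous_on_poincare_phi)
           (use X y A in auto)
      with J[of X] have "J X = (\<Sum>p\<in>X \<inter> A. integral {0..1} (\<lambda>x. poincare_phi n p (Complex x y)))"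
        by (rule has_integral_unique)
      thus "J X = (\<Sum>p\<in>X. integral {0..1} (\<lambda>x. poincare_phi n p (Complex x y)))"
        using X by (simp add: Int_absorb2)
    qed
    moreover have "norm (I + of_nat (partition_count n)) \<le> C * W * D * (exp (pi * y / 12) * exp (- 2 * pi * y))"
      if small: "exp (- 2 * pi * y) < \<delta>"
    proof -
      have "((\<lambda>x. poincare_series n (Complex x y)) has_integral 0) {0..1}"
        by (rule weight_2_horizontal_integral[OF holomorphic_poincare_series[OF n]])
           (use poincare_series_add_1 poincare_series_S y in auto)
      from has_integral_mult_right[OF this, of "1 / 2"]
      have H0: "((\<lambda>x. 1 / 2 * poincare_series n (Complex x y)) has_integral 0) {0..1}" by simp
      have "y > 0" using y by simp
      from has_integral_partition_count[OF this, of n]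
      have S: "((\<lambda>x. seed n (Complex x y)) has_integral of_nat (partition_count n)) {0..1}"
        by (simp add: seed_def q_power_def mult_ac)
      \<comment> \<open>The factor 1 / E is common to all p and comes out of the sum.\<close>
      have P: "1 / 2 * poincare_series n (Complex x y) - seed n (Complex x y) = R x * inverse (E x)" for x
      proof -
        have "((\<lambda>p. poincare_term n p (Complex x y)) has_sum (poincare_series n (Complex x y) / 2 - seed n (Complex x y))) A"
          unfolding A_def by (rule has_sum_poincare_series_split) (use y n in auto)
        hence "((\<lambda>p. poincare_term n p (Complex x y) * E x) has_sum
                 ((poincare_series n (Complex x y) / 2 - seed n (Complex x y)) * E x)) A"
          by (rule has_sum_cmult_left)
        hence "R x = (poincare_series n (Complex x y) / 2 - seed n (Complex x y)) * E x"
          unfolding R_def poincare_phi_def E_def by (rule infsumI)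
        thus ?thesis using E0[of x] by simp
      qed
      \<comment> \<open>Half the series integrates to 0 and the seed to p(n), so the integral of R /
        E is - p(n); what separates I from it is R (1 - 1 / E).\<close>
      have "((\<lambda>x. R x - (1 / 2 * poincare_series n (Complex x y) - seed n (Complex x y))) has_integral
               (I - (0 - of_nat (partition_count n)))) {0..1}"
        by (intro has_integral_diff I H0 S)
      hence int: "((\<lambda>x. R x - R x * inverse (E x)) has_integral (I + of_nat (partition_count n))) {0..1}"
        unfolding P by simp
      have "norm (R x - R x * inverse (E x)) \<le> C * W * D * (exp (pi * y / 12) * exp (- 2 * pi * y))"
        if x: "x \<in> {0..1}" for x
      proof -
        have "(\<lambda>p. norm (poincare_phi n p (Complex x y))) summable_on A"
          by (rule summable_on_comparison_test[OF summ]) (use bd x in auto)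
        hence "((\<lambda>p. poincare_phi n p (Complex x y)) has_sum R x) A"
          unfolding R_def by (rule has_sum_infsum[OF abs_summable_summable])
        from norm_infsum_le[OF this has_sum_cmult_right[OF W, of "C * exp (pi * y / 12)"]]
        have R: "norm (R x) \<le> C * exp (pi * y / 12) * W" using bd x by simp
        have "norm (q_power 1 (Complex x y)) = exp (- 2 * pi * y)" by (simp add: norm_q_power)
        hence "norm (inverse (E x) - 1) \<le> D * exp (- 2 * pi * y)"
          using \<delta>(3)[of "q_power 1 (Complex x y)"] small by (simp add: E_def)
        hence "norm (R x) * norm (inverse (E x) - 1) \<le> (C * exp (pi * y / 12) * W) * (D * exp (- 2 * pi * y))"
          using R C(1) W0 by (intro mult_mono) auto
        moreover have "norm (R x - R x * inverse (E x)) = norm (R x) * norm (inverse (E x) - 1)"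
        proof -
          have "R x - R x * inverse (E x) = R x * (1 - inverse (E x))" by (simp add: algebra_simps)
          thus ?thesis by (simp only: norm_mult norm_minus_commute)
        qed
        ultimately show ?thesis by (simp add: mult_ac)
      qed
      hence "norm (I + of_nat (partition_count n)) \<le>
               (C * W * D * (exp (pi * y / 12) * exp (- 2 * pi * y))) * measure lborel (cbox 0 (1::real))"
        using int C(1) W0 \<delta>(2) by (intro has_integral_bound) auto
      thus ?thesis by simp
    qed
    ultimately show ?thesis by blast
  qed
  define T where "T = (\<lambda>k. 1 / (of_real pi * of_real (sqrt 2)) * rademacher_term n (Suc k))"
  have T: "(T has_sum (- I)) UNIV"
    if "((\<lambda>p. integral {0..1} (\<lambda>x. poincare_phi n p (Complex x y))) has_sum I) A" "y \<ge> 1" for I y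
    unfolding T_def by (rule has_sum_rademacher_term[OF n, of y]) (use that in \<open>auto simp: A_def\<close>)
  obtain I where I: "((\<lambda>p. integral {0..1} (\<lambda>x. poincare_phi n p (Complex x 1))) has_sum I) A"
    using key[of 1] by auto
  have bound: "norm (I + of_nat (partition_count n)) \<le> C * W * D * (exp (pi * y / 12) * exp (- 2 * pi * y))"
    if y: "y \<ge> 1" "exp (- 2 * pi * y) < \<delta>" for y
  proof -
    obtain I' where I': "((\<lambda>p. integral {0..1} (\<lambda>x. poincare_phi n p (Complex x y))) has_sum I') A"
      "norm (I' + of_nat (partition_count n)) \<le> C * W * D * (exp (pi * y / 12) * exp (- 2 * pi * y))"
      using key[OF y(1)] y(2) by blast
    \<comment> \<open>Both are the sum of the series T, in which y does not occur.\<close>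
    have "- I' = - I" using T[OF I'(1) y(1)] T[OF I order_refl] has_sum_unique by blast
    thus ?thesis using I'(2) by simp
  qed
  have "norm (I + of_nat (partition_count n)) \<le> 0"
  proof (rule tendsto_lowerbound)
    show "((\<lambda>y. C * W * D * (exp (pi * y / 12) * exp (- 2 * pi * y))) \<longlongrightarrow> 0) at_top"
    proof -
      \<comment> \<open>The gain q from the Euler product outweighs the growth of q^(-1/24), as 1 /
        12 < 2.\<close>
      have "((\<lambda>y. exp (pi * y / 12) * exp (- 2 * pi * y)) \<longlongrightarrow> 0) at_top" by real_asymp
      from tendsto_mult_left[OF this, of "C * W * D"] show ?thesis by simp
    qed
    have "((\<lambda>y. exp (- 2 * pi * y)) \<longlongrightarrow> 0) at_top" by real_asymp
    hence "\<forall>\<^sub>F y in at_top. exp (- 2 * pi * y) < \<delta>" by (rule order_tendstoD) (use \<delta> in simp)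
    thus "\<forall>\<^sub>F y in at_top. norm (I + of_nat (partition_count n)) \<le> C * W * D * (exp (pi * y / 12) * exp (- 2 * pi * y))"
      using eventually_ge_at_top[of 1] by eventually_elim (rule bound)
  qed simp
  hence "- I = of_nat (partition_count n)" by (simp add: add_eq_0_iff)
  thus ?thesis using T[OF I order_refl] by (simp add: T_def)
qed

theorem theorem1:
  fixes n :: nat
  assumes "n > 0"
  shows "summable (\<lambda>k. rademacher_term n (Suc k)) \<and>
         of_nat (partition_count n) =
           1 / (of_real pi * of_real (sqrt 2)) * (\<Sum>k. rademacher_term n (Suc k))"
proof -
  have nz: "complex_of_real pi * complex_of_real (sqrt 2) \<noteq> 0" by simp
  have "(\<lambda>k. 1 / (of_real pi * of_real (sqrt 2)) * rademacher_term n (Suc k)) sums of_nat (partition_count n)"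
    by (rule has_sum_imp_sums[OF has_sum_rademacher[OF assms]])
  from sums_mult[OF this, of "of_real pi * of_real (sqrt 2)"]
  have "(\<lambda>k. rademacher_term n (Suc k)) sums (of_real pi * of_real (sqrt 2) * of_nat (partition_count n))"
    by simp
  thus ?thesis using nz by (simp add: sums_iff)
qed

end
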